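(* Let $l\ge2$ and let $\mathcal D=\mathcal D(\mathcal E,\Pi,a,k,g)$ be a quasi-elliptic base system (QEBS) which is $A_l^{(1,1)}$, i.e. the affine Cartan matrix $A=(J(\alpha^\vee,\beta))_{\alpha,\beta\in\Pi}$ is of type $A_l^{(1)}$. Let $\mathfrak g'_{\mathcal D}$ be a Lie superalgebra satisfying: (UI1) $\mathfrak g'_{\mathcal D}$ includes $\mathfrak h_{\mathcal D}=\{h_\sigma\mid\sigma\in\mathcal E\}$ as a sub Lie superalgebra. (UI2) With $\mathfrak g'_{\mathcal D,\mu}=\{X\in\mathfrak g'_{\mathcal D}\mid[h_\sigma,X]=J(\sigma,\mu)X\ \forall\sigma\in\mathcal E\}$, $$\mathfrak g'_{\mathcal D}=\mathfrak h_{\mathcal D}\oplus\Bigl(\bigoplus_{\nu\in R(k,g)}\mathfrak g'_{\mathcal D,\nu}\Bigr)\oplus\Bigl(\bigoplus_{(m,n)\in\mathbb Z^2\setminus\{(0,0)\}}\mathfrak g'_{\mathcal D,m\delta+na}\Bigr),$$ and $\dim\mathfrak g'_{\mathcal D,\nu}=1$ for $\nu\in R(k,g)$. (UI3) $\mathfrak g'_{\mathcal D}$ is generated by $\mathfrak h_{\mathcal D}$ and the $\mathfrak g'_{\mathcal D,\nu}$ with $\nu\in R(k,g)$. (UI4) There exists an invariant form $J'$ on $\mathfrak g'_{\mathcal D}$ such that $J'(h_\sigma,h_\tau)=J(\sigma,\tau)$ for $\sigma,\tau\in\mathcal E$ and $\ker J'\subset\bigoplus_{(m,n)\in\mathbb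 Z^2\setminus\{(0,0)\}}\mathfrak g'_{\mathcal D,m\delta+na}$. Then there exist a $q\in\mathbb C\setminus\{0\}$ and an epimorphism $\eta:\mathfrak g^q_{\mathcal D}\to\mathfrak g'_{\mathcal D}$ such that $\eta(h_\sigma)=h_\sigma$ for $\sigma\in\mathcal E$ and $J'\circ(\eta\times\eta)=J$, where $J$ on $\mathfrak g^q_{\mathcal D}$ is the invariant form with $J(h_\sigma,h_\tau)=J(\sigma,\tau)$.
   Context: All vector spaces and Lie superalgebras are over $\mathbb C$. $\mathbb Z_+=\{0,1,2,\dots\}$. An invariant form on a Lie superalgebra is a supersymmetric bilinear form $B$ with $B([X,Y],Z)=B(X,[Y,Z])$; $\ker B=\{X\mid B(X,\cdot)=0\}$. **The base system of type $A_l^{(1,1)}$ ($l\ge2$).** $\mathcal E$ is an $(l+4)$-dimensional $\mathbb C$-vector space with a nondegenerate symmetric bilinear form $J$ and basis $\{\alpha_0,\dots,\alpha_l,\Lambda_\delta,a,\Lambda_a\}$. For $x$ with $J(x,x)\ne0$ put $x^\vee=2x/J(x,x)$ and $s_x(y)=y-J(x^\vee,y)x$. The matrix $(J(\alpha_i^\vee,\alpha_j))_{0\le i,j\le l}$ is the affine Cartan matrix of type $A_l^{(1)}$ (cyclic numbering: $\alpha_i$ adjacent to $\alpha_{i\pm1}$, indices mod $l+1$); $J(\Lambda_\delta,\Lambda_\delta)=J(a,\alpha_i)=J(a,\Lambda_\delta)=J(a,a)=J(\Lambda_a,\alpha_i)=J(\Lambda_a,\Lambda_a)=0$, $J(\Lambda_a,a)=1$,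 $J(\Lambda_\delta,\alpha_i)=\delta_{i0}$. $\Pi=\{\alpha_0,\dots,\alpha_l\}$, $W=\langle s_\alpha\mid\alpha\in\Pi\rangle$. In this type the QEBS axioms force $k(\alpha)=1$ and $g(\alpha)=\emptyset$ for all $\alpha\in\Pi$ (here $k:\Pi\to\mathbb Z_{>0}$ and $g$, valued in subsets of $\mathbb Z$, are the multiplicity data of a QEBS), so $R(k,g)=\bigcup_{w\in W}w\bigl(\bigcup_{\alpha\in\Pi}(\alpha+\mathbb Za)\bigr)$. $\delta\in\mathbb Z_+\Pi$ is the unique element with $\mathbb Z\delta=\{\lambda\in\mathbb Z\Pi\mid J(\lambda,\lambda)=0\}$ (i.e. $\delta=\sum_i\alpha_i$). **The Lie algebra $\mathfrak g_{\mathcal D}^q$.** Let $q\in\mathbb C\setminus\{0\}$. Put $\alpha^*=\alpha+a$ for $\alpha\in\Pi$, $\Pi^*=\{\alpha^*\mid\alpha\in\Pi\}$, $\mathcal B_+=\Pi\cup\Pi^*$, $\mathcal B=\mathcal B_+\cup-\mathcal B_+$, $(\mathcal B\times\mathcal B)'=\{(\mu,\nu)\in\mathcal B\times\mathcal B\mid\mu\ne\nu,\ \mu+\nu\ne0\}$, and for such $(\mu,\nu)$ let $x_{\mu,\nu}=1-J(\mu^\vee,\nu)$ if $J(\mu^\vee,\nu)<0$ and $x_{\mu,\nu}=1$ otherwise. $\mathfrak g^q_{\mathcal D}$ is the Lie algebra with generators $h_\sigma$ ($\sigma\in\mathcal E$), $E_\mu$ ($\mu\in\mathcal B$) and relations: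 $xh_\sigma+yh_\tau=h_{x\sigma+y\tau}$ ($x,y\in\mathbb C$); $[h_\sigma,h_\tau]=0$; $[h_\sigma,E_\mu]=J(\sigma,\mu)E_\mu$; $[E_\mu,E_{-\mu}]=h_{\mu^\vee}$ ($\mu\in\mathcal B_+$); $(\mathrm{ad}E_\mu)^{x_{\mu,\nu}}E_\nu=0$ for $(\mu,\nu)\in(\mathcal B\times\mathcal B)'$; $[E_{\pm\alpha^*},E_{\pm\beta}]=[E_{\pm\alpha},E_{\pm\beta^*}]$ for $\alpha,\beta\in\Pi$ with $J(\alpha,\beta^\vee)=-1$ and $\{\alpha,\beta\}\ne\{\alpha_0,\alpha_l\}$; and $q^{\pm1}[E_{\pm\alpha_0^*},E_{\pm\alpha_l}]=[E_{\pm\alpha_0},E_{\pm\alpha_l^*}]$. For $q=1$ this is the elliptic Lie algebra $\mathfrak g_{\mathcal D}$. $\mathfrak h_{\mathcal D}$ is the $(l+4)$-dimensional abelian Lie algebra $\{h_\sigma\mid\sigma\in\mathcal E\}$, with $\sigma\mapsto h_\sigma$ a linear isomorphism. $\mathfrak g^q_{\mathcal D}$ carries an invariant form, again denoted $J$, with $J(h_\sigma,h_\tau)=J(\sigma,\tau)$; it is determined by this property. *)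

theory Defs
  imports Complex_Main "HOL-Algebra.Module"
begin

section \<open>Lie superalgebras over the complex numbers\<close>

definition complex_ring :: "complex ring" where
  "complex_ring = \<lparr>carrier = UNIV, mult = (*), one = 1, zero = 0, add = (+)\<rparr>"

text \<open>The fields \<open>mult\<close> and \<open>one\<close> inherited from rings carry no information, as for any module
  in HOL-Algebra. \<open>hpart L False\<close> is the even part of \<open>L\<close> and \<open>hpart L True\<close> the odd part.\<close>

record 'a lsalg = "(complex, 'a) module" +
  bracket :: "'a \<Rightarrow> 'a \<Rightarrow> 'a"
  hpart :: "bool \<Rightarrow> 'a set"

definition koszul_sign :: "bool \<Rightarrow> bool \<Rightarrow> complex" where
  "koszul_sign p r = (if p \<and> r then - 1 else 1)"

locale lie_superalgebra = module complex_ring L for L :: "('a, 'm) lsalg_scheme" (structure) +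
  assumes hpart_submodule: "submodule (hpart L p) complex_ring L"
    and hpart_decomp: "x \<in> carrier L \<Longrightarrow>
      \<exists>!(y, z). y \<in> hpart L False \<and> z \<in> hpart L True \<and> x = y \<oplus> z"
    and bracket_hpart: "\<lbrakk>x \<in> hpart L p; y \<in> hpart L r\<rbrakk> \<Longrightarrow> bracket L x y \<in> hpart L (p \<noteq> r)"
    and bracket_closed: "\<lbrakk>x \<in> carrier L; y \<in> carrier L\<rbrakk> \<Longrightarrow> bracket L x y \<in> carrier L"
    and bracket_add_left: "\<lbrakk>x \<in> carrier L; y \<in> carrier L; z \<in> carrier L\<rbrakk> \<Longrightarrow>
      bracket L (x \<oplus> y) z = bracket L x z \<oplus> bracket L y z"
    and bracket_add_right: "\<lbrakk>x \<in> carrier L; y \<in> carrier L; z \<in> carrier L\<rbrakk> \<Longrightarrow>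
      bracket L x (y \<oplus> z) = bracket L x y \<oplus> bracket L x z"
    and bracket_smult_left: "\<lbrakk>x \<in> carrier L; y \<in> carrier L\<rbrakk> \<Longrightarrow>
      bracket L (c \<odot>\<^bsub>L\<^esub> x) y = c \<odot>\<^bsub>L\<^esub> bracket L x y"
    and bracket_smult_right: "\<lbrakk>x \<in> carrier L; y \<in> carrier L\<rbrakk> \<Longrightarrow>
      bracket L x (c \<odot>\<^bsub>L\<^esub> y) = c \<odot>\<^bsub>L\<^esub> bracket L x y"
    and bracket_skew: "\<lbrakk>x \<in> hpart L p; y \<in> hpart L r\<rbrakk> \<Longrightarrow>
      bracket L x y = (- koszul_sign p r) \<odot>\<^bsub>L\<^esub> bracket L y x"
    and bracket_jacobi: "\<lbrakk>x \<in> hpart L p; y \<in> hpart L r; z \<in> carrier L\<rbrakk> \<Longrightarrow>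
      bracket L x (bracket L y z) =
        bracket L (bracket L x y) z \<oplus> koszul_sign p r \<odot>\<^bsub>L\<^esub> bracket L y (bracket L x z)"

definition bilinear_form :: "('a, 'm) lsalg_scheme \<Rightarrow> ('a \<Rightarrow> 'a \<Rightarrow> complex) \<Rightarrow> bool" where
  "bilinear_form L B \<longleftrightarrow>
    (\<forall>x\<in>carrier L. \<forall>y\<in>carrier L. \<forall>z\<in>carrier L.
        B (x \<oplus>\<^bsub>L\<^esub> y) z = B x z + B y z \<and> B x (y \<oplus>\<^bsub>L\<^esub> z) = B x y + B x z) \<and>
    (\<forall>c. \<forall>x\<in>carrier L. \<forall>y\<in>carrier L.
        B (c \<odot>\<^bsub>L\<^esub> x) y = c * B x y \<and> B x (c \<odot>\<^bsub>L\<^esub> y) = c * B x y)"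

definition invariant_form :: "('a, 'm) lsalg_scheme \<Rightarrow> ('a \<Rightarrow> 'a \<Rightarrow> complex) \<Rightarrow> bool" where
  "invariant_form L B \<longleftrightarrow> bilinear_form L B \<and>
    (\<forall>p r. \<forall>x\<in>hpart L p. \<forall>y\<in>hpart L r. B x y = koszul_sign p r * B y x) \<and>
    (\<forall>x\<in>carrier L. \<forall>y\<in>carrier L. \<forall>z\<in>carrier L. B (bracket L x y) z = B x (bracket L y z))"

definition form_kernel :: "('a, 'm) lsalg_scheme \<Rightarrow> ('a \<Rightarrow> 'a \<Rightarrow> complex) \<Rightarrow> 'a set" where
  "form_kernel L B = {x \<in> carrier L. \<forall>y\<in>carrier L. B x y = 0}"

definition lie_hom :: "('a, 'm) lsalg_scheme \<Rightarrow> ('b, 'n) lsalg_scheme \<Rightarrow> ('a \<Rightarrow> 'b) \<Rightarrow> bool" where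
  "lie_hom L M f \<longleftrightarrow> f \<in> carrier L \<rightarrow> carrier M \<and>
    (\<forall>x\<in>carrier L. \<forall>y\<in>carrier L. f (x \<oplus>\<^bsub>L\<^esub> y) = f x \<oplus>\<^bsub>M\<^esub> f y) \<and>
    (\<forall>c. \<forall>x\<in>carrier L. f (c \<odot>\<^bsub>L\<^esub> x) = c \<odot>\<^bsub>M\<^esub> f x) \<and>
    (\<forall>x\<in>carrier L. \<forall>y\<in>carrier L. f (bracket L x y) = bracket M (f x) (f y)) \<and>
    (\<forall>p. f ` hpart L p \<subseteq> hpart M p)"

definition lie_epi :: "('a, 'm) lsalg_scheme \<Rightarrow> ('b, 'n) lsalg_scheme \<Rightarrow> ('a \<Rightarrow> 'b) \<Rightarrow> bool" where
  "lie_epi L M f \<longleftrightarrow> lie_hom L M f \<and> f ` carrier L = carrier M"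

definition sub_lie_superalgebra :: "'a set \<Rightarrow> ('a, 'm) lsalg_scheme \<Rightarrow> bool" where
  "sub_lie_superalgebra U L \<longleftrightarrow> submodule U complex_ring L \<and>
    (\<forall>x\<in>U. \<exists>y\<in>U \<inter> hpart L False. \<exists>z\<in>U \<inter> hpart L True. x = y \<oplus>\<^bsub>L\<^esub> z) \<and>
    (\<forall>x\<in>U. \<forall>y\<in>U. bracket L x y \<in> U)"

definition lie_generate :: "('a, 'm) lsalg_scheme \<Rightarrow> 'a set \<Rightarrow> 'a set" where
  "lie_generate L S = \<Inter>{U. sub_lie_superalgebra U L \<and> S \<subseteq> U}"

text \<open>\<open>L\<close> is the internal direct sum of the subspaces \<open>V i\<close>, \<open>i \<in> I\<close>: every element has a unique
  expansion as a finite sum; the family \<open>f\<close> is taken to vanish off \<open>I\<close>.\<close>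

definition internal_direct_sum :: "('a, 'm) lsalg_scheme \<Rightarrow> 'i set \<Rightarrow> ('i \<Rightarrow> 'a set) \<Rightarrow> bool" where
  "internal_direct_sum L I V \<longleftrightarrow> (\<forall>i\<in>I. submodule (V i) complex_ring L) \<and>
    (\<forall>x\<in>carrier L. \<exists>!f. (\<forall>i\<in>I. f i \<in> V i) \<and> (\<forall>i. i \<notin> I \<longrightarrow> f i = \<zero>\<^bsub>L\<^esub>) \<and>
        finite {i. f i \<noteq> \<zero>\<^bsub>L\<^esub>} \<and> x = finsum L f {i. f i \<noteq> \<zero>\<^bsub>L\<^esub>})"

definition sum_of_subspaces :: "('a, 'm) lsalg_scheme \<Rightarrow> 'i set \<Rightarrow> ('i \<Rightarrow> 'a set) \<Rightarrow> 'a set" where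
  "sum_of_subspaces L I V = {finsum L f F | f F. finite F \<and> F \<subseteq> I \<and> (\<forall>i\<in>F. f i \<in> V i)}"

definition one_dimensional :: "('a, 'm) lsalg_scheme \<Rightarrow> 'a set \<Rightarrow> bool" where
  "one_dimensional L V \<longleftrightarrow> (\<exists>v. v \<noteq> \<zero>\<^bsub>L\<^esub> \<and> v \<in> carrier L \<and> V = {c \<odot>\<^bsub>L\<^esub> v | c. True})"


section \<open>Lie algebras presented by generators and relations\<close>

datatype 'x lie_term =
    Gen 'x
  | Zero
  | Add "'x lie_term" "'x lie_term"
  | Smul complex "'x lie_term"
  | Brk "'x lie_term" "'x lie_term"

text \<open>The least congruence that makes the terms a complex Lie algebra and contains the relations
  \<open>R\<close>.\<close>

inductive lie_cong :: "('x lie_term \<times> 'x lie_term) set \<Rightarrow> 'x lie_term \<Rightarrow> 'x lie_term \<Rightarrow> bool"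
  for R where
  rel: "(s, t) \<in> R \<Longrightarrow> lie_cong R s t"
| refl: "lie_cong R t t"
| sym: "lie_cong R s t \<Longrightarrow> lie_cong R t s"
| trans: "lie_cong R s t \<Longrightarrow> lie_cong R t u \<Longrightarrow> lie_cong R s u"
| add: "lie_cong R s s' \<Longrightarrow> lie_cong R t t' \<Longrightarrow> lie_cong R (Add s t) (Add s' t')"
| smul: "lie_cong R t t' \<Longrightarrow> lie_cong R (Smul c t) (Smul c t')"
| brk: "lie_cong R s s' \<Longrightarrow> lie_cong R t t' \<Longrightarrow> lie_cong R (Brk s t) (Brk s' t')"
| add_assoc: "lie_cong R (Add (Add s t) u) (Add s (Add t u))"
| add_comm: "lie_cong R (Add s t) (Add t s)"
| add_zero: "lie_cong R (Add Zero t) t"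
| add_inv: "lie_cong R (Add (Smul (- 1) t) t) Zero"
| smul_add: "lie_cong R (Smul c (Add s t)) (Add (Smul c s) (Smul c t))"
| add_smul: "lie_cong R (Smul (c + d) t) (Add (Smul c t) (Smul d t))"
| smul_smul: "lie_cong R (Smul (c * d) t) (Smul c (Smul d t))"
| smul_one: "lie_cong R (Smul 1 t) t"
| brk_add_left: "lie_cong R (Brk (Add s t) u) (Add (Brk s u) (Brk t u))"
| brk_add_right: "lie_cong R (Brk s (Add t u)) (Add (Brk s t) (Brk s u))"
| brk_smul_left: "lie_cong R (Brk (Smul c s) t) (Smul c (Brk s t))"
| brk_smul_right: "lie_cong R (Brk s (Smul c t)) (Smul c (Brk s t))"
| brk_alt: "lie_cong R (Brk t t) Zero"
| brk_jacobi: "lie_cong R (Brk s (Brk t u)) (Add (Brk (Brk s t) u) (Brk t (Brk s u)))"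

definition lie_terms :: "'x set \<Rightarrow> 'x lie_term set" where
  "lie_terms X = {t. set_lie_term t \<subseteq> X}"

definition lie_class ::
  "'x set \<Rightarrow> ('x lie_term \<times> 'x lie_term) set \<Rightarrow> 'x lie_term \<Rightarrow> 'x lie_term set" where
  "lie_class X R t = {s \<in> lie_terms X. lie_cong R t s}"

text \<open>The Lie algebra with generators \<open>X\<close> and relations \<open>s = t\<close> for \<open>(s, t) \<in> R\<close>, regarded as a
  purely even Lie superalgebra.\<close>

definition presented_lie_algebra ::
  "'x set \<Rightarrow> ('x lie_term \<times> 'x lie_term) set \<Rightarrow> 'x lie_term set lsalg" where
  "presented_lie_algebra X R = \<lparr>
     carrier = lie_class X R ` lie_terms X,
     mult = undefined,
     one = undefined,
     zero = lie_class X R Zero,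
     add = (\<lambda>S T. \<Union>s\<in>S. \<Union>t\<in>T. lie_class X R (Add s t)),
     smult = (\<lambda>c S. \<Union>s\<in>S. lie_class X R (Smul c s)),
     bracket = (\<lambda>S T. \<Union>s\<in>S. \<Union>t\<in>T. lie_class X R (Brk s t)),
     hpart = (\<lambda>p. if p then {lie_class X R Zero} else lie_class X R ` lie_terms X)\<rparr>"


lemma complex_ring_cring: "cring complex_ring"
proof (rule cringI)
  show "abelian_group complex_ring"
  proof (rule abelian_groupI)
    fix x assume "x \<in> carrier complex_ring"
    show "\<exists>y\<in>carrier complex_ring. y \<oplus>\<^bsub>complex_ring\<^esub> x = \<zero>\<^bsub>complex_ring\<^esub>"
      by (rule bexI[of _ "- x"]) (simp_all add: complex_ring_def)
  qed (simp_all add: complex_ring_def)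
  show "comm_monoid complex_ring"
    by (rule comm_monoidI) (simp_all add: complex_ring_def)
qed (simp_all add: complex_ring_def algebra_simps)

lemma lie_terms_simps [simp]:
  "Zero \<in> lie_terms X" "Add s t \<in> lie_terms X \<longleftrightarrow> s \<in> lie_terms X \<and> t \<in> lie_terms X"
  "Smul c t \<in> lie_terms X \<longleftrightarrow> t \<in> lie_terms X"
  "Brk s t \<in> lie_terms X \<longleftrightarrow> s \<in> lie_terms X \<and> t \<in> lie_terms X"
  "Gen x \<in> lie_terms X \<longleftrightarrow> x \<in> X"
  by (auto simp: lie_terms_def)

lemma lie_class_eqI:
  assumes "lie_cong R s t"
  shows "lie_class X R s = lie_class X R t"
proof -
  have "lie_cong R s u \<longleftrightarrow> lie_cong R t u" for u
    using lie_cong.trans[OF assms] lie_cong.trans[OF lie_cong.sym[OF assms]] by blast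
  then show ?thesis by (simp add: lie_class_def)
qed

lemma lie_class_self: "t \<in> lie_terms X \<Longrightarrow> t \<in> lie_class X R t"
  by (simp add: lie_class_def lie_cong.refl)

lemma lie_class_eq_iff:
  assumes "t \<in> lie_terms X"
  shows "lie_class X R s = lie_class X R t \<longleftrightarrow> lie_cong R s t"
proof
  assume "lie_class X R s = lie_class X R t"
  then have "t \<in> lie_class X R s" using lie_class_self[OF assms] by simp
  then show "lie_cong R s t" by (simp add: lie_class_def)
qed (rule lie_class_eqI)

lemma UN_lie_class:
  assumes "t \<in> lie_terms X" "\<And>s. lie_cong R t s \<Longrightarrow> lie_cong R (f t) (f s)"
  shows "(\<Union>s\<in>lie_class X R t. lie_class X R (f s)) = lie_class X R (f t)"
proof -
  have "lie_class X R (f s) = lie_class X R (f t)" if "s \<in> lie_class X R t" for s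
    by (rule lie_class_eqI[symmetric], rule assms(2)) (use that in \<open>simp add: lie_class_def\<close>)
  then show ?thesis by (intro UN_constant_eq[OF lie_class_self[OF assms(1)]]) simp
qed

lemma UN2_lie_class:
  assumes "s \<in> lie_terms X" "t \<in> lie_terms X"
    "\<And>s' t'. lie_cong R s s' \<Longrightarrow> lie_cong R t t' \<Longrightarrow> lie_cong R (f s t) (f s' t')"
  shows "(\<Union>s\<in>lie_class X R s. \<Union>t\<in>lie_class X R t. lie_class X R (f s t)) = lie_class X R (f s t)"
proof -
  have "lie_class X R (f s' t') = lie_class X R (f s t)"
    if "s' \<in> lie_class X R s" "t' \<in> lie_class X R t" for s' t'
    by (rule lie_class_eqI[symmetric], rule assms(3)) (use that in \<open>simp_all add: lie_class_def\<close>)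
  then show ?thesis
    by (intro UN_constant_eq[OF lie_class_self[OF assms(1)]] ballI
        UN_constant_eq[OF lie_class_self[OF assms(2)]]) simp_all
qed

lemma presented_lie_algebra_simps:
  "carrier (presented_lie_algebra X R) = lie_class X R ` lie_terms X"
  "\<zero>\<^bsub>presented_lie_algebra X R\<^esub> = lie_class X R Zero"
  "hpart (presented_lie_algebra X R) p =
     (if p then {lie_class X R Zero} else lie_class X R ` lie_terms X)"
  "\<lbrakk>s \<in> lie_terms X; t \<in> lie_terms X\<rbrakk> \<Longrightarrow>
     lie_class X R s \<oplus>\<^bsub>presented_lie_algebra X R\<^esub> lie_class X R t = lie_class X R (Add s t)"
  "t \<in> lie_terms X \<Longrightarrow>
     c \<odot>\<^bsub>presented_lie_algebra X R\<^esub> lie_class X R t = lie_class X R (Smul c t)"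
  "\<lbrakk>s \<in> lie_terms X; t \<in> lie_terms X\<rbrakk> \<Longrightarrow>
     bracket (presented_lie_algebra X R) (lie_class X R s) (lie_class X R t) = lie_class X R (Brk s t)"
  unfolding presented_lie_algebra_def
  by (simp_all, (intro UN_lie_class UN2_lie_class lie_cong.add lie_cong.smul lie_cong.brk; assumption)+)

lemma lie_cong_smul_zero: "lie_cong R (Smul 0 t) Zero"
proof -
  note [trans] = lie_cong.trans
  have "lie_cong R (Smul (- 1 + 1) t) (Add (Smul (- 1) t) (Smul 1 t))"
    by (rule lie_cong.add_smul)
  also have "lie_cong R \<dots> (Add (Smul (- 1) t) t)"
    by (intro lie_cong.add lie_cong.refl lie_cong.smul_one)
  also have "lie_cong R \<dots> Zero" by (rule lie_cong.add_inv)
  finally show ?thesis by simp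
qed

lemma lie_cong_add_zero_right: "lie_cong R (Add t Zero) t"
  by (rule lie_cong.trans[OF lie_cong.add_comm lie_cong.add_zero])

lemma lie_cong_smul_Zero: "lie_cong R (Smul c Zero) Zero"
proof -
  note [trans] = lie_cong.trans
  have "lie_cong R (Smul c Zero) (Smul c (Smul 0 Zero))"
    by (intro lie_cong.smul lie_cong.sym[OF lie_cong_smul_zero])
  also have "lie_cong R \<dots> (Smul (c * 0) Zero)"
    by (rule lie_cong.sym[OF lie_cong.smul_smul])
  also have "lie_cong R \<dots> Zero" by (simp add: lie_cong_smul_zero)
  finally show ?thesis .
qed

lemma lie_cong_brk_Zero: "lie_cong R (Brk Zero t) Zero" "lie_cong R (Brk t Zero) Zero"
proof -
  note z = lie_cong.sym[OF lie_cong_smul_zero, of R Zero]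
  show "lie_cong R (Brk Zero t) Zero"
    by (rule lie_cong.trans[OF lie_cong.brk[OF z lie_cong.refl]
          lie_cong.trans[OF lie_cong.brk_smul_left lie_cong_smul_zero]])
  show "lie_cong R (Brk t Zero) Zero"
    by (rule lie_cong.trans[OF lie_cong.brk[OF lie_cong.refl z]
          lie_cong.trans[OF lie_cong.brk_smul_right lie_cong_smul_zero]])
qed

lemma lie_cong_brk_skew: "lie_cong R (Brk s t) (Smul (- 1) (Brk t s))"
proof -
  note [trans] = lie_cong.trans
  note c = lie_cong.sym lie_cong.refl lie_cong.add
  let ?s = "Brk s t" and ?t = "Brk t s"
  have 0: "lie_cong R (Add ?s ?t) Zero"
  proof -
    have "lie_cong R (Brk (Add s t) (Add s t)) (Add (Brk s (Add s t)) (Brk t (Add s t)))"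
      by (rule lie_cong.brk_add_left)
    also have "lie_cong R \<dots> (Add (Add (Brk s s) ?s) (Add ?t (Brk t t)))"
      by (intro lie_cong.add lie_cong.brk_add_right)
    also have "lie_cong R \<dots> (Add (Add Zero ?s) (Add ?t Zero))"
      by (intro lie_cong.add lie_cong.brk_alt lie_cong.refl)
    also have "lie_cong R \<dots> (Add ?s ?t)"
      by (intro lie_cong.add lie_cong.add_zero lie_cong_add_zero_right)
    finally have *: "lie_cong R (Brk (Add s t) (Add s t)) (Add ?s ?t)" .
    show ?thesis by (rule lie_cong.trans[OF lie_cong.sym[OF *] lie_cong.brk_alt])
  qed
  have i: "lie_cong R (Add ?t (Smul (-1) ?t)) Zero"
    by (rule lie_cong.trans[OF lie_cong.add_comm lie_cong.add_inv])
  have "lie_cong R ?s (Add ?s Zero)" by (rule lie_cong.sym[OF lie_cong_add_zero_right])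
  also have "lie_cong R \<dots> (Add ?s (Add ?t (Smul (-1) ?t)))"
    by (intro lie_cong.add lie_cong.refl lie_cong.sym[OF i])
  also have "lie_cong R \<dots> (Add (Add ?s ?t) (Smul (-1) ?t))"
    by (rule lie_cong.sym[OF lie_cong.add_assoc])
  also have "lie_cong R \<dots> (Add Zero (Smul (-1) ?t))"
    by (intro lie_cong.add lie_cong.refl 0)
  also have "lie_cong R \<dots> (Smul (-1) ?t)" by (rule lie_cong.add_zero)
  finally show ?thesis .
qed

lemmas lie_cong_axioms =
  lie_cong.add_assoc lie_cong.add_comm lie_cong.add_zero lie_cong.add_inv lie_cong.smul_add
  lie_cong.add_smul lie_cong.smul_smul lie_cong.smul_one lie_cong.brk_add_left
  lie_cong.brk_add_right lie_cong.brk_smul_left lie_cong.brk_smul_right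
  lie_cong_smul_Zero lie_cong_brk_Zero

theorem presented_lie_algebra_lie_superalgebra:
  "lie_superalgebra (presented_lie_algebra X R)" (is "lie_superalgebra ?L")
proof -
  note [simp] = presented_lie_algebra_simps
  have ag: "abelian_group ?L"
  proof (rule abelian_groupI)
    show "\<exists>y\<in>carrier ?L. y \<oplus>\<^bsub>?L\<^esub> x = \<zero>\<^bsub>?L\<^esub>" if "x \<in> carrier ?L" for x
    proof -
      obtain t where t: "t \<in> lie_terms X" "x = lie_class X R t" using \<open>x \<in> carrier ?L\<close> by auto
      have "lie_class X R (Smul (-1) t) \<oplus>\<^bsub>?L\<^esub> x = \<zero>\<^bsub>?L\<^esub>" "lie_class X R (Smul (-1) t) \<in> carrier ?L"
        using t by (auto simp: lie_class_eq_iff intro: lie_cong_axioms del: equalityI)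
      then show ?thesis by blast
    qed
  qed (auto simp: lie_class_eq_iff intro: lie_cong_axioms del: equalityI)
  have m: "module complex_ring ?L"
    by (rule moduleI[OF complex_ring_cring ag])
      (auto simp: complex_ring_def lie_class_eq_iff intro: lie_cong_axioms del: equalityI)
  interpret module complex_ring ?L by (rule m)
  have Z: "lie_class X R Zero \<in> carrier ?L" by simp
  have rep: "\<exists>s\<in>lie_terms X. x = lie_class X R s \<and> (p \<longrightarrow> s = Zero)" if "x \<in> hpart ?L p" for x p
    using that by (cases p) auto
  have repc: "\<exists>s\<in>lie_terms X. x = lie_class X R s" if "x \<in> carrier ?L" for x
    using that by auto
  show ?thesis
  proof (rule lie_superalgebra.intro[OF m], rule lie_superalgebra_axioms.intro)
    fix p show "submodule (hpart ?L p) complex_ring ?L"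
    proof (cases p)
      case True
      have "\<ominus>\<^bsub>?L\<^esub> \<zero>\<^bsub>?L\<^esub> = \<zero>\<^bsub>?L\<^esub>" by (rule M.add.inv_one[unfolded a_inv_def[symmetric]])
      then show ?thesis using True
        by (intro submoduleI)
          (auto simp: lie_class_eq_iff intro: lie_cong_axioms del: equalityI)
    next
      case False
      then have "hpart ?L p = carrier ?L" by simp
      then show ?thesis using carrier_is_submodule by simp
    qed
  next
    fix x assume x: "x \<in> carrier ?L"
    have "x \<oplus>\<^bsub>?L\<^esub> \<zero>\<^bsub>?L\<^esub> = x" using x by (rule M.r_zero)
    moreover have "y = x" if "y \<in> carrier ?L" "x = y \<oplus>\<^bsub>?L\<^esub> \<zero>\<^bsub>?L\<^esub>" for y
      using that M.r_zero by metis
    moreover have "hpart ?L False = carrier ?L" "hpart ?L True = {\<zero>\<^bsub>?L\<^esub>}" by simp_all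
    ultimately have "(y \<in> hpart ?L False \<and> z \<in> hpart ?L True \<and> x = y \<oplus>\<^bsub>?L\<^esub> z) \<longleftrightarrow> y = x \<and> z = \<zero>\<^bsub>?L\<^esub>" for y z
      using x by (metis singletonD singletonI)
    then show "\<exists>!(y, z). y \<in> hpart ?L False \<and> z \<in> hpart ?L True \<and> x = y \<oplus>\<^bsub>?L\<^esub> z"
      by (intro ex1I[of _ "(x, \<zero>\<^bsub>?L\<^esub>)"]) (simp_all del: presented_lie_algebra_simps split: prod.splits)
  next
    fix x y p r assume "x \<in> hpart ?L p" "y \<in> hpart ?L r"
    then show "bracket ?L x y \<in> hpart ?L (p \<noteq> r)"
      by (auto simp: lie_class_eq_iff split: if_splits intro: lie_cong_axioms del: equalityI)
    show "bracket ?L x y = (- koszul_sign p r) \<odot>\<^bsub>?L\<^esub> bracket ?L y x"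
      using \<open>x \<in> hpart ?L p\<close> \<open>y \<in> hpart ?L r\<close>
    proof (cases "p \<and> r")
      case True
      then show ?thesis using \<open>x \<in> hpart ?L p\<close> \<open>y \<in> hpart ?L r\<close>
        by (auto simp: koszul_sign_def intro!: lie_class_eqI lie_cong.sym[OF lie_cong.smul_one])
    next
      case False
      then have k: "koszul_sign p r = 1" by (simp add: koszul_sign_def)
      obtain s t where "s \<in> lie_terms X" "t \<in> lie_terms X" "x = lie_class X R s" "y = lie_class X R t"
        using rep[OF \<open>x \<in> hpart ?L p\<close>] rep[OF \<open>y \<in> hpart ?L r\<close>] by blast
      then show ?thesis by (simp add: k lie_class_eqI lie_cong_brk_skew)
    qed
    fix z assume "z \<in> carrier ?L"
    show "bracket ?L x (bracket ?L y z) = bracket ?L (bracket ?L x y) z \<oplus>\<^bsub>?L\<^esub> koszul_sign p r \<odot>\<^bsub>?L\<^esub> bracket ?L y (bracket ?L x z)"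
    proof -
      obtain s t u where st: "s \<in> lie_terms X" "t \<in> lie_terms X" "u \<in> lie_terms X" 
         "x = lie_class X R s" "y = lie_class X R t" "z = lie_class X R u" "p \<and> r \<Longrightarrow> s = Zero"
        using rep[OF \<open>x \<in> hpart ?L p\<close>] rep[OF \<open>y \<in> hpart ?L r\<close>] repc[OF \<open>z \<in> carrier ?L\<close>] by blast
      have "lie_cong R (Brk t (Brk s u)) (Smul (koszul_sign p r) (Brk t (Brk s u)))"
      proof (cases "p \<and> r")
        case True
        have "lie_cong R (Brk t (Brk s u)) Zero"
          unfolding st(7)[OF True]
          by (rule lie_cong.trans[OF lie_cong.brk[OF lie_cong.refl lie_cong_brk_Zero(1)] lie_cong_brk_Zero(2)])
        from lie_cong.trans[OF lie_cong.smul[OF this] lie_cong_smul_Zero] this show ?thesis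
          by (rule lie_cong.trans[OF _ lie_cong.sym, rotated])
      next
        case False
        then show ?thesis by (auto simp: koszul_sign_def intro: lie_cong.sym lie_cong.smul_one)
      qed
      then have "lie_cong R (Brk s (Brk t u)) (Add (Brk (Brk s t) u) (Smul (koszul_sign p r) (Brk t (Brk s u))))"
        by (rule lie_cong.trans[OF lie_cong.brk_jacobi lie_cong.add[OF lie_cong.refl]])
      then show ?thesis using st by (simp add: lie_class_eqI)
    qed
  next
    fix x y z and c :: complex assume "x \<in> carrier ?L" "y \<in> carrier ?L"
    then obtain s t where st: "s \<in> lie_terms X" "t \<in> lie_terms X" "x = lie_class X R s" "y = lie_class X R t"
      using repc by metis
    show "bracket ?L x y \<in> carrier ?L" using st by simp
    show "bracket ?L (c \<odot>\<^bsub>?L\<^esub> x) y = c \<odot>\<^bsub>?L\<^esub> bracket ?L x y"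
      using st by (simp add: lie_class_eq_iff lie_cong.brk_smul_left)
    show "bracket ?L x (c \<odot>\<^bsub>?L\<^esub> y) = c \<odot>\<^bsub>?L\<^esub> bracket ?L x y"
      using st by (simp add: lie_class_eq_iff lie_cong.brk_smul_right)
    assume "z \<in> carrier ?L"
    then obtain u where u: "u \<in> lie_terms X" "z = lie_class X R u" using repc by metis
    show "bracket ?L (x \<oplus>\<^bsub>?L\<^esub> y) z = bracket ?L x z \<oplus>\<^bsub>?L\<^esub> bracket ?L y z"
      using st u by (simp add: lie_class_eq_iff lie_cong.brk_add_left)
    show "bracket ?L x (y \<oplus>\<^bsub>?L\<^esub> z) = bracket ?L x y \<oplus>\<^bsub>?L\<^esub> bracket ?L x z"
      using st u by (simp add: lie_class_eq_iff lie_cong.brk_add_right)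
  qed
qed


section \<open>The base system of type \<open>A_l^(1,1)\<close>\<close>

record 'e base_system =
  scl :: "complex \<Rightarrow> 'e \<Rightarrow> 'e"
  form :: "'e \<Rightarrow> 'e \<Rightarrow> complex"
  rank :: nat
  simple_root :: "nat \<Rightarrow> 'e"
  null_a :: 'e
  Lambda_delta :: 'e
  Lambda_a :: 'e

definition coroot :: "'e base_system \<Rightarrow> 'e \<Rightarrow> 'e" where
  "coroot D x = scl D (2 / form D x x) x"

definition reflection :: "'e::ab_group_add base_system \<Rightarrow> 'e \<Rightarrow> 'e \<Rightarrow> 'e" where
  "reflection D x y = y - scl D (form D (coroot D x) y) x"

definition cartan_A :: "nat \<Rightarrow> nat \<Rightarrow> nat \<Rightarrow> int" where
  "cartan_A l i j = (if i = j then 2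
     else if j = (i + 1) mod (l + 1) \<or> i = (j + 1) mod (l + 1) then - 1 else 0)"

definition simple_roots :: "'e base_system \<Rightarrow> 'e set" where
  "simple_roots D = simple_root D ` {..rank D}"

locale A11_base_system = vector_space "scl D" for D :: "'e::ab_group_add base_system" +
  assumes rank_ge_2: "rank D \<ge> 2"
    and form_add: "form D (x + y) z = form D x z + form D y z"
    and form_scl: "form D (scl D c x) z = c * form D x z"
    and form_sym: "form D x y = form D y x"
    and form_nondegenerate: "(\<And>y. form D x y = 0) \<Longrightarrow> x = 0"
    and basis_distinct: "card (simple_roots D \<union> {Lambda_delta D, null_a D, Lambda_a D}) = rank D + 4"
    and basis_independent: "independent (simple_roots D \<union> {Lambda_delta D, null_a D, Lambda_a D})"
    and basis_span: "span (simple_roots D \<union> {Lambda_delta D, null_a D, Lambda_a D}) = UNIV"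
    and simple_root_nonisotropic:
      "i \<le> rank D \<Longrightarrow> form D (simple_root D i) (simple_root D i) \<noteq> 0"
    and cartan_matrix: "\<lbrakk>i \<le> rank D; j \<le> rank D\<rbrakk> \<Longrightarrow>
      form D (coroot D (simple_root D i)) (simple_root D j) = of_int (cartan_A (rank D) i j)"
    and form_Lambda_delta: "form D (Lambda_delta D) (Lambda_delta D) = 0"
    and form_Lambda_delta_simple:
      "i \<le> rank D \<Longrightarrow> form D (Lambda_delta D) (simple_root D i) = (if i = 0 then 1 else 0)"
    and form_a_simple: "i \<le> rank D \<Longrightarrow> form D (null_a D) (simple_root D i) = 0"
    and form_a_Lambda_delta: "form D (null_a D) (Lambda_delta D) = 0"
    and form_a_a: "form D (null_a D) (null_a D) = 0"
    and form_Lambda_a_simple: "i \<le> rank D \<Longrightarrow> form D (Lambda_a D) (simple_root D i) = 0"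
    and form_Lambda_a_Lambda_a: "form D (Lambda_a D) (Lambda_a D) = 0"
    and form_Lambda_a_a: "form D (Lambda_a D) (null_a D) = 1"

text \<open>The group generated by the simple reflections; these are involutions, so inverses need not
  be added.\<close>

inductive_set weyl_group :: "'e::ab_group_add base_system \<Rightarrow> ('e \<Rightarrow> 'e) set"
  for D :: "'e base_system" where
  one: "id \<in> weyl_group D"
| step: "\<lbrakk>\<alpha> \<in> simple_roots D; w \<in> weyl_group D\<rbrakk> \<Longrightarrow> reflection D \<alpha> \<circ> w \<in> weyl_group D"

text \<open>The multiplicity data of type \<open>A_l^(1,1)\<close> are forced (\<open>k = 1\<close>, \<open>g\<close> empty), so they do not
  occur as parameters.\<close>

definition real_roots :: "'e::ab_group_add base_system \<Rightarrow> 'e set" where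
  "real_roots D = (\<Union>w\<in>weyl_group D.
     w ` (\<Union>\<alpha>\<in>simple_roots D. {\<alpha> + scl D (of_int n) (null_a D) | n :: int. True}))"

text \<open>In type \<open>A_l^(1)\<close> the isotropic elements of the root lattice are the integer multiples of the
  sum of the simple roots.\<close>

definition delta :: "'e::ab_group_add base_system \<Rightarrow> 'e" where
  "delta D = (\<Sum>i\<le>rank D. simple_root D i)"

definition imag_weight :: "'e::ab_group_add base_system \<Rightarrow> int \<times> int \<Rightarrow> 'e" where
  "imag_weight D = (\<lambda>(m, n). scl D (of_int m) (delta D) + scl D (of_int n) (null_a D))"


section \<open>The Lie algebra \<open>g_D^q\<close>\<close>

definition star :: "'e::ab_group_add base_system \<Rightarrow> 'e \<Rightarrow> 'e" where
  "star D \<alpha> = \<alpha> + null_a D"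

definition B_plus :: "'e::ab_group_add base_system \<Rightarrow> 'e set" where
  "B_plus D = simple_roots D \<union> star D ` simple_roots D"

definition B_all :: "'e::ab_group_add base_system \<Rightarrow> 'e set" where
  "B_all D = B_plus D \<union> uminus ` B_plus D"

text \<open>The numbers \<open>J(\<mu>\<^sup>\<or>, \<nu>)\<close> with \<open>\<mu>\<close>, \<open>\<nu>\<close> in \<open>B_all D\<close> are integers; \<open>Re\<close> and \<open>floor\<close> only
  convert them from complex numbers.\<close>

definition serre_exp :: "'e base_system \<Rightarrow> 'e \<Rightarrow> 'e \<Rightarrow> nat" where
  "serre_exp D \<mu> \<nu> = (let c = Re (form D (coroot D \<mu>) \<nu>) in
     if c < 0 then nat \<lfloor>1 - c\<rfloor> else 1)"

datatype 'e gen = HGen 'e | EGen 'e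

abbreviation "gen_h \<sigma> \<equiv> Gen (HGen \<sigma>)"
abbreviation "gen_e \<mu> \<equiv> Gen (EGen \<mu>)"

definition gq_generators :: "'e::ab_group_add base_system \<Rightarrow> 'e gen set" where
  "gq_generators D = range HGen \<union> EGen ` B_all D"

inductive_set gq_relations ::
  "'e::ab_group_add base_system \<Rightarrow> complex \<Rightarrow> ('e gen lie_term \<times> 'e gen lie_term) set"
  for D :: "'e base_system" and q :: complex where
  h_linear:
    "(Add (Smul x (gen_h \<sigma>)) (Smul y (gen_h \<tau>)), gen_h (scl D x \<sigma> + scl D y \<tau>)) \<in> gq_relations D q"
| h_h: "(Brk (gen_h \<sigma>) (gen_h \<tau>), Zero) \<in> gq_relations D q"
| h_e: "\<mu> \<in> B_all D \<Longrightarrow> (Brk (gen_h \<sigma>) (gen_e \<mu>), Smul (form D \<sigma> \<mu>) (gen_e \<mu>)) \<in> gq_relations D q"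
| e_f: "\<mu> \<in> B_plus D \<Longrightarrow> (Brk (gen_e \<mu>) (gen_e (- \<mu>)), gen_h (coroot D \<mu>)) \<in> gq_relations D q"
| serre: "\<lbrakk>\<mu> \<in> B_all D; \<nu> \<in> B_all D; \<mu> \<noteq> \<nu>; \<mu> + \<nu> \<noteq> 0\<rbrakk> \<Longrightarrow>
    ((Brk (gen_e \<mu>) ^^ serre_exp D \<mu> \<nu>) (gen_e \<nu>), Zero) \<in> gq_relations D q"
| star_pos: "\<lbrakk>\<alpha> \<in> simple_roots D; \<beta> \<in> simple_roots D; form D \<alpha> (coroot D \<beta>) = - 1;
      {\<alpha>, \<beta>} \<noteq> {simple_root D 0, simple_root D (rank D)}\<rbrakk> \<Longrightarrow>
    (Brk (gen_e (star D \<alpha>)) (gen_e \<beta>), Brk (gen_e \<alpha>) (gen_e (star D \<beta>))) \<in> gq_relations D q"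
| star_neg: "\<lbrakk>\<alpha> \<in> simple_roots D; \<beta> \<in> simple_roots D; form D \<alpha> (coroot D \<beta>) = - 1;
      {\<alpha>, \<beta>} \<noteq> {simple_root D 0, simple_root D (rank D)}\<rbrakk> \<Longrightarrow>
    (Brk (gen_e (- star D \<alpha>)) (gen_e (- \<beta>)), Brk (gen_e (- \<alpha>)) (gen_e (- star D \<beta>))) \<in> gq_relations D q"
| twist_pos:
    "(Smul q (Brk (gen_e (star D (simple_root D 0))) (gen_e (simple_root D (rank D)))),
      Brk (gen_e (simple_root D 0)) (gen_e (star D (simple_root D (rank D))))) \<in> gq_relations D q"
| twist_neg:
    "(Smul (inverse q) (Brk (gen_e (- star D (simple_root D 0))) (gen_e (- simple_root D (rank D)))),
      Brk (gen_e (- simple_root D 0)) (gen_e (- star D (simple_root D (rank D))))) \<in> gq_relations D q"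

definition gq :: "'e::ab_group_add base_system \<Rightarrow> complex \<Rightarrow> 'e gen lie_term set lsalg" where
  "gq D q = presented_lie_algebra (gq_generators D) (gq_relations D q)"

definition gq_h :: "'e::ab_group_add base_system \<Rightarrow> complex \<Rightarrow> 'e \<Rightarrow> 'e gen lie_term set" where
  "gq_h D q \<sigma> = lie_class (gq_generators D) (gq_relations D q) (gen_h \<sigma>)"

text \<open>The invariant form on \<open>g_D^q\<close> extending \<open>J\<close>. As HOL functions are total, its value is fixed to
  \<open>0\<close> outside the carrier, where it is meaningless; otherwise \<open>THE\<close> could not single it out.\<close>

definition gq_form :: "'e::ab_group_add base_system \<Rightarrow> complex \<Rightarrow>
    'e gen lie_term set \<Rightarrow> 'e gen lie_term set \<Rightarrow> complex" where
  "gq_form D q = (THE B. invariant_form (gq D q) B \<and>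
     (\<forall>\<sigma> \<tau>. B (gq_h D q \<sigma>) (gq_h D q \<tau>) = form D \<sigma> \<tau>) \<and>
     (\<forall>x y. x \<notin> carrier (gq D q) \<or> y \<notin> carrier (gq D q) \<longrightarrow> B x y = 0))"


section \<open>The conditions (UI1)--(UI4)\<close>

text \<open>The inclusion of \<open>h_D\<close> into \<open>L\<close> is a map \<open>h\<close>, sending \<open>\<sigma>\<close> to the element called \<open>h_\<sigma>\<close>.\<close>

definition UI1 :: "'e::ab_group_add base_system \<Rightarrow> 'b lsalg \<Rightarrow> ('e \<Rightarrow> 'b) \<Rightarrow> bool" where
  "UI1 D L h \<longleftrightarrow> inj h \<and> range h \<subseteq> hpart L False \<and>
    (\<forall>x y \<sigma> \<tau>. h (scl D x \<sigma> + scl D y \<tau>) = x \<odot>\<^bsub>L\<^esub> h \<sigma> \<oplus>\<^bsub>L\<^esub> y \<odot>\<^bsub>L\<^esub> h \<tau>) \<and>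
    (\<forall>\<sigma> \<tau>. bracket L (h \<sigma>) (h \<tau>) = \<zero>\<^bsub>L\<^esub>)"

definition weight_space ::
  "'e base_system \<Rightarrow> 'b lsalg \<Rightarrow> ('e \<Rightarrow> 'b) \<Rightarrow> 'e \<Rightarrow> 'b set" where
  "weight_space D L h \<mu> = {X \<in> carrier L. \<forall>\<sigma>. bracket L (h \<sigma>) X = form D \<sigma> \<mu> \<odot>\<^bsub>L\<^esub> X}"

text \<open>The three kinds of summands in (UI2); the first is \<open>h_D\<close> itself, not the zero weight space.\<close>

datatype 'e summand = Cartan | RealRoot 'e | ImagRoot "int \<times> int"

definition summand_indices :: "'e::ab_group_add base_system \<Rightarrow> 'e summand set" where
  "summand_indices D = {Cartan} \<union> RealRoot ` real_roots D \<union> ImagRoot ` (UNIV - {(0, 0)})"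

fun summand_space ::
  "'e::ab_group_add base_system \<Rightarrow> 'b lsalg \<Rightarrow> ('e \<Rightarrow> 'b) \<Rightarrow> 'e summand \<Rightarrow> 'b set" where
  "summand_space D L h Cartan = range h"
| "summand_space D L h (RealRoot \<nu>) = weight_space D L h \<nu>"
| "summand_space D L h (ImagRoot p) = weight_space D L h (imag_weight D p)"

definition UI2 :: "'e::ab_group_add base_system \<Rightarrow> 'b lsalg \<Rightarrow> ('e \<Rightarrow> 'b) \<Rightarrow> bool" where
  "UI2 D L h \<longleftrightarrow> internal_direct_sum L (summand_indices D) (summand_space D L h) \<and>
    (\<forall>\<nu>\<in>real_roots D. one_dimensional L (weight_space D L h \<nu>))"

definition UI3 :: "'e::ab_group_add base_system \<Rightarrow> 'b lsalg \<Rightarrow> ('e \<Rightarrow> 'b) \<Rightarrow> bool" where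
  "UI3 D L h \<longleftrightarrow>
    lie_generate L (range h \<union> (\<Union>\<nu>\<in>real_roots D. weight_space D L h \<nu>)) = carrier L"

definition UI4 :: "'e::ab_group_add base_system \<Rightarrow> 'b lsalg \<Rightarrow> ('e \<Rightarrow> 'b) \<Rightarrow>
    ('b \<Rightarrow> 'b \<Rightarrow> complex) \<Rightarrow> bool" where
  "UI4 D L h J' \<longleftrightarrow> invariant_form L J' \<and> (\<forall>\<sigma> \<tau>. J' (h \<sigma>) (h \<tau>) = form D \<sigma> \<tau>) \<and>
    form_kernel L J' \<subseteq>
      sum_of_subspaces L (UNIV - {(0, 0)}) (\<lambda>p. weight_space D L h (imag_weight D p))"

end

theory Submission
  imports Defs "HOL-Library.Function_Algebras" "HOL-Library.Product_Plus" "HOL-Library.Poly_Mapping"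
begin

text \<open>The theorem has two halves, the construction of the epimorphism and the comparison of the forms, and
the second is the harder one.

\<^bold>\<open>The epimorphism.\<close> In \<open>L\<close> every weight space whose weight \<open>\<mu>\<close> has \<open>J(\<mu>, \<mu>)\<close> different from
\<open>0\<close> and from the common squared length \<open>N\<close> of the real roots is zero (\<open>W_trivial\<close>); this alone
yields the Serre relations for any choice of root vectors. As the kernel of \<open>J'\<close> does not meet the
real root spaces, \<open>J'\<close> pairs the lines of \<open>\<nu>\<close> and \<open>- \<nu>\<close> perfectly, and
\<open>[x, y] = J'(x, y) h\<^sub>\<nu>\<close> there; consequently real root vectors are even, \<open>L\<close> is an ordinary Lie
algebra, and root vectors for \<open>\<alpha>\<^sub>i\<close> and \<open>\<alpha>\<^sub>i + a\<close> can be normalised so that \<open>[E, F]\<close> is the coroot. For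
neighbours \<open>i\<close>, \<open>j\<close> both \<open>[E\<^sub>i, E\<^sub>j\<^sup>*]\<close> and \<open>[E\<^sub>i\<^sup>*, E\<^sub>j]\<close> are nonzero vectors of the line of
\<open>\<alpha>\<^sub>i + \<alpha>\<^sub>j + a\<close>, so they differ by a scalar, and invariance of \<open>J'\<close> forces the inverse scalar on the
negative side (\<open>star_scalar\<close>). Rescaling the starred vectors along the path \<open>0, 1, \<dots>, l\<close> turns all of
these scalars into \<open>1\<close> except the one on the edge that closes the cycle, and that one is \<open>q\<close>. The
chosen vectors generate, because \<open>sl\<^sub>2\<close> strings carry nonzero root vectors along the reflections
\<open>s\<^sub>\<alpha>\<close> and \<open>s\<^sub>\<alpha>\<^sub>+\<^sub>a\<close>, and these reach all real roots (\<open>real_roots_induct\<close>).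

\<^bold>\<open>The forms.\<close> The pullback of \<open>J'\<close> is an invariant form on \<open>g\<^sup>q\<close>, so what is missing is that an
invariant form on \<open>g\<^sup>q\<close> is determined by its values on the Cartan subalgebra. By weights and
invariance this comes down to the root spaces of \<open>\<plusminus>\<alpha>\<^sub>i\<close> and \<open>\<plusminus>(\<alpha>\<^sub>i + a)\<close> being lines in an
algebra that is only known through generators and relations. The idea is to use two triangular
decompositions. For an edge \<open>{i, j}\<close> the relations give the subalgebra generated by the eight root
vectors of \<open>i\<close> and \<open>j\<close> Chevalley generators of affine type \<open>A\<^sub>2\<^sup>(\<^sup>1\<^sup>)\<close> with simple roots \<open>\<alpha>\<^sub>i + a\<close>,
\<open>\<alpha>\<^sub>j\<close>, \<open>- \<alpha>\<^sub>i - \<alpha>\<^sub>j\<close>. Its triangular decomposition and the injectivity of \<open>sl\<^sub>2\<close> strings give that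
the spaces of \<open>\<alpha>\<^sub>j + n a\<close> are at most one-dimensional and that those of \<open>\<alpha>\<^sub>i - \<alpha>\<^sub>j + n a\<close> vanish (\<open>thin_root\<close>,
\<open>difference_zero\<close>). These two facts are exactly what a second, coarser triangular decomposition
needs, the one by the height over \<open>\<alpha>\<^sub>0, \<dots>, \<alpha>\<^sub>l\<close> whose simple pieces are the infinite sums of the
spaces of \<open>\<alpha>\<^sub>i + n a\<close>. It shows that nothing else lives in degree \<open>\<alpha>\<^sub>i\<close>
(\<open>form_vanishes_f\<close>, \<open>form_vanishes_e\<close>).

Computations take place in Lie algebras whose underlying set is a whole type. A Lie algebra on a
carrier set is moved there by a linear section of the evaluation map from the free vector space on
its elements (\<open>even_lie_model\<close>).\<close>

section \<open>Lie algebras on a type\<close>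

text \<open>Degrees are integer-valued functions and are compared as whole functions; unfolding the pointwise
operations automatically would destroy the sums on which the graded arguments depend.\<close>

declare plus_fun_apply [simp del] zero_fun_apply [simp del] uminus_apply [simp del] minus_apply [simp del]
lemmas fun_ops = plus_fun_apply zero_fun_apply uminus_apply minus_apply

definition unit_deg :: "'i \<Rightarrow> 'i \<Rightarrow> int" where
  "unit_deg k = (\<lambda>n. if n = k then 1 else 0)"

definition pos_deg :: "('i \<Rightarrow> int) \<Rightarrow> bool" where
  "pos_deg d \<longleftrightarrow> d \<noteq> 0 \<and> (\<forall>k. 0 \<le> d k)"

locale lie_alg = vector_space scl for scl :: "complex \<Rightarrow> 'v::ab_group_add \<Rightarrow> 'v" +
  fixes br :: "'v \<Rightarrow> 'v \<Rightarrow> 'v"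
  assumes br_add_left: "br (x + y) z = br x z + br y z"
    and br_add_right: "br x (y + z) = br x y + br x z"
    and br_scl_left: "br (scl c x) y = scl c (br x y)"
    and br_scl_right: "br x (scl c y) = scl c (br x y)"
    and br_self: "br x x = 0"
    and jacobi: "br x (br y z) = br (br x y) z + br y (br x z)"
begin

lemma br_zero_left [simp]: "br 0 y = 0"
  using br_scl_left[of 0 0 y] by simp

lemma br_zero_right [simp]: "br x 0 = 0"
  using br_scl_right[of x 0 0] by simp

lemma br_minus_left: "br (- x) y = - br x y"
  using br_scl_left[of "-1" x y] by simp

lemma br_minus_right: "br x (- y) = - br x y"
  using br_scl_right[of x "-1" y] by simp

lemma br_skew: "br y x = - br x y"
proof -
  have "br (x + y) (x + y) = br x x + br y x + (br x y + br y y)"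
    by (simp only: br_add_left br_add_right)
  then have "br x y + br y x = 0" by (simp add: br_self add.commute)
  then show ?thesis by (simp add: eq_neg_iff_add_eq_0 add.commute)
qed

lemma br_eq_0_sym: "br x y = 0 \<Longrightarrow> br y x = 0"
  by (simp add: br_skew[of y x])

lemma br_mem_sym: "br x y \<in> U \<Longrightarrow> subspace U \<Longrightarrow> br y x \<in> U"
  using subspace_neg[of U "br x y"] by (simp add: br_skew[of y x])

lemma jacobi_left: "br (br x y) z = br x (br y z) - br y (br x z)"
  by (simp add: jacobi[of x y z])

lemma subspace_br_right: "subspace U \<Longrightarrow> subspace {y. br x y \<in> U}"
  by (auto simp: subspace_def br_add_right br_scl_right)

lemma subspace_br_left: "subspace U \<Longrightarrow> subspace {x. br x y \<in> U}"
  by (auto simp: subspace_def br_add_left br_scl_left)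

lemma br_span_span:
  assumes "x \<in> span A" "y \<in> span B" "subspace U" "\<And>a b. a \<in> A \<Longrightarrow> b \<in> B \<Longrightarrow> br a b \<in> U"
  shows "br x y \<in> U"
proof -
  have "br a y \<in> U" if "a \<in> A" for a
    using span_minimal[OF _ subspace_br_right[OF assms(3), of a], of B] assms(2,4) that by auto
  then show ?thesis
    using span_minimal[OF _ subspace_br_left[OF assms(3), of y], of A] assms(1) by auto
qed

lemma br_span_right:
  assumes "y \<in> span B" "subspace U" "\<And>b. b \<in> B \<Longrightarrow> br a b \<in> U"
  shows "br a y \<in> U"
  using br_span_span[of a "{a}" y B U] assms by (auto intro: span_base)

lemma br_line: "br x y \<in> U \<Longrightarrow> subspace U \<Longrightarrow> x' \<in> span {x} \<Longrightarrow> y' \<in> span {y} \<Longrightarrow> br x' y' \<in> U"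
  by (rule br_span_span[of x' "{x}" y' "{y}"]) auto

lemma pow_br_add: "(br u ^^ n) (x + y) = (br u ^^ n) x + (br u ^^ n) y"
  by (induction n) (simp_all add: br_add_right)

lemma pow_br_scl: "(br u ^^ n) (scl c x) = scl c ((br u ^^ n) x)"
  by (induction n) (simp_all add: br_scl_right)

lemma pow_br_zero [simp]: "(br u ^^ n) 0 = 0"
  by (induction n) simp_all

lemma pow_br_mono: "(br u ^^ n) x = 0 \<Longrightarrow> n \<le> m \<Longrightarrow> (br u ^^ m) x = 0"
proof -
  assume "(br u ^^ n) x = 0" "n \<le> m"
  then obtain k where "m = k + n" by (auto simp: le_iff_add add.commute)
  then show ?thesis using \<open>(br u ^^ n) x = 0\<close> by (simp add: funpow_add)
qed

text \<open>Nilpotency of \<open>ad u\<close> on a single element. It passes to brackets (\<open>ad_nil_br\<close>), hence from generators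
to the algebra that they generate, which is how integrability is obtained from the Serre relations.\<close>

definition ad_nil :: "'v \<Rightarrow> 'v \<Rightarrow> bool" where
  "ad_nil u x \<longleftrightarrow> (\<exists>n. (br u ^^ n) x = 0)"

lemma ad_nilI: "(br u ^^ n) x = 0 \<Longrightarrow> ad_nil u x"
  by (auto simp: ad_nil_def)

lemma ad_nil_zero: "ad_nil u 0"
  by (rule ad_nilI[of 0 u]) simp

lemma ad_nil_step: assumes "ad_nil u (br u x)" shows "ad_nil u x"
proof -
  obtain n where "(br u ^^ n) (br u x) = 0" using assms by (auto simp: ad_nil_def)
  then have "(br u ^^ Suc n) x = 0" by (simp add: funpow_swap1)
  then show ?thesis by (rule ad_nilI)
qed

lemma ad_nil_add: assumes "ad_nil u x" "ad_nil u y" shows "ad_nil u (x + y)"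
proof -
  obtain n m where "(br u ^^ n) x = 0" "(br u ^^ m) y = 0" using assms by (auto simp: ad_nil_def)
  then have "(br u ^^ (max n m)) (x + y) = 0"
    by (simp add: pow_br_add pow_br_mono[of n u x "max n m"] pow_br_mono[of m u y "max n m"])
  then show ?thesis by (rule ad_nilI)
qed

lemma ad_nil_scl: "ad_nil u x \<Longrightarrow> ad_nil u (scl c x)"
  by (auto simp: ad_nil_def pow_br_scl)

lemma ad_nil_br: assumes "ad_nil u x" "ad_nil u y" shows "ad_nil u (br x y)"
proof -
  have "ad_nil u (br x y)" if "(br u ^^ n) x = 0" "(br u ^^ m) y = 0" "n + m = k" for n m k x y
    using that
  proof (induction k arbitrary: n m x y)
    case 0 then show ?case by (simp add: ad_nil_zero)
  next
    case (Suc k)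
    show ?case
    proof (cases "n = 0 \<or> m = 0")
      case True then show ?thesis using Suc.prems by (elim disjE) (simp_all add: ad_nil_zero)
    next
      case False
      then obtain n' m' where nm: "n = Suc n'" "m = Suc m'" by (auto simp: gr0_conv_Suc)
      have "ad_nil u (br (br u x) y)"
        by (rule Suc.IH[of n' _ m]) (use Suc.prems nm in \<open>simp_all add: funpow_swap1\<close>)
      moreover have "ad_nil u (br x (br u y))"
        by (rule Suc.IH[of n _ m']) (use Suc.prems nm in \<open>simp_all add: funpow_swap1\<close>)
      ultimately show ?thesis
        by (intro ad_nil_step[of u "br x y"]) (simp add: jacobi[of u x y] ad_nil_add)
    qed
  qed
  then show ?thesis using assms by (auto simp: ad_nil_def)
qed

section \<open>Strings for \<open>sl\<^sub>2\<close>\<close>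

lemma weight_pow:
  assumes "br h e = scl (of_int p) e" "br h z = scl (of_int k) z"
  shows "br h ((br e ^^ n) z) = scl (of_int (k + int n * p)) ((br e ^^ n) z)"
proof (induction n)
  case 0 then show ?case using assms by simp
next
  case (Suc n)
  have "br h (br e ((br e ^^ n) z)) = scl (of_int p) (br e ((br e ^^ n) z)) + scl (of_int (k + int n * p)) (br e ((br e ^^ n) z))"
    by (subst jacobi) (simp add: assms Suc br_scl_left br_scl_right)
  also have "\<dots> = scl (of_int (k + int (Suc n) * p)) (br e ((br e ^^ n) z))"
    unfolding scale_left_distrib[symmetric] by (rule arg_cong[of _ _ "\<lambda>c. scl c _"]) (simp add: algebra_simps)
  finally show ?case by simp
qed

text \<open>The commutation rule of \<open>e\<^sup>n\<close> with \<open>f\<close> in the enveloping algebra of \<open>sl\<^sub>2\<close>, applied to a weight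
vector.\<close>

lemma sl2_commute:
  assumes "br e f = h" "br h e = scl 2 e" "br h z = scl (of_int k) z"
  shows "(br e ^^ n) (br f z) = br f ((br e ^^ n) z) +
    scl (of_int (int n * (k + int n - 1))) ((br e ^^ (n - 1)) z)"
proof (induction n)
  case 0 then show ?case by simp
next
  case (Suc n)
  have h: "br h ((br e ^^ n) z) = scl (of_int (k + int n * 2)) ((br e ^^ n) z)"
    by (rule weight_pow) (use assms in auto)
  have s: "scl (of_int (int n * (k + int n - 1))) (br e ((br e ^^ (n - 1)) z)) =
    scl (of_int (int n * (k + int n - 1))) ((br e ^^ n) z)"
    by (cases n) auto
  have "(br e ^^ Suc n) (br f z) = br e (br f ((br e ^^ n) z)) +
      scl (of_int (int n * (k + int n - 1))) ((br e ^^ n) z)"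
    using s by (simp add: Suc br_add_right br_scl_right)
  also have "br e (br f ((br e ^^ n) z)) = scl (of_int (k + int n * 2)) ((br e ^^ n) z) + br f ((br e ^^ Suc n) z)"
    by (subst jacobi) (simp add: assms h)
  also have "scl (of_int (k + int n * 2)) ((br e ^^ n) z) + br f ((br e ^^ Suc n) z) +
      scl (of_int (int n * (k + int n - 1))) ((br e ^^ n) z) = br f ((br e ^^ Suc n) z) +
      scl (of_int (k + int n * 2) + of_int (int n * (k + int n - 1))) ((br e ^^ n) z)"
    by (simp add: scale_left_distrib)
  also have "of_int (k + int n * 2) + of_int (int n * (k + int n - 1)) = (of_int (int (Suc n) * (k + int (Suc n) - 1)) :: complex)"
    by (simp add: algebra_simps)
  finally show ?case by simp
qed

lemma sl2_lowest_nonzero: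
  assumes "br e f = h" "br h e = scl 2 e" "br h y = scl (- of_nat m) y" "br f y = 0" "y \<noteq> 0" "k \<le> m"
  shows "(br e ^^ k) y \<noteq> 0"
  using \<open>k \<le> m\<close>
proof (induction k)
  case 0 then show ?case using assms by simp
next
  case (Suc k)
  have "0 = br f ((br e ^^ Suc k) y) + scl (of_int (int (Suc k) * (- int m + int (Suc k) - 1))) ((br e ^^ k) y)"
    using sl2_commute[OF assms(1,2), of y "- int m" "Suc k"] assms(3,4) by simp
  moreover have "of_int (int (Suc k) * (- int m + int (Suc k) - 1)) \<noteq> (0::complex)"
    using Suc.prems by (simp only: of_int_eq_0_iff) simp
  ultimately show ?case using Suc by fastforce
qed

text \<open>Moving \<open>f\<close> to the left past a power of \<open>e\<close> costs at most one factor \<open>e\<close>, so \<open>e\<^sup>b f\<^sup>a\<close> still contains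
the factor \<open>e\<^sup>m\<close> next to \<open>x\<close> if \<open>b \<ge> m + a\<close>.\<close>

lemma sl2_kernel_propagates:
  assumes "br e f = h" "br h e = scl 2 e" "br h f = scl (- 2) f" "br h x = scl (of_int k) x"
    "(br e ^^ m) x = 0" "m + a \<le> b"
  shows "(br e ^^ b) ((br f ^^ a) x) = 0"
  using \<open>m + a \<le> b\<close>
proof (induction a arbitrary: b)
  case 0 then show ?case using assms(5) pow_br_mono by simp
next
  case (Suc a)
  have "br h ((br f ^^ a) x) = scl (of_int (k + int a * (-2))) ((br f ^^ a) x)"
    by (rule weight_pow) (use assms in auto)
  from sl2_commute[OF assms(1,2) this, of b] Suc.IH[of b] Suc.IH[of "b - 1"] Suc.prems
  show ?case by simp
qed

text \<open>Raising from weight \<open>- m\<close> to weight \<open>m\<close> is injective wherever \<open>f\<close> acts nilpotently. The last nonzero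
\<open>y = f\<^sup>a x\<close> is a lowest weight vector of weight \<open>- (m + 2 a)\<close>, so \<open>e\<^sup>k y\<close> is nonzero for
\<open>k = m + 2 a\<close>; but \<open>e\<^sup>m x = 0\<close> would make \<open>e\<^sup>k y\<close> vanish. This takes the place of Weyl group
automorphisms and also bounds dimensions, as it applies to all vectors of a weight space.\<close>

theorem sl2_raising_injective:
  assumes "br e f = h" "br h e = scl 2 e" "br h f = scl (- 2) f" "br h x = scl (- of_nat m) x"
    "ad_nil f x" "(br e ^^ m) x = 0"
  shows "x = 0"
proof (rule ccontr)
  assume "x \<noteq> 0"
  define N where "N = (LEAST n. (br f ^^ n) x = 0)"
  have N: "(br f ^^ N) x = 0" unfolding N_def by (rule LeastI_ex) (use assms(5) in \<open>simp add: ad_nil_def\<close>)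
  then obtain a where a: "N = Suc a" using \<open>x \<noteq> 0\<close> by (cases N) auto
  define y where "y = (br f ^^ a) x"
  have "y \<noteq> 0" unfolding y_def using not_less_Least[of a "\<lambda>n. (br f ^^ n) x = 0"] a N_def by simp
  have hx: "br h x = scl (of_int (- int m)) x" using assms(4) by simp
  have "br h y = scl (of_int (- int m + int a * (-2))) y"
    unfolding y_def by (rule weight_pow) (use assms(3) hx in auto)
  moreover have "of_int (- int m + int a * (-2)) = (- of_nat (m + 2 * a) :: complex)" by simp
  ultimately have hy: "br h y = scl (- of_nat (m + 2 * a)) y" by simp
  have "br f y = 0" using N a by (simp add: y_def)
  from sl2_lowest_nonzero[OF assms(1,2) hy this \<open>y \<noteq> 0\<close>, of "m + 2 * a"]
    sl2_kernel_propagates[OF assms(1,2,3) hx assms(6), of a "m + 2 * a"]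
  show False by (simp add: y_def)
qed

section \<open>Graded subalgebras\<close>

text \<open>The homogeneous part of degree \<open>d\<close> of the subalgebra generated by the homogeneous elements \<open>(d, x)\<close>
of \<open>X\<close>. The degree is a formal label: the decomposition of an element into weight vectors is never
needed. Bracketing only with generators loses nothing, by \<open>gen_at_br\<close>.\<close>

inductive gen_at :: "('d::ab_group_add \<times> 'v) set \<Rightarrow> 'd \<Rightarrow> 'v \<Rightarrow> bool" for X where
  base: "(d, x) \<in> X \<Longrightarrow> gen_at X d x"
| zero: "gen_at X d 0"
| add: "gen_at X d x \<Longrightarrow> gen_at X d y \<Longrightarrow> gen_at X d (x + y)"
| scale: "gen_at X d x \<Longrightarrow> gen_at X d (scl c x)"
| brk: "(d, x) \<in> X \<Longrightarrow> gen_at X d' y \<Longrightarrow> gen_at X (d + d') (br x y)"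

lemma gen_at_uminus: "gen_at X d x \<Longrightarrow> gen_at X d (- x)"
  using gen_at.scale[of X d x "-1"] by simp

lemma gen_at_diff: "gen_at X d x \<Longrightarrow> gen_at X d y \<Longrightarrow> gen_at X d (x - y)"
  using gen_at.add[of X d x "- y"] gen_at_uminus[of X d y] by simp

lemma gen_at_subspace: "subspace {x. gen_at X d x}"
  by (auto simp: subspace_def intro: gen_at.intros)

lemma gen_at_br:
  assumes "gen_at X d x" "gen_at X d' y" shows "gen_at X (d + d') (br x y)"
  using assms
proof (induction arbitrary: d' y rule: gen_at.induct)
  case (brk d x d1 z)
  have "gen_at X (d + (d1 + d')) (br x (br z y))"
    by (rule gen_at.brk[OF brk.hyps(1) brk.IH[OF brk.prems]])
  moreover have "gen_at X (d1 + (d + d')) (br z (br x y))"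
    by (rule brk.IH[OF gen_at.brk[OF brk.hyps(1) brk.prems]])
  moreover have "d1 + (d + d') = d + d1 + d'" "d + (d1 + d') = d + d1 + d'" by (simp_all add: add_ac)
  ultimately show ?case by (simp only: jacobi_left gen_at_diff)
qed (auto simp: br_add_left br_scl_left intro: gen_at.intros)

lemma gen_at_map:
  assumes "gen_at X d x" "\<And>d x. (d, x) \<in> X \<Longrightarrow> gen_at Y (\<phi> d) x" "\<And>d d'. \<phi> (d + d') = \<phi> d + \<phi> d'"
  shows "gen_at Y (\<phi> d) x"
  using assms(1) by induction (auto intro: gen_at.intros gen_at_br assms(2) simp: assms(3))

lemma gen_at_weight:
  assumes "gen_at X d x" "\<And>d x. (d, x) \<in> X \<Longrightarrow> br h x = scl (\<chi> d) x"
    "\<And>d d'. \<chi> (d + d') = \<chi> d + \<chi> d'"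
  shows "br h x = scl (\<chi> d) x"
  using assms(1)
proof induction
  case (brk d x d' y)
  then show ?case
    by (subst jacobi) (simp add: assms(2,3) br_scl_left br_scl_right scale_left_distrib)
qed (auto simp: assms(2) br_add_right br_scl_right scale_right_distrib ac_simps)

lemma gen_at_in:
  assumes "gen_at X d x" "\<And>d x. (d, x) \<in> X \<Longrightarrow> x \<in> U" "subspace U"
    "\<And>x y. x \<in> U \<Longrightarrow> y \<in> U \<Longrightarrow> br x y \<in> U"
  shows "x \<in> U"
  using assms(1) by induction (use assms(2-) in \<open>auto simp: subspace_def\<close>)

section \<open>Triangular decomposition\<close>

definition pos_gens :: "'i set \<Rightarrow> ('i \<Rightarrow> 'v set) \<Rightarrow> (('i \<Rightarrow> int) \<times> 'v) set" where
  "pos_gens I V = {(unit_deg k, x) | k x. k \<in> I \<and> x \<in> V k}"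

definition nonneg_part :: "'i set \<Rightarrow> ('i \<Rightarrow> 'v set) \<Rightarrow> 'v set \<Rightarrow> ('i \<Rightarrow> int) \<Rightarrow> 'v \<Rightarrow> bool" where
  "nonneg_part I V H d x \<longleftrightarrow> x = 0 \<or> d = 0 \<and> x \<in> H \<or> gen_at (pos_gens I V) d x"

definition tri_gens :: "'i set \<Rightarrow> ('i \<Rightarrow> 'v set) \<Rightarrow> ('i \<Rightarrow> 'v set) \<Rightarrow> 'v set \<Rightarrow> (('i \<Rightarrow> int) \<times> 'v) set" where
  "tri_gens I Vp Vm H0 = pos_gens I Vp \<union> (\<lambda>(d, x). (- d, x)) ` pos_gens I Vm \<union> Pair 0 ` H0"

end

lemma unit_deg_neq_0 [simp]: "unit_deg k \<noteq> 0"
  by (auto simp: unit_deg_def fun_eq_iff fun_ops)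

lemma pos_deg_unit: "pos_deg (unit_deg k)"
  by (auto simp: pos_deg_def unit_deg_def fun_eq_iff fun_ops)

lemma pos_deg_add: "pos_deg d \<Longrightarrow> pos_deg d' \<Longrightarrow> pos_deg (d + d')"
  unfolding pos_deg_def fun_eq_iff fun_ops by (auto simp: add_nonneg_eq_0_iff)

lemma unit_deg_inj: "unit_deg k = unit_deg m \<Longrightarrow> k = m"
  by (auto simp: unit_deg_def fun_eq_iff split: if_splits)

text \<open>Unit degrees are minimal among the positive ones; therefore a bracket of positive elements never has
unit degree.\<close>

lemma unit_deg_minimal: "unit_deg m + d = unit_deg k \<Longrightarrow> \<not> pos_deg d"
proof
  assume e: "unit_deg m + d = unit_deg k" and p: "pos_deg d"
  have d: "d n = unit_deg k n - unit_deg m n" for n using fun_cong[OF e, of n] by (simp add: fun_ops)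
  have "k = m"
  proof (rule ccontr)
    assume "k \<noteq> m"
    then have "d m = -1" by (simp add: d unit_deg_def)
    then show False using p by (auto simp: pos_deg_def dest: spec[of _ m])
  qed
  then have "d = 0" by (simp add: d fun_eq_iff fun_ops)
  then show False using p by (simp add: pos_deg_def)
qed

text \<open>A common frame for the two decompositions \<open>N\<^sub>- + H + N\<^sub>+\<close> below. The simple pieces \<open>Vp k\<close> and \<open>Vm k\<close> are
arbitrary subspaces instead of lines, since in the second application they are infinite-dimensional,
and \<open>H\<close> may be larger than the space spanned by the generators \<open>H0\<close> of degree zero.\<close>

locale triangular = lie_alg scl br for scl :: "complex \<Rightarrow> 'v::ab_group_add \<Rightarrow> 'v" and br +
  fixes I :: "'i set" and Vp Vm :: "'i \<Rightarrow> 'v set" and H0 H :: "'v set"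
  assumes Vp_sub: "k \<in> I \<Longrightarrow> subspace (Vp k)"
    and Vm_sub: "k \<in> I \<Longrightarrow> subspace (Vm k)"
    and H_sub: "subspace H"
    and Vp_Vm_same: "k \<in> I \<Longrightarrow> x \<in> Vp k \<Longrightarrow> y \<in> Vm k \<Longrightarrow> br x y \<in> H"
    and Vp_Vm_other: "k \<in> I \<Longrightarrow> m \<in> I \<Longrightarrow> k \<noteq> m \<Longrightarrow> x \<in> Vp k \<Longrightarrow> y \<in> Vm m \<Longrightarrow> br x y = 0"
    and H_Vp: "k \<in> I \<Longrightarrow> x \<in> H \<Longrightarrow> y \<in> Vp k \<Longrightarrow> br x y \<in> Vp k"
    and H_Vm: "k \<in> I \<Longrightarrow> x \<in> H \<Longrightarrow> y \<in> Vm k \<Longrightarrow> br x y \<in> Vm k"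
    and H0_H: "H0 \<subseteq> H"
    and H0_H_br: "x \<in> H0 \<Longrightarrow> y \<in> H \<Longrightarrow> br x y \<in> H"
begin

lemma flip: "triangular scl br I Vm Vp H0 H"
proof unfold_locales
  fix k m x y assume "k \<in> I" "m \<in> I" "k \<noteq> m" "x \<in> Vm k" "y \<in> Vp m"
  then show "br x y = 0" using Vp_Vm_other[of m k y x] br_eq_0_sym by blast
next
  fix k x y assume "k \<in> I" "x \<in> Vm k" "y \<in> Vp k"
  then show "br x y \<in> H" using Vp_Vm_same[of k y x] br_mem_sym H_sub by blast
qed (use Vp_sub Vm_sub H_sub H_Vp H_Vm H0_H H0_H_br in blast)+

lemma pos_gens_deg: "gen_at (pos_gens I Vp) d x \<Longrightarrow> x = 0 \<or> pos_deg d"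
  by (induction rule: gen_at.induct) (auto simp: pos_gens_def intro: pos_deg_unit pos_deg_add)

lemma pos_gens_H: "gen_at (pos_gens I Vp) d x \<Longrightarrow> h \<in> H \<Longrightarrow> gen_at (pos_gens I Vp) d (br h x)"
proof (induction rule: gen_at.induct)
  case (base d x)
  then show ?case by (auto simp: pos_gens_def intro!: gen_at.base H_Vp)
next
  case (brk d x d' y)
  have "(d, br h x) \<in> pos_gens I Vp" using brk by (auto simp: pos_gens_def intro: H_Vp)
  then show ?case unfolding jacobi[of h x y]
    by (rule gen_at.add[OF gen_at.brk[OF _ brk.hyps(2)] gen_at.brk[OF brk.hyps(1) brk.IH[OF brk.prems]]])
qed (auto simp: br_add_right br_scl_right intro: gen_at.intros)

lemma pos_gens_unit: "gen_at (pos_gens I Vp) d x \<Longrightarrow> d = unit_deg k \<Longrightarrow> k \<in> I \<Longrightarrow> x \<in> Vp k"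
proof (induction rule: gen_at.induct)
  case (base d x)
  then show ?case by (auto simp: pos_gens_def dest: unit_deg_inj)
next
  case (brk d x d' y)
  then obtain m where "d = unit_deg m" by (auto simp: pos_gens_def)
  then have "y = 0" using pos_gens_deg[OF brk.hyps(2)] unit_deg_minimal[of m d' k] brk.prems by auto
  then show ?case using subspace_0[OF Vp_sub] brk.prems by simp
qed (use Vp_sub in \<open>auto simp: subspace_def\<close>)

lemma nonneg_part_add:
  assumes "nonneg_part I Vp H d x" "nonneg_part I Vp H d y" shows "nonneg_part I Vp H d (x + y)"
  using assms pos_gens_deg[of d x] pos_gens_deg[of d y] subspace_add[OF H_sub]
  unfolding nonneg_part_def by (auto simp: pos_deg_def intro: gen_at.add)

lemma nonneg_part_scale: "nonneg_part I Vp H d x \<Longrightarrow> nonneg_part I Vp H d (scl c x)"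
  unfolding nonneg_part_def by (auto intro: gen_at.scale subspace_scale[OF H_sub])

lemma nonneg_part_raise:
  assumes "nonneg_part I Vp H d x" "k \<in> I" "v \<in> Vp k" shows "nonneg_part I Vp H (unit_deg k + d) (br v x)"
proof -
  have g: "(unit_deg k, v) \<in> pos_gens I Vp" using assms by (auto simp: pos_gens_def)
  consider "x = 0" | "d = 0" "x \<in> H" | "gen_at (pos_gens I Vp) d x"
    using assms(1) by (auto simp: nonneg_part_def)
  then show ?thesis
  proof cases
    case 2
    then have "br v x \<in> Vp k" using assms H_Vp Vp_sub br_mem_sym by blast
    then show ?thesis using 2 assms(2) by (auto simp: nonneg_part_def pos_gens_def intro!: gen_at.base)
  qed (auto simp: nonneg_part_def intro: gen_at.brk[OF g])
qed

text \<open>The usual induction on a bracket of positive generators: \<open>y\<close> either turns the first generator into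
an element of \<open>H\<close>, which acts on the positive part, or kills it and moves on to the rest.\<close>

lemma nonneg_part_lower:
  assumes "gen_at (pos_gens I Vp) d x" "k \<in> I" "y \<in> Vm k"
  shows "nonneg_part I Vp H (d - unit_deg k) (br y x)"
  using assms(1)
proof (induction rule: gen_at.induct)
  case (base d x)
  then obtain m where m: "d = unit_deg m" "m \<in> I" "x \<in> Vp m" by (auto simp: pos_gens_def)
  show ?case
  proof (cases "m = k")
    case True
    then have "br y x \<in> H" using m assms Vp_Vm_same[of k x y] br_mem_sym H_sub by blast
    then show ?thesis using True m by (simp add: nonneg_part_def)
  next
    case False
    then have "br y x = 0" using m assms Vp_Vm_other[of m k x y] br_eq_0_sym by blast
    then show ?thesis by (simp add: nonneg_part_def)
  qed
next
  case (brk d v d' z)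
  then obtain m where m: "d = unit_deg m" "m \<in> I" "v \<in> Vp m" by (auto simp: pos_gens_def)
  have 1: "nonneg_part I Vp H (d + d' - unit_deg k) (br v (br y z))"
    using nonneg_part_raise[OF brk.IH m(2,3)] m(1) by (simp only: add_diff_eq)
  have 2: "nonneg_part I Vp H (d + d' - unit_deg k) (br (br y v) z)"
  proof (cases "m = k")
    case True
    then have "br y v \<in> H" using m assms Vp_Vm_same[of k v y] br_mem_sym H_sub by blast
    then show ?thesis using pos_gens_H[OF brk.hyps(2)] True m(1) by (simp add: nonneg_part_def)
  next
    case False
    then have "br y v = 0" using m assms Vp_Vm_other[of m k v y] br_eq_0_sym by blast
    then show ?thesis by (simp add: nonneg_part_def)
  qed
  show ?case unfolding jacobi[of y v z] by (rule nonneg_part_add[OF 2 1])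
next
  case (zero d) show ?case by (simp add: nonneg_part_def)
next
  case (add d x z) then show ?case by (simp only: br_add_right nonneg_part_add)
next
  case (scale d x c) then show ?case by (simp only: br_scl_right nonneg_part_scale)
qed

lemma nonneg_part_H0:
  assumes "nonneg_part I Vp H d x" "h \<in> H0" shows "nonneg_part I Vp H d (br h x)"
  using assms H0_H pos_gens_H[of d x h] H0_H_br[of h x] by (auto simp: nonneg_part_def)

theorem triangular_decomposition:
  assumes "gen_at (tri_gens I Vp Vm H0) d x"
  shows "nonneg_part I Vp H d x \<or> nonneg_part I Vm H (- d) x"
  using assms
proof (induction rule: gen_at.induct)
  interpret m: triangular scl br I Vm Vp H0 H by (rule flip)
  case (base d x)
  then show ?case using H0_H by (auto simp: tri_gens_def nonneg_part_def intro: gen_at.base)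
next
  case (zero d) then show ?case by (simp add: nonneg_part_def)
next
  interpret m: triangular scl br I Vm Vp H0 H by (rule flip)
  case (add d x y)
  have *: "x = 0 \<or> y = 0 \<or> d = 0 \<and> x \<in> H \<and> y \<in> H" if "nonneg_part I Vp H d x" "nonneg_part I Vm H (- d) y" for x y
  proof -
    have "\<not> (pos_deg d \<and> pos_deg (- d))" by (auto simp: pos_deg_def fun_eq_iff fun_ops intro: order_antisym)
    then show ?thesis
      using that pos_gens_deg[of d x] m.pos_gens_deg[of "- d" y] by (auto simp: nonneg_part_def pos_deg_def)
  qed
  from add.IH *[of x y] *[of y x] show ?case
    using nonneg_part_add[of d x y] m.nonneg_part_add[of "- d" x y] subspace_add[OF H_sub, of x y]
    by (auto simp: nonneg_part_def[of I Vp H 0])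
next
  interpret m: triangular scl br I Vm Vp H0 H by (rule flip)
  case (scale d x c)
  then show ?case using nonneg_part_scale m.nonneg_part_scale by blast
next
  interpret m: triangular scl br I Vm Vp H0 H by (rule flip)
  case (brk d v d' y)
  consider k where "d = unit_deg k" "k \<in> I" "v \<in> Vp k" | k where "d = - unit_deg k" "k \<in> I" "v \<in> Vm k"
    | "d = 0" "v \<in> H0"
    using brk.hyps(1) by (auto simp: tri_gens_def pos_gens_def)
  then show ?case
  proof cases
    case 1
    show ?thesis
    proof (cases "nonneg_part I Vp H d' y")
      case True then show ?thesis using nonneg_part_raise[OF True] 1 by simp
    next
      case False
      then have "gen_at (pos_gens I Vm) (- d') y" using brk.IH by (auto simp: nonneg_part_def)
      from m.nonneg_part_lower[OF this 1(2,3)] show ?thesis using 1(1) by (simp only: minus_add_distrib) (simp add: add.commute)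
    qed
  next
    case 2
    show ?thesis
    proof (cases "nonneg_part I Vm H (- d') y")
      case True then show ?thesis using m.nonneg_part_raise[OF True] 2 by simp
    next
      case False
      then have "gen_at (pos_gens I Vp) d' y" using brk.IH by (auto simp: nonneg_part_def)
      from nonneg_part_lower[OF this 2(2,3)] show ?thesis using 2(1) by (simp add: add.commute)
    qed
  next
    case 3
    then show ?thesis using brk.IH nonneg_part_H0 m.nonneg_part_H0 by auto
  qed
qed

text \<open>The two consequences that are used later: every part of the decomposition has a degree without mixed
signs, and in the positive part only the simple pieces have unit degree.\<close>

corollary mixed_degree_zero:
  assumes "gen_at (tri_gens I Vp Vm H0) d x" "d j < 0" "0 < d k"
  shows "x = 0"
proof -
  interpret m: triangular scl br I Vm Vp H0 H by (rule flip)
  have "\<not> pos_deg d" "\<not> pos_deg (- d)" "d \<noteq> 0" using assms(2,3)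
    by (auto simp: pos_deg_def not_le fun_ops intro: exI[of _ j] exI[of _ k])
  then show ?thesis using triangular_decomposition[OF assms(1)] pos_gens_deg[of d x] m.pos_gens_deg[of "- d" x]
    by (auto simp: nonneg_part_def)
qed

corollary unit_degree:
  assumes "gen_at (tri_gens I Vp Vm H0) (unit_deg k) x" "k \<in> I"
  shows "x \<in> Vp k"
proof -
  interpret m: triangular scl br I Vm Vp H0 H by (rule flip)
  have "\<not> pos_deg (- unit_deg k)" by (auto simp: pos_deg_def unit_deg_def fun_ops intro: exI[of _ k])
  then have "x = 0 \<or> gen_at (pos_gens I Vp) (unit_deg k) x"
    using triangular_decomposition[OF assms(1)] m.pos_gens_deg[of "- unit_deg k" x]
    by (auto simp: nonneg_part_def)
  then show ?thesis using pos_gens_unit assms(2) subspace_0[OF Vp_sub] by blast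
qed

end

section \<open>Evaluation of Lie terms\<close>

primrec (in lie_alg) eval_term :: "('x \<Rightarrow> 'v) \<Rightarrow> 'x lie_term \<Rightarrow> 'v" where
  "eval_term g (Gen x) = g x"
| "eval_term g Zero = 0"
| "eval_term g (Add s t) = eval_term g s + eval_term g t"
| "eval_term g (Smul c t) = scl c (eval_term g t)"
| "eval_term g (Brk s t) = br (eval_term g s) (eval_term g t)"

lemma (in lie_alg) eval_term_cong:
  assumes "lie_cong R s t" "\<And>s t. (s, t) \<in> R \<Longrightarrow> eval_term g s = eval_term g t"
  shows "eval_term g s = eval_term g t"
  using assms(1)
proof induction
  case (brk_jacobi s t u)
  show ?case by (simp add: jacobi[of "eval_term g s" "eval_term g t"])
qed (simp_all add: assms(2) br_add_left br_add_right br_scl_left br_scl_right br_self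
    scale_left_distrib scale_right_distrib)

section \<open>The relations of \<open>A\<^sub>l\<^sup>(\<^sup>1\<^sup>,\<^sup>1\<^sup>)\<close> in a Lie algebra\<close>

lemma cartan_A_sym: "cartan_A l i j = cartan_A l j i"
  by (auto simp: cartan_A_def)

lemma cartan_A_same [simp]: "cartan_A l i i = 2"
  by (simp add: cartan_A_def)

lemma cartan_A_cases: "i \<noteq> j \<Longrightarrow> cartan_A l i j = -1 \<or> cartan_A l i j = 0"
  by (auto simp: cartan_A_def)

lemma cartan_A_neighbour:
  assumes "2 \<le> l" "i \<le> l" obtains j where "j \<le> l" "cartan_A l i j = -1"
proof
  show "(i + 1) mod (l + 1) \<le> l" using mod_less_divisor[of "l + 1" "i + 1"] by simp
  have "i \<noteq> (i + 1) mod (l + 1)" using assms by (cases "i = l") auto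
  then show "cartan_A l i ((i + 1) mod (l + 1)) = -1" by (simp add: cartan_A_def)
qed

lemma int_shift_induct:
  fixes P :: "int \<Rightarrow> bool"
  assumes "P 0" "\<And>n. P n \<Longrightarrow> P (n + 1)" "\<And>n. P n \<Longrightarrow> P (n - 1)" shows "P n"
  by (rule int_induct[of P 0]) (use assms in auto)

lemma int_shift2_induct:
  fixes P :: "int \<Rightarrow> bool"
  assumes "P 0" "P 1" "\<And>n. P n \<Longrightarrow> P (n + 2)" "\<And>n. P n \<Longrightarrow> P (n - 2)" shows "P n"
proof -
  have "P n \<and> P (n + 1)"
  proof (induction n rule: int_shift_induct)
    case (2 n) then show ?case using assms(3)[of n] by (simp add: add.assoc)
  next
    case (3 n) then show ?case using assms(4)[of "n + 1"] by simp
  qed (use assms in auto)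
  then show ?thesis ..
qed

lemma int_shift3_induct:
  fixes P :: "int \<Rightarrow> bool"
  assumes "P 0" "P 1" "P 2" "\<And>n. P n \<Longrightarrow> P (n + 3)" "\<And>n. P n \<Longrightarrow> P (n - 3)" shows "P n"
proof -
  have "P n \<and> P (n + 1) \<and> P (n + 2)"
  proof (induction n rule: int_shift_induct)
    case (2 n) then show ?case using assms(4)[of n] by (simp add: add.assoc)
  next
    case (3 n) then show ?case using assms(5)[of "n + 2"] by (simp add: add.commute)
  qed (use assms in auto)
  then show ?thesis by simp
qed

context lie_alg
begin

text \<open>Dimension at most one, in a form that pulls back along injective linear maps without reference to
bases.\<close>

definition thin :: "'v set \<Rightarrow> bool" where
  "thin U \<longleftrightarrow> (\<forall>x\<in>U. \<forall>y\<in>U. \<exists>a b. (a \<noteq> 0 \<or> b \<noteq> 0) \<and> scl a x + scl b y = 0)"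

lemma thin_line: "U \<subseteq> span {v} \<Longrightarrow> thin U"
  unfolding thin_def
proof (intro ballI)
  fix x y assume "U \<subseteq> span {v}" "x \<in> U" "y \<in> U"
  then have "x \<in> span {v}" "y \<in> span {v}" by blast+
  then obtain a b where ab: "x = scl a v" "y = scl b v" by (auto simp: span_singleton)
  show "\<exists>a b. (a \<noteq> 0 \<or> b \<noteq> 0) \<and> scl a x + scl b y = 0"
  proof (cases "a = 0 \<and> b = 0")
    case True then show ?thesis using ab by (intro exI[of _ 1]) auto
  next
    case False
    have "scl b x + scl (- a) y = 0" using ab by (simp add: mult.commute)
    then show ?thesis using False neg_equal_0_iff_equal[of a] by blast
  qed
qed

lemma thin_preimage:
  assumes "thin U'" "subspace U" "\<And>x. x \<in> U \<Longrightarrow> \<phi> x \<in> U'" "\<And>x. x \<in> U \<Longrightarrow> \<phi> x = 0 \<Longrightarrow> x = 0"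
    "\<And>x y. \<phi> (x + y) = \<phi> x + \<phi> y" "\<And>c x. \<phi> (scl c x) = scl c (\<phi> x)"
  shows "thin U"
  unfolding thin_def
proof (intro ballI)
  fix x y assume xy: "x \<in> U" "y \<in> U"
  obtain a b where ab: "a \<noteq> 0 \<or> b \<noteq> 0" "scl a (\<phi> x) + scl b (\<phi> y) = 0"
    using assms(1)[unfolded thin_def, rule_format, OF assms(3)[OF xy(1)] assms(3)[OF xy(2)]] by blast
  have "scl a x + scl b y = 0"
    by (rule assms(4)) (use xy assms(2) ab in \<open>auto simp: subspace_add subspace_scale assms(5,6)\<close>)
  then show "\<exists>a b. (a \<noteq> 0 \<or> b \<noteq> 0) \<and> scl a x + scl b y = 0" using ab by auto
qed

lemma thin_span: assumes "thin U" "v \<in> U" "v \<noteq> 0" "x \<in> U" shows "x \<in> span {v}"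
proof -
  obtain a b where ab: "a \<noteq> 0 \<or> b \<noteq> 0" "scl a x + scl b v = 0"
    using assms(1)[unfolded thin_def, rule_format, OF assms(4,2)] by blast
  have "a \<noteq> 0" using ab assms(3) by auto
  have "scl a x = scl (- b) v" using ab(2) by (simp add: eq_neg_iff_add_eq_0)
  then have "scl (1 / a) (scl a x) = scl (1 / a) (scl (- b) v)" by (rule arg_cong)
  then have "x = scl (1 / a * - b) v" using \<open>a \<noteq> 0\<close> by (simp only: scale_scale) simp
  then show ?thesis unfolding span_singleton by (rule range_eqI)
qed

text \<open>The relation of \<open>g\<^sup>q\<close> between starred and unstarred neighbours, with the scalar left open: the
arguments below do not distinguish the edge that carries \<open>q\<close> from the others.\<close>

definition star_related :: "(nat \<Rightarrow> bool \<Rightarrow> 'v) \<Rightarrow> nat \<Rightarrow> nat \<Rightarrow> bool" where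
  "star_related e i j \<longleftrightarrow> (\<exists>c. c \<noteq> 0 \<and> br (e i True) (e j False) = scl c (br (e i False) (e j True)))"

text \<open>Degree \<open>(p, n)\<close> stands for the weight \<open>p \<alpha>\<^sub>i + n a\<close>; the four generators span a copy of affine
\<open>sl\<^sub>2\<close>.\<close>

definition loop_gens :: "(nat \<Rightarrow> bool \<Rightarrow> 'v) \<Rightarrow> (nat \<Rightarrow> bool \<Rightarrow> 'v) \<Rightarrow> nat \<Rightarrow> ((int \<times> int) \<times> 'v) set" where
  "loop_gens e f i = (\<Union>b. {((1, of_bool b), e i b), ((- 1, - of_bool b), f i b)})"

abbreviation loop_at :: "(nat \<Rightarrow> bool \<Rightarrow> 'v) \<Rightarrow> (nat \<Rightarrow> bool \<Rightarrow> 'v) \<Rightarrow> nat \<Rightarrow> int \<Rightarrow> int \<Rightarrow> 'v \<Rightarrow> bool" where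
  "loop_at e f i p n \<equiv> gen_at (loop_gens e f i) (p, n)"

text \<open>Root vectors for the simple roots \<open>- \<alpha>\<^sub>i - \<alpha>\<^sub>j\<close>, \<open>\<alpha>\<^sub>i + a\<close>, \<open>\<alpha>\<^sub>j\<close> of the affine \<open>sl\<^sub>3\<close> of an edge, in this
order. Exchanging \<open>e\<close> and \<open>f\<close> gives the opposite root vectors.\<close>

definition sl3_root :: "(nat \<Rightarrow> bool \<Rightarrow> 'v) \<Rightarrow> (nat \<Rightarrow> bool \<Rightarrow> 'v) \<Rightarrow> nat \<Rightarrow> nat \<Rightarrow> nat \<Rightarrow> 'v" where
  "sl3_root e f i j k = (if k = 0 then br (f i False) (f j False) else if k = 1 then e i True else e j False)"

lemma loop_at_flip: "loop_at f e i p n x \<longleftrightarrow> loop_at e f i (- p) (- n) x"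
proof
  assume "loop_at f e i p n x"
  then have "gen_at (loop_gens e f i) (- (p, n)) x"
    by (rule gen_at_map) (auto simp: loop_gens_def intro!: gen_at.base)
  then show "loop_at e f i (- p) (- n) x" by simp
next
  assume "loop_at e f i (- p) (- n) x"
  then have "gen_at (loop_gens f e i) (- (- p, - n)) x"
    by (rule gen_at_map) (auto simp: loop_gens_def intro!: gen_at.base)
  then show "loop_at f e i p n x" by simp
qed

lemma loop_at_br: "loop_at e f i p n x \<Longrightarrow> loop_at e f i p' n' y \<Longrightarrow> loop_at e f i (p + p') (n + n') (br x y)"
  using gen_at_br[of "loop_gens e f i" "(p, n)" x "(p', n')" y] by simp

lemma loop_at_gens: "loop_at e f i 1 (of_bool b) (e i b)" "loop_at e f i (- 1) (- of_bool b) (f i b)"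
  by (rule gen_at.base, force simp: loop_gens_def)+

end

text \<open>The weight \<open>- x (\<alpha>\<^sub>i + \<alpha>\<^sub>j) + y (\<alpha>\<^sub>i + a) + z \<alpha>\<^sub>j\<close> is recorded as \<open>deg3 x y z\<close>. So \<open>a\<close> is \<open>deg3 1 1 1\<close>,
\<open>\<alpha>\<^sub>i\<close> is \<open>deg3 (- 1) 0 (- 1)\<close>, and \<open>\<alpha>\<^sub>j + n a\<close> is \<open>deg3 n n (n + 1)\<close>.\<close>

definition deg3 :: "int \<Rightarrow> int \<Rightarrow> int \<Rightarrow> nat \<Rightarrow> int" where
  "deg3 a b c = (\<lambda>n. if n = 0 then a else if n = 1 then b else if n = 2 then c else 0)"

lemma deg3_simps [simp]:
  "deg3 a b c 0 = a" "deg3 a b c (Suc 0) = b" "deg3 a b c 2 = c"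
  "deg3 a b c + deg3 a' b' c' = deg3 (a + a') (b + b') (c + c')" "- deg3 a b c = deg3 (- a) (- b) (- c)"
  by (auto simp: deg3_def fun_eq_iff fun_ops)

lemma unit_deg3: "unit_deg 0 = deg3 1 0 0" "unit_deg (Suc 0) = deg3 0 1 0" "unit_deg 2 = deg3 0 0 1"
  by (auto simp: deg3_def unit_deg_def fun_eq_iff)

text \<open>\<open>e i b\<close> and \<open>f i b\<close> are root vectors for \<open>\<alpha>\<^sub>i\<close> and \<open>- \<alpha>\<^sub>i\<close>, shifted by \<open>a\<close> respectively \<open>- a\<close> if \<open>b\<close>
holds; \<open>w s i\<close> and \<open>z s\<close> are the values of the weight \<open>\<alpha>\<^sub>i\<close> and of \<open>a\<close> on the Cartan element \<open>H s\<close>. The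
assumptions are symmetric under the Chevalley involution (lemma \<open>flip\<close>), so that each statement about
positive roots yields one about negative roots.\<close>

locale elliptic_gens = lie_alg scl br for scl :: "complex \<Rightarrow> 'v::ab_group_add \<Rightarrow> 'v" and br +
  fixes l :: nat and H :: "'s \<Rightarrow> 'v" and w :: "'s \<Rightarrow> nat \<Rightarrow> complex" and z :: "'s \<Rightarrow> complex"
    and co :: "nat \<Rightarrow> bool \<Rightarrow> 's" and e f :: "nat \<Rightarrow> bool \<Rightarrow> 'v"
  assumes l2: "2 \<le> l"
    and HH: "br (H s) (H t) = 0"
    and He: "i \<le> l \<Longrightarrow> br (H s) (e i b) = scl (w s i + of_bool b * z s) (e i b)"
    and Hf: "i \<le> l \<Longrightarrow> br (H s) (f i b) = scl (- (w s i + of_bool b * z s)) (f i b)"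
    and ef: "i \<le> l \<Longrightarrow> br (e i b) (f i b) = H (co i b)"
    and w_co: "i \<le> l \<Longrightarrow> j \<le> l \<Longrightarrow> w (co i b) j = of_int (cartan_A l i j)"
    and z_co: "i \<le> l \<Longrightarrow> z (co i b) = 0"
    and ef_other: "i \<le> l \<Longrightarrow> j \<le> l \<Longrightarrow> i \<noteq> j \<Longrightarrow> br (e i b) (f j b') = 0"
    and ee_same: "i \<le> l \<Longrightarrow> br (e i b) (e i b') = 0"
    and ff_same: "i \<le> l \<Longrightarrow> br (f i b) (f i b') = 0"
    and ee_far: "i \<le> l \<Longrightarrow> j \<le> l \<Longrightarrow> cartan_A l i j = 0 \<Longrightarrow> br (e i b) (e j b') = 0"
    and ff_far: "i \<le> l \<Longrightarrow> j \<le> l \<Longrightarrow> cartan_A l i j = 0 \<Longrightarrow> br (f i b) (f j b') = 0"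
    and ee_near: "i \<le> l \<Longrightarrow> j \<le> l \<Longrightarrow> cartan_A l i j = -1 \<Longrightarrow> br (e i b) (br (e i b) (e j b')) = 0"
    and ff_near: "i \<le> l \<Longrightarrow> j \<le> l \<Longrightarrow> cartan_A l i j = -1 \<Longrightarrow> br (f i b) (br (f i b) (f j b')) = 0"
    and eef: "i \<le> l \<Longrightarrow> b \<noteq> b' \<Longrightarrow> br (e i b) (br (e i b) (br (e i b) (f i b'))) = 0"
    and ffe: "i \<le> l \<Longrightarrow> b \<noteq> b' \<Longrightarrow> br (f i b) (br (f i b) (br (f i b) (e i b'))) = 0"
    and star_e: "i \<le> l \<Longrightarrow> j \<le> l \<Longrightarrow> cartan_A l i j = -1 \<Longrightarrow> star_related e i j"
    and star_f: "i \<le> l \<Longrightarrow> j \<le> l \<Longrightarrow> cartan_A l i j = -1 \<Longrightarrow> star_related f i j"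
    and e_nz: "i \<le> l \<Longrightarrow> e i b \<noteq> 0"
    and f_nz: "i \<le> l \<Longrightarrow> f i b \<noteq> 0"
begin

lemma flip: "elliptic_gens scl br l (\<lambda>s. - H s) w z co f e"
proof unfold_locales
  fix i j b b' assume "i \<le> l" "j \<le> l" "i \<noteq> j"
  then show "br (f i b) (e j b') = 0" using ef_other[of j i b' b] br_eq_0_sym by blast
next
  fix i b s assume i: "i \<le> l"
  show "br (- H s) (f i b) = scl (w s i + of_bool b * z s) (f i b)"
    by (simp only: br_minus_left Hf[OF i] scale_minus_left minus_minus)
  show "br (- H s) (e i b) = scl (- (w s i + of_bool b * z s)) (e i b)"
    by (simp only: br_minus_left He[OF i] scale_minus_left)
next
  fix i b assume "i \<le> l"
  then show "br (f i b) (e i b) = - H (co i b)" using ef br_skew[of "f i b" "e i b"] by simp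
qed (simp_all add: l2 HH w_co z_co ee_same ff_same ee_far ff_far ee_near ff_near eef ffe star_e star_f
    e_nz f_nz br_minus_left br_minus_right)

definition gens :: "'v set" where
  "gens = range H \<union> {e i b | i b. i \<le> l} \<union> {f i b | i b. i \<le> l}"

definition alg :: "'v set" where
  "alg = {x. gen_at (Pair (0::int) ` gens) 0 x}"

lemma alg_subspace: "subspace alg" unfolding alg_def by (rule gen_at_subspace)

lemma alg_br: "x \<in> alg \<Longrightarrow> y \<in> alg \<Longrightarrow> br x y \<in> alg"
  unfolding alg_def using gen_at_br[of "Pair (0::int) ` gens" 0 x 0 y] by simp

lemma alg_gens: "gens \<subseteq> alg"
  unfolding alg_def by (auto intro: gen_at.base)

lemma alg_e: "i \<le> l \<Longrightarrow> e i b \<in> alg" and alg_f: "i \<le> l \<Longrightarrow> f i b \<in> alg" and alg_H: "H s \<in> alg"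
  using alg_gens unfolding gens_def by blast+

lemma alg_least:
  assumes "x \<in> alg" "gens \<subseteq> U" "subspace U" "\<And>x y. x \<in> U \<Longrightarrow> y \<in> U \<Longrightarrow> br x y \<in> U"
  shows "x \<in> U"
  using assms(1) unfolding alg_def mem_Collect_eq by (rule gen_at_in) (use assms(2-) in auto)

lemma flip_alg: "elliptic_gens.alg scl br l (\<lambda>s. - H s) f e = alg"
proof -
  interpret fl: elliptic_gens scl br l "\<lambda>s. - H s" w z co f e by (rule flip)
  have "gens \<subseteq> fl.alg"
    using fl.alg_e fl.alg_f subspace_neg[OF fl.alg_subspace fl.alg_H] by (auto simp: gens_def)
  moreover have "fl.gens \<subseteq> alg"
    using alg_e alg_f subspace_neg[OF alg_subspace alg_H] by (auto simp: fl.gens_def)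
  ultimately show ?thesis using alg_least[OF _ _ fl.alg_subspace fl.alg_br] fl.alg_least[OF _ _ alg_subspace alg_br] by blast
qed

text \<open>Integrability. By \<open>ad_nil_br\<close> only the action on generators has to be inspected, where nilpotency is
a Serre relation.\<close>

lemma f_nil:
  assumes "i \<le> l" "x \<in> alg" shows "ad_nil (f i b) x"
proof -
  have "x \<in> {x. ad_nil (f i b) x}"
  proof (rule alg_least[OF assms(2)])
    show "subspace {x. ad_nil (f i b) x}"
      by (auto simp: subspace_def ad_nil_zero ad_nil_add ad_nil_scl)
    have "ad_nil (f i b) (H s)" for s
    proof (rule ad_nilI[of 2])
      show "(br (f i b) ^^ 2) (H s) = 0"
        using Hf[OF assms(1)] by (simp add: numeral_2_eq_2 br_skew[of "f i b" "H s"] br_minus_right br_scl_right br_self)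
    qed
    moreover have "ad_nil (f i b) (e j b')" if "j \<le> l" for j b'
    proof (cases "i = j")
      case True
      show ?thesis
      proof (rule ad_nilI[of 3])
        show "(br (f i b) ^^ 3) (e j b') = 0"
        proof (cases "b = b'")
          case True
          then show ?thesis using \<open>i = j\<close> ef[OF assms(1)] Hf[OF assms(1)]
            by (simp add: numeral_3_eq_3 br_skew[of "f j b'" "e j b'"] br_skew[of "f j b'" "H _"] br_minus_right br_scl_right br_self)
        next
          case False
          then show ?thesis using \<open>i = j\<close> ffe[OF assms(1)] by (simp add: numeral_3_eq_3)
        qed
      qed
    next
      case False
      show ?thesis by (rule ad_nilI[of 1]) (use False ef_other[OF that assms(1)] br_eq_0_sym in simp)
    qed
    moreover have "ad_nil (f i b) (f j b')" if "j \<le> l" for j b'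
    proof -
      consider "i = j" | "cartan_A l i j = -1" | "cartan_A l i j = 0" using cartan_A_cases by blast
      then show ?thesis
        by cases (rule ad_nilI[of 2]; simp add: numeral_2_eq_2 that assms ff_same ff_near ff_far)+
    qed
    ultimately show "gens \<subseteq> {x. ad_nil (f i b) x}" by (auto simp: gens_def)
  qed (simp add: ad_nil_br)
  then show ?thesis by simp
qed

lemma raise_inj:
  assumes "i \<le> l" "x \<in> alg" "br (H (co i b)) x = scl (of_int k) x" "k = - int m" "(br (e i b) ^^ m) x = 0"
  shows "x = 0"
  by (rule sl2_raising_injective[OF ef[OF assms(1), of b] _ _ _ f_nil[OF assms(1,2)] assms(5)])
    (use assms in \<open>simp_all add: He Hf w_co z_co\<close>)

lemma lower_inj:
  assumes "i \<le> l" "x \<in> alg" "br (H (co i b)) x = scl (of_int k) x" "k = int m" "(br (f i b) ^^ m) x = 0"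
  shows "x = 0"
proof -
  interpret fl: elliptic_gens scl br l "\<lambda>s. - H s" w z co f e by (rule flip)
  show ?thesis
    using fl.raise_inj[of i x b "- k" m] assms flip_alg by (simp add: br_minus_left)
qed

lemma loop_alg: assumes "loop_at e f i p n x" "i \<le> l" shows "x \<in> alg"
  by (rule gen_at_in[OF assms(1) _ alg_subspace alg_br]) (auto simp: loop_gens_def intro: alg_e alg_f assms(2))

lemma loop_weight: assumes "loop_at e f i p n x" "i \<le> l"
  shows "br (H s) x = scl (of_int p * w s i + of_int n * z s) x"
proof -
  have "br (H s) x = scl ((\<lambda>(p, n). of_int p * w s i + of_int n * z s) (p, n)) x"
    by (rule gen_at_weight[OF assms(1)])
      (auto simp: loop_gens_def He Hf assms(2) algebra_simps)
  then show ?thesis by simp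
qed

lemma loop_co: assumes "loop_at e f i p n x" "i \<le> l"
  shows "br (H (co i b)) x = scl (of_int (2 * p)) x"
  using loop_weight[OF assms, of "co i b"] by (simp add: w_co z_co assms mult.commute)

text \<open>Two successive strings realise \<open>s\<^sub>\<alpha>\<^sub>+\<^sub>a s\<^sub>\<alpha>\<close> and \<open>s\<^sub>\<alpha> s\<^sub>\<alpha>\<^sub>+\<^sub>a\<close>, which translate \<open>\<alpha> + n a\<close> by \<open>2 a\<close> and
\<open>- 2 a\<close>; starting from \<open>\<alpha>\<close> and \<open>\<alpha> + a\<close> every \<open>n\<close> is reached.\<close>

lemma loop_nonzero: assumes "i \<le> l" shows "\<exists>x. x \<noteq> 0 \<and> loop_at e f i 1 n x"
proof (induction n rule: int_shift2_induct)
  case 1 then show ?case using loop_at_gens(1)[of e f i False] e_nz[OF assms] by auto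
next
  case 2 then show ?case using loop_at_gens(1)[of e f i True] e_nz[OF assms] by auto
next
  case (3 n)
  then obtain x where x: "x \<noteq> 0" "loop_at e f i 1 n x" by blast
  define y where "y = (br (f i False) ^^ 2) x"
  have y: "loop_at e f i (- 1) n y"
    using loop_at_br[OF loop_at_gens(2)[of e f i False] loop_at_br[OF loop_at_gens(2)[of e f i False] x(2)]]
    by (simp add: y_def numeral_2_eq_2)
  have "y \<noteq> 0" using lower_inj[OF assms loop_alg[OF x(2) assms] loop_co[OF x(2) assms], of 2 False] x(1)
    by (auto simp: y_def)
  define u where "u = (br (e i True) ^^ 2) y"
  have u: "loop_at e f i 1 (n + 2) u"
    using loop_at_br[OF loop_at_gens(1)[of e f i True] loop_at_br[OF loop_at_gens(1)[of e f i True] y]]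
    by (simp add: u_def numeral_2_eq_2 add.commute)
  have "u \<noteq> 0" using raise_inj[OF assms loop_alg[OF y assms] loop_co[OF y assms], of 2 True] \<open>y \<noteq> 0\<close>
    by (auto simp: u_def)
  then show ?case using u by blast
next
  case (4 n)
  then obtain x where x: "x \<noteq> 0" "loop_at e f i 1 n x" by blast
  define y where "y = (br (f i True) ^^ 2) x"
  have y: "loop_at e f i (- 1) (n - 2) y"
    using loop_at_br[OF loop_at_gens(2)[of e f i True] loop_at_br[OF loop_at_gens(2)[of e f i True] x(2)]]
    by (simp add: y_def numeral_2_eq_2)
  have "y \<noteq> 0" using lower_inj[OF assms loop_alg[OF x(2) assms] loop_co[OF x(2) assms], of 2 True] x(1)
    by (auto simp: y_def)
  define u where "u = (br (e i False) ^^ 2) y"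
  have u: "loop_at e f i 1 (n - 2) u"
    using loop_at_br[OF loop_at_gens(1)[of e f i False] loop_at_br[OF loop_at_gens(1)[of e f i False] y]]
    by (simp add: u_def numeral_2_eq_2)
  have "u \<noteq> 0" using raise_inj[OF assms loop_alg[OF y assms] loop_co[OF y assms], of 2 False] \<open>y \<noteq> 0\<close>
    by (auto simp: u_def)
  then show ?case using u by blast
qed

end

section \<open>The affine \<open>sl\<^sub>3\<close> of an edge\<close>

context elliptic_gens
begin

abbreviation S :: "nat \<Rightarrow> nat \<Rightarrow> (nat \<Rightarrow> int) \<Rightarrow> 'v \<Rightarrow> bool" where
  "S i j \<equiv> gen_at (tri_gens {0, Suc 0, 2} (\<lambda>k. span {sl3_root e f i j k}) (\<lambda>k. span {sl3_root f e i j k}) (range H))"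

lemma H_span_line:
  assumes "\<And>s. \<exists>c. br (H s) v = scl c v" "x \<in> span (range H)" "y \<in> span {v}"
  shows "br x y \<in> span {v}"
proof (rule br_span_span[OF assms(2,3)])
  fix a b assume "a \<in> range H" "b \<in> {v}"
  then show "br a b \<in> span {v}" using assms(1) by (auto simp: span_singleton)
qed simp

lemma H_in_span: "H s \<in> span (range H)"
  by (simp add: span_base)

end

locale elliptic_edge = elliptic_gens +
  fixes i j :: nat
  assumes i: "i \<le> l" and j: "j \<le> l" and near: "cartan_A l i j = -1"
begin

lemma ij: "i \<noteq> j" using near by auto
lemma near': "cartan_A l j i = -1" using near by (simp add: cartan_A_sym)

lemma flip_edge: "elliptic_edge scl br l (\<lambda>s. - H s) w z co f e i j"
  using flip i j near by (simp add: elliptic_edge_def elliptic_edge_axioms_def)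

text \<open>The next lemmas verify the Chevalley relations for the new simple roots. Those that involve
\<open>- \<alpha>\<^sub>i - \<alpha>\<^sub>j\<close> rest on the star relations, see \<open>e_theta\<close>.\<close>

lemma H_sl3_root: "\<exists>c. br (H s) (sl3_root e f i j k) = scl c (sl3_root e f i j k)"
proof -
  have "br (H s) (br (f i False) (f j False)) = scl (- (w s i) - w s j) (br (f i False) (f j False))"
    by (subst jacobi) (simp add: Hf i j br_scl_left br_scl_right br_minus_left br_minus_right scale_left_diff_distrib)
  then show ?thesis using He[OF i] He[OF j] by (auto simp: sl3_root_def)
qed

text \<open>The star relation replaces \<open>[e\<^sub>i\<^sup>*, e\<^sub>j]\<close> by a multiple of \<open>[e\<^sub>i, e\<^sub>j\<^sup>*]\<close>, and then a Serre relation applies.\<close>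

lemma e_theta: "br (e i True) (br (e i False) (e j False)) = 0"
proof -
  obtain c where "br (e i True) (e j False) = scl c (br (e i False) (e j True))"
    using star_e[OF i j near] unfolding star_related_def by blast
  then show ?thesis by (subst jacobi) (simp add: ee_same i br_scl_right ee_near[OF i j near])
qed

lemma e_theta': "br (e j False) (br (e i False) (e j False)) = 0"
  using ee_near[OF j i near'] by (simp add: br_skew[of "e i False" "e j False"] br_minus_right)

lemma fj_theta: "br (f j False) (br (e i False) (e j False)) = - e i False"
proof -
  have "br (f j False) (e i False) = 0" using ef_other[OF i j ij] br_eq_0_sym by blast
  moreover have "br (f j False) (e j False) = - H (co j False)" using ef[OF j] br_skew by metis
  moreover have "br (e i False) (H (co j False)) = e i False"
    using He[OF i, of "co j False" False] by (simp add: br_skew[of "e i False"] w_co[OF j i] z_co j near')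
  ultimately show ?thesis by (subst jacobi) (simp add: br_minus_right)
qed

lemma fi_theta: "br (f i False) (br (e i False) (e j False)) = e j False"
proof -
  have "br (f i False) (e j False) = 0" using ef_other[OF j i ij[symmetric]] br_eq_0_sym by blast
  moreover have "br (f i False) (e i False) = - H (co i False)" using ef[OF i] br_skew by metis
  ultimately show ?thesis using He[OF j, of "co i False" False]
    by (subst jacobi) (simp add: br_minus_left w_co[OF i j] z_co i near)
qed

lemma theta_theta: "br (br (f i False) (f j False)) (br (e i False) (e j False)) \<in> span (range H)"
proof -
  have "br (br (f i False) (f j False)) (br (e i False) (e j False)) =
      br (f i False) (- e i False) - br (f j False) (e j False)"
    by (simp only: jacobi_left fj_theta fi_theta)
  also have "\<dots> = H (co i False) + H (co j False)"
    using ef[OF i] ef[OF j] br_skew[of "f i False" "e i False"] br_skew[of "f j False" "e j False"]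
    by (simp add: br_minus_right)
  finally show ?thesis by (simp add: span_add H_in_span)
qed

lemma sl3_other:
  assumes "k \<in> {0, Suc 0, 2}" "m \<in> {0, Suc 0, 2}" "k \<noteq> m"
  shows "br (sl3_root e f i j k) (sl3_root f e i j m) = 0"
proof -
  interpret fl: elliptic_edge scl br l "\<lambda>s. - H s" w z co f e i j by (rule flip_edge)
  show ?thesis
    using assms e_theta e_theta' br_eq_0_sym[OF fl.e_theta] br_eq_0_sym[OF fl.e_theta']
      ef_other[OF i j ij] ef_other[OF j i ij[symmetric]]
    by (auto simp: sl3_root_def)
qed

lemma sl3_same: "br (sl3_root e f i j k) (sl3_root f e i j k) \<in> span (range H)"
  using theta_theta ef[OF i] ef[OF j] H_in_span by (auto simp: sl3_root_def)

lemma edge_triangular: "triangular scl br {0, Suc 0, 2} (\<lambda>k. span {sl3_root e f i j k})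
   (\<lambda>k. span {sl3_root f e i j k}) (range H) (span (range H))"
proof -
  interpret fl: elliptic_edge scl br l "\<lambda>s. - H s" w z co f e i j by (rule flip_edge)
  have hm: "\<exists>c. br (H s) (sl3_root f e i j k) = scl c (sl3_root f e i j k)" for s k
  proof -
    obtain c where "br (- H s) (sl3_root f e i j k) = scl c (sl3_root f e i j k)"
      using fl.H_sl3_root[of s k] by blast
    moreover have "br (H s) (sl3_root f e i j k) = - br (- H s) (sl3_root f e i j k)"
      by (simp add: br_minus_left)
    ultimately have "br (H s) (sl3_root f e i j k) = scl (- c) (sl3_root f e i j k)" by simp
    then show ?thesis ..
  qed
  show ?thesis
  proof unfold_locales
    fix k m :: nat and x y
    assume km: "k \<in> {0, Suc 0, 2}" "m \<in> {0, Suc 0, 2}" "k \<noteq> m"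
      and xy: "x \<in> span {sl3_root e f i j k}" "y \<in> span {sl3_root f e i j m}"
    have "br x y \<in> {0}" by (rule br_line[OF _ subspace_single_0 xy]) (simp add: sl3_other[OF km])
    then show "br x y = 0" by simp
  next
    fix k x y assume "x \<in> span {sl3_root e f i j k}" "y \<in> span {sl3_root f e i j k}"
    then show "br x y \<in> span (range H)" by (rule br_line[OF sl3_same subspace_span])
  next
    fix x y assume "x \<in> range H" "y \<in> span (range H)"
    show "br x y \<in> span (range H)"
      by (rule br_span_right[OF \<open>y \<in> span (range H)\<close> subspace_span])
        (use \<open>x \<in> range H\<close> in \<open>auto simp: HH span_zero\<close>)
  next
    fix k x y assume "x \<in> span (range H)" "y \<in> span {sl3_root e f i j k}"
    then show "br x y \<in> span {sl3_root e f i j k}" by (rule H_span_line[OF H_sl3_root])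
  next
    fix k x y assume "x \<in> span (range H)" "y \<in> span {sl3_root f e i j k}"
    then show "br x y \<in> span {sl3_root f e i j k}" by (rule H_span_line[OF hm])
  qed (rule subspace_span span_superset)+
qed

sublocale tri: triangular scl br "{0, Suc 0, 2}" "\<lambda>k. span {sl3_root e f i j k}"
   "\<lambda>k. span {sl3_root f e i j k}" "range H" "span (range H)"
  by (rule edge_triangular)

lemma S_br: "S i j d x \<Longrightarrow> S i j d' y \<Longrightarrow> d'' = d + d' \<Longrightarrow> S i j d'' (br x y)"
  by (simp add: gen_at_br)

lemma S_base:
  assumes "k \<in> {0, Suc 0, 2}"
  shows "S i j (unit_deg k) (sl3_root e f i j k)" "S i j (- unit_deg k) (sl3_root f e i j k)"
proof -
  have "(unit_deg k, sl3_root e f i j k) \<in> pos_gens {0, Suc 0, 2} (\<lambda>k. span {sl3_root e f i j k})"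
    "(unit_deg k, sl3_root f e i j k) \<in> pos_gens {0, Suc 0, 2} (\<lambda>k. span {sl3_root f e i j k})"
    using assms span_base unfolding pos_gens_def by blast+
  then show "S i j (unit_deg k) (sl3_root e f i j k)" "S i j (- unit_deg k) (sl3_root f e i j k)"
    by (auto intro!: gen_at.base simp: tri_gens_def image_iff split: prod.splits)
qed

lemma S_ei1: "S i j (deg3 0 1 0) (e i True)" and S_fi1: "S i j (deg3 0 (- 1) 0) (f i True)"
  and S_ej0: "S i j (deg3 0 0 1) (e j False)" and S_fj0: "S i j (deg3 0 0 (- 1)) (f j False)"
  and S_ff: "S i j (deg3 1 0 0) (br (f i False) (f j False))"
  and S_ee: "S i j (deg3 (- 1) 0 0) (br (e i False) (e j False))"
  using S_base(1)[of "Suc 0"] S_base(2)[of "Suc 0"] S_base(1)[of 2] S_base(2)[of 2] S_base(1)[of 0] S_base(2)[of 0]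
  by (simp_all add: unit_deg3 sl3_root_def)

lemma S_ei0: "S i j (deg3 (- 1) 0 (- 1)) (e i False)"
proof -
  have "S i j (deg3 (- 1) 0 (- 1)) (br (f j False) (br (e i False) (e j False)))"
    by (rule S_br[OF S_fj0 S_ee]) simp
  then show ?thesis using gen_at_uminus[of _ _ "- e i False"] unfolding fj_theta by simp
qed

lemma S_fi0: "S i j (deg3 1 0 1) (f i False)"
proof -
  interpret fl: elliptic_edge scl br l "\<lambda>s. - H s" w z co f e i j by (rule flip_edge)
  have "S i j (deg3 1 0 1) (br (e j False) (br (f i False) (f j False)))"
    by (rule S_br[OF S_ej0 S_ff]) simp
  then show ?thesis using gen_at_uminus[of _ _ "- f i False"] unfolding fl.fj_theta by simp
qed

text \<open>The root vector of \<open>\<alpha>\<^sub>j + a\<close> is not among the generators of the affine \<open>sl\<^sub>3\<close>; by the star relation it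
lies in the subalgebra that they generate.\<close>

lemma ej1_theta: "\<exists>c. e j True = scl c (br (f i False) (br (e i True) (e j False)))"
proof -
  obtain c where c: "c \<noteq> 0" "br (e i True) (e j False) = scl c (br (e i False) (e j True))"
    using star_e[OF i j near] unfolding star_related_def by blast
  have "br (f i False) (e j True) = 0" using ef_other[OF j i ij[symmetric]] br_eq_0_sym by blast
  moreover have "br (f i False) (e i False) = - H (co i False)" using ef[OF i] br_skew by metis
  ultimately have "br (f i False) (br (e i False) (e j True)) = e j True"
    using He[OF j, of "co i False" True]
    by (subst jacobi) (simp add: br_minus_left w_co[OF i j] z_co i near)
  then have "e j True = scl (1 / c) (br (f i False) (br (e i True) (e j False)))"
    using c by (simp add: br_scl_right)
  then show ?thesis ..
qed

lemma S_ej1: "S i j (deg3 1 1 2) (e j True)"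
proof -
  have "S i j (deg3 1 1 2) (br (f i False) (br (e i True) (e j False)))"
    by (rule S_br[OF S_fi0 S_br[OF S_ei1 S_ej0 HOL.refl]]) simp
  then show ?thesis using ej1_theta gen_at.scale by fastforce
qed

lemma S_fj1: "S i j (deg3 (- 1) (- 1) (- 2)) (f j True)"
proof -
  interpret fl: elliptic_edge scl br l "\<lambda>s. - H s" w z co f e i j by (rule flip_edge)
  have "S i j (deg3 (- 1) (- 1) (- 2)) (br (e i False) (br (f i True) (f j False)))"
    by (rule S_br[OF S_ei0 S_br[OF S_fi1 S_fj0 HOL.refl]]) simp
  then show ?thesis using fl.ej1_theta gen_at.scale by fastforce
qed

lemma S_alg: assumes "S i j d x" shows "x \<in> alg"
proof (rule gen_at_in[OF assms _ alg_subspace alg_br])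
  fix d x assume "(d, x) \<in> tri_gens {0, Suc 0, 2} (\<lambda>k. span {sl3_root e f i j k}) (\<lambda>k. span {sl3_root f e i j k}) (range H)"
  moreover have "span {sl3_root e f i j k} \<subseteq> alg" "span {sl3_root f e i j k} \<subseteq> alg" for k
    by (rule span_minimal[OF _ alg_subspace]; simp add: sl3_root_def alg_br alg_e alg_f i j)+
  ultimately show "x \<in> alg" using alg_H by (auto simp: tri_gens_def pos_gens_def)
qed

lemma S_weight:
  assumes "S i j d x"
  shows "br (H s) x = scl (of_int (d 1) * (w s i + z s) + of_int (d 2) * w s j - of_int (d 0) * (w s i + w s j)) x"
proof (rule gen_at_weight[OF assms, where \<chi> = "\<lambda>d. of_int (d 1) * (w s i + z s) + of_int (d 2) * w s j - of_int (d 0) * (w s i + w s j)"])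
  have ff: "br (H s) (br (f i False) (f j False)) = scl (- (w s i) - w s j) (br (f i False) (f j False))"
    by (subst jacobi) (simp add: Hf i j br_scl_left br_scl_right br_minus_left br_minus_right scale_left_diff_distrib)
  have ee: "br (H s) (br (e i False) (e j False)) = scl (w s i + w s j) (br (e i False) (e j False))"
    by (subst jacobi) (simp add: He i j br_scl_left br_scl_right scale_left_distrib)
  have e1: "br (H s) (e i True) = scl (w s i + z s) (e i True)" "br (H s) (f i True) = scl (- (w s i + z s)) (f i True)"
    "br (H s) (e j False) = scl (w s j) (e j False)" "br (H s) (f j False) = scl (- w s j) (f j False)"
    using He[OF i, of s True] Hf[OF i, of s True] He[OF j, of s False] Hf[OF j, of s False] by simp_all
  fix d x assume g: "(d, x) \<in> tri_gens {0, Suc 0, 2} (\<lambda>k. span {sl3_root e f i j k}) (\<lambda>k. span {sl3_root f e i j k}) (range H)"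
  consider k where "k \<in> {0, Suc 0, 2}" "d = unit_deg k" "x \<in> span {sl3_root e f i j k}"
    | k where "k \<in> {0, Suc 0, 2}" "d = - unit_deg k" "x \<in> span {sl3_root f e i j k}" | t where "d = 0" "x = H t"
  proof -
    from g consider "(d, x) \<in> pos_gens {0, Suc 0, 2} (\<lambda>k. span {sl3_root e f i j k})"
      | d' where "d = - d'" "(d', x) \<in> pos_gens {0, Suc 0, 2} (\<lambda>k. span {sl3_root f e i j k})" | "d = 0" "x \<in> range H"
      unfolding tri_gens_def by (elim UnE) auto
    then show thesis by cases (use that in \<open>auto simp: pos_gens_def\<close>)
  qed
  then show "br (H s) x = scl (of_int (d 1) * (w s i + z s) + of_int (d 2) * w s j - of_int (d 0) * (w s i + w s j)) x"
  proof cases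
    case 1
    then have "br (H s) (sl3_root e f i j k) = scl (of_int (d 1) * (w s i + z s) + of_int (d 2) * w s j - of_int (d 0) * (w s i + w s j)) (sl3_root e f i j k)"
      using ff e1 by (auto simp: sl3_root_def unit_deg_def)
    moreover obtain c where "x = scl c (sl3_root e f i j k)" using 1(3) by (auto simp: span_singleton)
    ultimately show ?thesis by (simp only: br_scl_right scale_left_commute)
  next
    case 2
    then have "br (H s) (sl3_root f e i j k) = scl (of_int (d 1) * (w s i + z s) + of_int (d 2) * w s j - of_int (d 0) * (w s i + w s j)) (sl3_root f e i j k)"
      using ee e1 by (auto simp: sl3_root_def unit_deg_def fun_ops)
    moreover obtain c where "x = scl c (sl3_root f e i j k)" using 2(3) by (auto simp: span_singleton)
    ultimately show ?thesis by (simp only: br_scl_right scale_left_commute)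
  next
    case 3 then show ?thesis by (simp add: HH fun_ops)
  qed
next
  fix d d' :: "nat \<Rightarrow> int"
  show "of_int ((d + d') 1) * (w s i + z s) + of_int ((d + d') 2) * w s j - of_int ((d + d') 0) * (w s i + w s j) =
    of_int (d 1) * (w s i + z s) + of_int (d 2) * w s j - of_int (d 0) * (w s i + w s j) +
    (of_int (d' 1) * (w s i + z s) + of_int (d' 2) * w s j - of_int (d' 0) * (w s i + w s j))"
    unfolding fun_ops of_int_add by (simp add: ring_distribs)
qed

lemma S_co_i: assumes "S i j (deg3 a b c) x" shows "br (H (co i b')) x = scl (of_int (2 * b - c - a)) x"
  using S_weight[OF assms, of "co i b'"] by (simp add: w_co z_co i j near mult.commute diff_right_commute)

lemma S_co_j: assumes "S i j (deg3 a b c) x" shows "br (H (co j b')) x = scl (of_int (2 * c - b - a)) x"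
  using S_weight[OF assms, of "co j b'"] by (simp add: w_co z_co i j near' mult.commute)

lemma S_pow: "S i j d y \<Longrightarrow> S i j d' x \<Longrightarrow> S i j ((\<lambda>n. int m * d n) + d') ((br y ^^ m) x)"
proof (induction m)
  case (Suc m)
  have eq: "(\<lambda>n. int (Suc m) * d n) + d' = d + ((\<lambda>n. int m * d n) + d')"
    by (simp add: fun_eq_iff fun_ops algebra_simps)
  show ?case unfolding eq funpow.simps comp_apply by (rule gen_at_br[OF Suc.prems(1) Suc.IH[OF Suc.prems]])
qed (simp add: plus_fun_def)

lemma S_pow3:
  assumes "S i j (deg3 p q r) y" "S i j (deg3 a b c) x"
    "a' = int m * p + a" "b' = int m * q + b" "c' = int m * r + c"
  shows "S i j (deg3 a' b' c') ((br y ^^ m) x)"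
proof -
  have "(\<lambda>n. int m * deg3 p q r n) + deg3 a b c = deg3 a' b' c'"
    using assms(3-) by (auto simp: deg3_def fun_eq_iff fun_ops)
  then show ?thesis using S_pow[OF assms(1,2), of m] by simp
qed

text \<open>For \<open>n = 0\<close> the weight \<open>\<alpha>\<^sub>j\<close> is simple. The reflections in \<open>\<alpha>\<^sub>i\<close> and \<open>\<alpha>\<^sub>i + a\<close>, realised by injective
\<open>sl\<^sub>2\<close> strings of length one, translate \<open>\<alpha>\<^sub>j + n a\<close> by \<open>a\<close> or \<open>- a\<close> and transport the bound.\<close>

lemma thin_root: "thin {x. S i j (deg3 n n (n + 1)) x}"
proof (induction n rule: int_shift_induct)
  case 1
  have "{x. S i j (deg3 0 0 1) x} \<subseteq> span {e j False}"
    using tri.unit_degree[of 2] by (auto simp: unit_deg3 sl3_root_def)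
  then show ?case by (simp add: thin_line)
next
  case (2 n)
  show ?case
  proof (rule thin_preimage[OF 2 gen_at_subspace, where \<phi> = "\<lambda>x. br (f i True) (br (e i False) x)"])
    fix x assume "x \<in> {x. S i j (deg3 (n + 1) (n + 1) (n + 1 + 1)) x}"
    then have x: "S i j (deg3 (n + 1) (n + 1) (n + 2)) x" by (simp add: add.assoc)
    have y: "S i j (deg3 n (n + 1) (n + 1)) (br (e i False) x)" by (rule S_br[OF S_ei0 x]) (simp add: add.commute)
    have u: "S i j (deg3 n n (n + 1)) (br (f i True) (br (e i False) x))" by (rule S_br[OF S_fi1 y]) simp
    then show "br (f i True) (br (e i False) x) \<in> {x. S i j (deg3 n n (n + 1)) x}" by simp
    assume "br (f i True) (br (e i False) x) = 0"
    then have "br (e i False) x = 0"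
      by (intro lower_inj[OF i S_alg[OF y] S_co_i[OF y, of True], of 1]) simp_all
    then show "x = 0"
      by (intro raise_inj[OF i S_alg[OF x] S_co_i[OF x, of False], of 1]) simp_all
  qed (simp_all add: br_add_right br_scl_right)
next
  case (3 n)
  show ?case
  proof (rule thin_preimage[OF 3 gen_at_subspace, where \<phi> = "\<lambda>x. br (f i False) (br (e i True) x)"])
    fix x assume "x \<in> {x. S i j (deg3 (n - 1) (n - 1) (n - 1 + 1)) x}"
    then have x: "S i j (deg3 (n - 1) (n - 1) n) x" by simp
    have y: "S i j (deg3 (n - 1) n n) (br (e i True) x)" by (rule S_br[OF S_ei1 x]) simp
    have u: "S i j (deg3 n n (n + 1)) (br (f i False) (br (e i True) x))" by (rule S_br[OF S_fi0 y]) (simp add: add.commute)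
    then show "br (f i False) (br (e i True) x) \<in> {x. S i j (deg3 n n (n + 1)) x}" by simp
    assume "br (f i False) (br (e i True) x) = 0"
    then have "br (e i True) x = 0"
      by (intro lower_inj[OF i S_alg[OF y] S_co_i[OF y, of False], of 1]) simp_all
    then show "x = 0"
      by (intro raise_inj[OF i S_alg[OF x] S_co_i[OF x, of True], of 1]) simp_all
  qed (simp_all add: br_add_right br_scl_right)
qed

text \<open>\<open>deg3 (k - 1) k (k - 2)\<close> is \<open>\<alpha>\<^sub>i - \<alpha>\<^sub>j + k a\<close>. It is of mixed sign for \<open>k = 1\<close>, and its image under a
simple reflection is of mixed sign for \<open>k = 0\<close> and \<open>k = 2\<close>; the translations by \<open>3 a\<close> that come from
the reflections in \<open>\<alpha>\<^sub>j\<close> and \<open>\<alpha>\<^sub>j + a\<close> reduce every other \<open>k\<close> to these.\<close>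

lemma difference_zero: "S i j (deg3 (k - 1) k (k - 2)) x \<Longrightarrow> x = 0"
proof (induction k arbitrary: x rule: int_shift3_induct)
  case 1
  have x: "S i j (deg3 (- 1) 0 (- 2)) x" using 1 by simp
  have y: "S i j (deg3 (- 1) 0 1) ((br (e j False) ^^ 3) x)" by (rule S_pow3[OF S_ej0 x]) simp_all
  have "(br (e j False) ^^ 3) x = 0" by (rule tri.mixed_degree_zero[OF y, of 0 2]) simp_all
  then show ?case by (intro raise_inj[OF j S_alg[OF x] S_co_j[OF x, of False], of 3]) simp_all
next
  case 2
  then have x: "S i j (deg3 0 1 (- 1)) x" by simp
  show ?case by (rule tri.mixed_degree_zero[OF x, of 2 1]) simp_all
next
  case 3
  then have x: "S i j (deg3 1 2 0) x" by simp
  have y: "S i j (deg3 1 (- 1) 0) ((br (f i True) ^^ 3) x)" by (rule S_pow3[OF S_fi1 x]) simp_all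
  have "(br (f i True) ^^ 3) x = 0" by (rule tri.mixed_degree_zero[OF y, of 1 0]) simp_all
  then show ?case by (intro lower_inj[OF i S_alg[OF x] S_co_i[OF x, of True], of 3]) simp_all
next
  \<comment> \<open>the reflections in \<open>\<alpha>\<^sub>j\<close> and then in \<open>\<alpha>\<^sub>j + a\<close> lead from \<open>k + 3\<close> to \<open>k\<close>\<close>
  case (4 k)
  have x: "S i j (deg3 (k + 2) (k + 3) (k + 1)) x" using 4(2) by (simp add: algebra_simps)
  have y: "S i j (deg3 (k + 2) (k + 3) (k + 4)) ((br (e j False) ^^ 3) x)" by (rule S_pow3[OF S_ej0 x]) simp_all
  have u: "S i j (deg3 (k - 1) k (k - 2)) ((br (f j True) ^^ 3) ((br (e j False) ^^ 3) x))"
    by (rule S_pow3[OF S_fj1 y]) simp_all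
  from 4(1)[OF u] have "(br (e j False) ^^ 3) x = 0"
    by (intro lower_inj[OF j S_alg[OF y] S_co_j[OF y, of True], of 3]) simp_all
  then show ?case by (intro raise_inj[OF j S_alg[OF x] S_co_j[OF x, of False], of 3]) simp_all
next
  \<comment> \<open>in the opposite order they lead from \<open>k - 3\<close> to \<open>k\<close>\<close>
  case (5 k)
  have x: "S i j (deg3 (k - 4) (k - 3) (k - 5)) x" using 5(2) by (simp add: algebra_simps)
  have y: "S i j (deg3 (k - 1) k (k + 1)) ((br (e j True) ^^ 3) x)" by (rule S_pow3[OF S_ej1 x]) simp_all
  have u: "S i j (deg3 (k - 1) k (k - 2)) ((br (f j False) ^^ 3) ((br (e j True) ^^ 3) x))"
    by (rule S_pow3[OF S_fj0 y]) simp_all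
  from 5(1)[OF u] have "(br (e j True) ^^ 3) x = 0"
    by (intro lower_inj[OF j S_alg[OF y] S_co_j[OF y, of False], of 3]) simp_all
  then show ?case by (intro raise_inj[OF j S_alg[OF x] S_co_j[OF x, of True], of 3]) simp_all
qed

lemma loop_j_S: "loop_at e f j p n x \<Longrightarrow> S i j (deg3 n n (n + p)) x"
proof -
  assume a: "loop_at e f j p n x"
  have "S i j ((\<lambda>(p, n). deg3 n n (n + p)) (p, n)) x"
    by (rule gen_at_map[OF a])
      (auto simp: loop_gens_def S_ej0 S_ej1 S_fj0 S_fj1 algebra_simps split: if_splits)
  then show ?thesis by simp
qed

lemma loop_i_S: "loop_at e f i p n x \<Longrightarrow> S i j (deg3 (n - p) n (n - p)) x"
proof -
  assume a: "loop_at e f i p n x"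
  have "S i j ((\<lambda>(p, n). deg3 (n - p) n (n - p)) (p, n)) x"
    by (rule gen_at_map[OF a])
      (auto simp: loop_gens_def S_ei0 S_ei1 S_fi0 S_fi1 algebra_simps split: if_splits)
  then show ?thesis by simp
qed

text \<open>A nonzero vector of \<open>loop_at\<close> spans the line of \<open>\<alpha>\<^sub>j + n a\<close> in the affine \<open>sl\<^sub>3\<close>. So that line does not
depend on the edge through \<open>j\<close>, and statements proved in different edges fit together.\<close>

lemma S_loop_j: assumes "S i j (deg3 n n (n + 1)) x" shows "loop_at e f j 1 n x"
proof -
  obtain v where v: "v \<noteq> 0" "loop_at e f j 1 n v" using loop_nonzero[OF j] by blast
  have "x \<in> span {v}"
    by (rule thin_span[OF thin_root, of v]) (use loop_j_S[OF v(2)] v(1) assms in simp_all)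
  then show ?thesis using v(2) by (auto simp: span_singleton intro: gen_at.scale)
qed

lemma thin_loop: "thin {x. loop_at e f j 1 n x}"
  using thin_root[of n] loop_j_S[of 1 n] unfolding thin_def by blast

lemma edge_plus_minus:
  assumes "loop_at e f i 1 n x" "loop_at e f j (- 1) m y" shows "br x y = 0"
proof -
  have "S i j (deg3 (n + m - 1) (n + m) (n + m - 2)) (br x y)"
    by (rule S_br[OF loop_i_S[OF assms(1)] loop_j_S[OF assms(2)]]) (simp add: algebra_simps)
  then show ?thesis by (rule difference_zero)
qed

text \<open>An imaginary element of the affine \<open>sl\<^sub>2\<close> of \<open>i\<close> acts on the root vectors of the neighbour \<open>j\<close> without
leaving the sum of their lines; this replaces the formula \<open>[h t\<^sup>n, e t\<^sup>m] = \<beta>(h) e t\<^sup>n\<^sup>+\<^sup>m\<close> of a loop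
algebra.\<close>

lemma edge_imaginary:
  assumes "loop_at e f i 1 n x" "loop_at e f i (- 1) m y" "loop_at e f j 1 k u"
  shows "loop_at e f j 1 (n + m + k) (br (br x y) u)"
proof (rule S_loop_j)
  show "S i j (deg3 (n + m + k) (n + m + k) (n + m + k + 1)) (br (br x y) u)"
    by (rule S_br[OF S_br[OF loop_i_S[OF assms(1)] loop_i_S[OF assms(2)] HOL.refl] loop_j_S[OF assms(3)]]) (simp add: algebra_simps)
qed

end

section \<open>Root spaces and invariant forms\<close>

lemma (in lie_alg) gen_at_commute:
  assumes "gen_at X d x" "gen_at X' d' y" "\<And>a u b v. (a, u) \<in> X \<Longrightarrow> (b, v) \<in> X' \<Longrightarrow> br u v = 0"
  shows "br x y = 0"
proof -
  have sub: "subspace {y. br u y = 0}" for u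
    using subspace_br_right[OF subspace_single_0, of u] by simp
  have 1: "y \<in> {y. br u y = 0}" if "(a, u) \<in> X" for a u
    by (rule gen_at_in[OF assms(2) _ sub]) (use assms(3)[OF that] in \<open>auto simp: jacobi[of u]\<close>)
  have "x \<in> {x. br x y = 0}"
  proof (rule gen_at_in[OF assms(1)])
    show "subspace {x. br x y = 0}" using subspace_br_left[OF subspace_single_0, of y] by simp
  qed (use 1 in \<open>auto simp: jacobi_left\<close>)
  then show ?thesis by simp
qed

context elliptic_gens
begin

text \<open>The simple pieces of the second decomposition: the sums of the root spaces of \<open>\<alpha>\<^sub>i + n a\<close>, and of their
negatives, over all integers \<open>n\<close>.\<close>

definition Vp :: "nat \<Rightarrow> 'v set" where "Vp i = span {x. \<exists>n. loop_at e f i 1 n x}"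
definition Vm :: "nat \<Rightarrow> 'v set" where "Vm i = span {x. \<exists>n. loop_at e f i (- 1) n x}"

definition imag_brackets :: "'v set" where
  "imag_brackets = {br x y | x y. \<exists>i\<le>l. \<exists>n m. loop_at e f i 1 n x \<and> loop_at e f i (- 1) m y}"

definition imag_part :: "'v set" where
  "imag_part = span (range H \<union> imag_brackets)"

lemma edge: "i \<le> l \<Longrightarrow> j \<le> l \<Longrightarrow> cartan_A l i j = -1 \<Longrightarrow> elliptic_edge scl br l H w z co e f i j"
  by unfold_locales

lemma far_commute:
  assumes "i \<le> l" "j \<le> l" "i \<noteq> j" "cartan_A l i j = 0" "loop_at e f i p n x" "loop_at e f j p' n' y"
  shows "br x y = 0"
proof (rule gen_at_commute[OF assms(5,6)])
  fix a u b v assume "(a, u) \<in> loop_gens e f i" "(b, v) \<in> loop_gens e f j"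
  moreover have "br (f i b) (e j b') = 0" for b b'
    using ef_other[OF assms(2,1), of b' b] assms(3) br_eq_0_sym by blast
  ultimately show "br u v = 0"
    using assms(1-4) by (auto simp: loop_gens_def ef_other ee_far ff_far)
qed

text \<open>For neighbours this is the vanishing of the root spaces of \<open>\<alpha>\<^sub>i - \<alpha>\<^sub>j + n a\<close>; otherwise the two affine
\<open>sl\<^sub>2\<close> commute.\<close>

lemma plus_minus:
  assumes "i \<le> l" "j \<le> l" "i \<noteq> j" "loop_at e f i 1 n x" "loop_at e f j (- 1) m y"
  shows "br x y = 0"
  using elliptic_edge.edge_plus_minus[OF edge[OF assms(1,2)] assms(4,5)]
    far_commute[OF assms(1-3) _ assms(4,5)] cartan_A_cases[OF assms(3), of l] by blast

lemma imaginary_plus: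
  assumes "i \<le> l" "j \<le> l" "loop_at e f i 1 n x" "loop_at e f i (- 1) m y" "loop_at e f j 1 k u"
  shows "\<exists>k. loop_at e f j 1 k (br (br x y) u)"
proof -
  consider "i = j" | "cartan_A l i j = -1" | "i \<noteq> j" "cartan_A l i j = 0" using cartan_A_cases by blast
  then show ?thesis
  proof cases
    case 1
    then show ?thesis using loop_at_br[OF loop_at_br[OF assms(3,4)], of 1 k u] assms(5) by auto
  next
    case 2
    then show ?thesis using elliptic_edge.edge_imaginary[OF edge[OF assms(1,2)] assms(3-5)] by blast
  next
    case 3
    then have "br x u = 0" "br y u = 0" using far_commute assms by blast+
    then show ?thesis by (auto simp: jacobi_left intro: gen_at.zero)
  qed
qed

lemma imaginary_minus:
  assumes "i \<le> l" "j \<le> l" "loop_at e f i 1 n x" "loop_at e f i (- 1) m y" "loop_at e f j (- 1) k u"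
  shows "\<exists>k. loop_at e f j (- 1) k (br (br x y) u)"
proof -
  interpret fl: elliptic_gens scl br l "\<lambda>s. - H s" w z co f e by (rule flip)
  have "\<exists>k. loop_at f e j 1 k (br (br y x) u)"
    by (rule fl.imaginary_plus[OF assms(1,2), of "- m" y "- n" x "- k" u])
      (simp_all add: loop_at_flip[of f e] assms)
  then obtain k where "loop_at e f j (- 1) (- k) (br (br y x) u)" by (auto simp: loop_at_flip[of f e])
  then show ?thesis using gen_at_uminus[of "loop_gens e f j" "(- 1, - k)"] br_skew[of x y]
    by (auto simp: br_minus_left)
qed

lemma loop_H: assumes "i \<le> l" "loop_at e f i p n x" shows "loop_at e f i p n (br (H s) x)"
  using loop_weight[OF assms(2,1)] gen_at.scale[OF assms(2)] by simp

lemma H_imag: assumes "y \<in> imag_part" shows "br (H s) y \<in> imag_part"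
  unfolding imag_part_def
proof (rule br_span_right[OF assms[unfolded imag_part_def] subspace_span])
  fix b assume "b \<in> range H \<union> imag_brackets"
  then show "br (H s) b \<in> span (range H \<union> imag_brackets)"
  proof
    assume "b \<in> imag_brackets"
    then obtain x y i n m where b: "b = br x y" "i \<le> l" "loop_at e f i 1 n x" "loop_at e f i (- 1) m y"
      by (auto simp: imag_brackets_def)
    have "br (br (H s) x) y \<in> imag_brackets" "br x (br (H s) y) \<in> imag_brackets"
      using b loop_H unfolding imag_brackets_def by blast+
    then show ?thesis unfolding b(1) jacobi[of "H s" x y] by (intro span_add span_base) auto
  qed (auto simp: HH span_zero)
qed

lemma loop_triangular: "triangular scl br {..l} Vp Vm (range H) imag_part"
proof unfold_locales
  fix k x y assume k: "k \<in> {..l}" and xy: "x \<in> Vp k" "y \<in> Vm k"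
  show "br x y \<in> imag_part" unfolding imag_part_def
  proof (rule br_span_span[OF xy[unfolded Vp_def Vm_def] subspace_span])
    fix a b assume "a \<in> {x. \<exists>n. loop_at e f k 1 n x}" "b \<in> {x. \<exists>n. loop_at e f k (- 1) n x}"
    then have "br a b \<in> imag_brackets" using k unfolding imag_brackets_def by auto
    then show "br a b \<in> span (range H \<union> imag_brackets)" by (simp add: span_base)
  qed
next
  fix k m x y assume km: "k \<in> {..l}" "m \<in> {..l}" "k \<noteq> m" and xy: "x \<in> Vp k" "y \<in> Vm m"
  have "br x y \<in> {0}"
    by (rule br_span_span[OF xy[unfolded Vp_def Vm_def] subspace_single_0]) (use plus_minus km in auto)
  then show "br x y = 0" by simp
next
  fix k x y assume k: "k \<in> {..l}" and xy: "x \<in> imag_part" "y \<in> Vp k"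
  show "br x y \<in> Vp k" unfolding Vp_def
  proof (rule br_span_span[OF xy[unfolded imag_part_def Vp_def] subspace_span])
    fix a b assume "a \<in> range H \<union> imag_brackets" "b \<in> {x. \<exists>n. loop_at e f k 1 n x}"
    moreover from this have "\<exists>n. loop_at e f k 1 n (br (H t) b)" for t using loop_H[of k] k by blast
    ultimately have "\<exists>n. loop_at e f k 1 n (br a b)"
      using imaginary_plus[of _ k] k unfolding imag_brackets_def by auto
    then show "br a b \<in> span {x. \<exists>n. loop_at e f k 1 n x}" by (simp add: span_base)
  qed
next
  fix k x y assume k: "k \<in> {..l}" and xy: "x \<in> imag_part" "y \<in> Vm k"
  show "br x y \<in> Vm k" unfolding Vm_def
  proof (rule br_span_span[OF xy[unfolded imag_part_def Vm_def] subspace_span])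
    fix a b assume "a \<in> range H \<union> imag_brackets" "b \<in> {x. \<exists>n. loop_at e f k (- 1) n x}"
    moreover from this have "\<exists>n. loop_at e f k (- 1) n (br (H t) b)" for t using loop_H[of k] k by blast
    ultimately have "\<exists>n. loop_at e f k (- 1) n (br a b)"
      using imaginary_minus[of _ k] k unfolding imag_brackets_def by auto
    then show "br a b \<in> span {x. \<exists>n. loop_at e f k (- 1) n x}" by (simp add: span_base)
  qed
qed (auto simp: Vp_def Vm_def imag_part_def intro: span_base H_imag[unfolded imag_part_def])

sublocale tri: triangular scl br "{..l}" Vp Vm "range H" imag_part
  by (rule loop_triangular)

abbreviation G :: "(nat \<Rightarrow> int) \<Rightarrow> 'v \<Rightarrow> bool" where
  "G \<equiv> gen_at (tri_gens {..l} Vp Vm (range H))"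

lemma tri_gens_cases:
  assumes "(d, x) \<in> tri_gens {..l} Vp Vm (range H)"
  obtains k where "k \<le> l" "d = unit_deg k" "x \<in> Vp k" | k where "k \<le> l" "d = - unit_deg k" "x \<in> Vm k"
    | t where "d = 0" "x = H t"
proof -
  from assms consider "(d, x) \<in> pos_gens {..l} Vp"
    | d' where "d = - d'" "(d', x) \<in> pos_gens {..l} Vm" | "d = 0" "x \<in> range H"
    unfolding tri_gens_def by (elim UnE) auto
  then show thesis by cases (use that in \<open>auto simp: pos_gens_def\<close>)
qed

text \<open>The degree is a function on all natural numbers, of which only the values up to \<open>l\<close> are seen by
weights.\<close>

lemma G_support: assumes "G d x" shows "x = 0 \<or> (\<forall>j>l. d j = 0)"
  using assms
proof induction
  case (base d x) then show ?case by (elim tri_gens_cases) (auto simp: unit_deg_def fun_ops)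
next
  case (brk d x d' y)
  have "\<forall>j>l. d j = 0" using brk.hyps(1) by (elim tri_gens_cases) (auto simp: unit_deg_def fun_ops)
  then show ?case using brk.IH by (auto simp: fun_ops)
qed auto

lemma weight_subspace: "subspace {x. br h x = scl c x}"
  by (auto simp: subspace_def br_add_right br_scl_right scale_right_distrib scale_left_commute)

lemma Vp_weight: assumes "i \<le> l" "z s = 0" "x \<in> Vp i" shows "br (H s) x = scl (w s i) x"
proof -
  have "{x. \<exists>n. loop_at e f i 1 n x} \<subseteq> {x. br (H s) x = scl (w s i) x}"
    using loop_weight[of i 1 _ _ s] assms(1,2) by auto
  from span_minimal[OF this weight_subspace] show ?thesis using assms(3) unfolding Vp_def by blast
qed

lemma Vm_weight: assumes "i \<le> l" "z s = 0" "x \<in> Vm i" shows "br (H s) x = scl (- w s i) x"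
proof -
  have "{x. \<exists>n. loop_at e f i (- 1) n x} \<subseteq> {x. br (H s) x = scl (- w s i) x}"
    using loop_weight[of i "- 1" _ _ s] assms(1,2) by auto
  from span_minimal[OF this weight_subspace] show ?thesis using assms(3) unfolding Vm_def by blast
qed

lemma G_weight: assumes "G d x" "z s = 0"
  shows "br (H s) x = scl (\<Sum>j\<le>l. of_int (d j) * w s j) x"
proof (rule gen_at_weight[OF assms(1), where \<chi> = "\<lambda>d. \<Sum>j\<le>l. of_int (d j) * w s j"])
  have u: "(\<Sum>j\<le>l. of_int (unit_deg k j) * w s j) = w s k" if "k \<le> l" for k
    using that by (simp add: unit_deg_def if_distrib[of of_int] if_distrib[of "\<lambda>c. c * _"] cong: if_cong)
  fix d x assume "(d, x) \<in> tri_gens {..l} Vp Vm (range H)"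
  then show "br (H s) x = scl (\<Sum>j\<le>l. of_int (d j) * w s j) x"
  proof (cases rule: tri_gens_cases)
    case (1 k) then show ?thesis using u Vp_weight[OF 1(1) assms(2)] by simp
  next
    case (2 k) then show ?thesis using u Vm_weight[OF 2(1) assms(2)] by (simp add: fun_ops sum_negf)
  next
    case (3 t) then show ?thesis by (simp add: HH fun_ops)
  qed
qed (simp add: fun_ops ring_distribs sum.distrib)

lemma alg_graded: assumes "x \<in> alg" shows "x \<in> span (\<Union>d. {x. G d x})"
proof (rule alg_least[OF assms _ subspace_span])
  have "G (unit_deg i) (e i b)" "G (- unit_deg i) (f i b)" if "i \<le> l" for i b
  proof -
    have "e i b \<in> Vp i" "f i b \<in> Vm i"
      unfolding Vp_def Vm_def using loop_at_gens[of e f i b] by (blast intro: span_base)+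
    then have "(unit_deg i, e i b) \<in> pos_gens {..l} Vp" "(unit_deg i, f i b) \<in> pos_gens {..l} Vm"
      using that by (auto simp: pos_gens_def)
    then show "G (unit_deg i) (e i b)" "G (- unit_deg i) (f i b)"
      by (auto intro!: gen_at.base simp: tri_gens_def image_iff)
  qed
  moreover have "G 0 (H s)" for s by (auto intro!: gen_at.base simp: tri_gens_def)
  ultimately show "gens \<subseteq> span (\<Union>d. {x. G d x})" unfolding gens_def by (blast intro: span_base)
  fix x y assume "x \<in> span (\<Union>d. {x. G d x})" "y \<in> span (\<Union>d. {x. G d x})"
  then show "br x y \<in> span (\<Union>d. {x. G d x})"
  proof (rule br_span_span[OF _ _ subspace_span])
    fix a b assume "a \<in> (\<Union>d. {x. G d x})" "b \<in> (\<Union>d. {x. G d x})"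
    then show "br a b \<in> span (\<Union>d. {x. G d x})" using gen_at_br by (blast intro: span_base)
  qed
qed

context
  fixes C :: "'v \<Rightarrow> 'v \<Rightarrow> complex"
  assumes C_add: "C x (y + y') = C x y + C x y'" "C (x + x') y = C x y + C x' y"
    and C_scl: "C x (scl c y) = c * C x y" "C (scl c x) y = c * C x y"
    and C_inv: "C (br x y) u = C x (br y u)"
    and C_H: "C (H s) (H t) = 0"
    and sep_z: "\<exists>s. z s \<noteq> 0"
    and sep_w: "\<And>d :: nat \<Rightarrow> int. \<exists>j\<le>l. d j \<noteq> 0 \<Longrightarrow> \<exists>s. z s = 0 \<and> (\<Sum>j\<le>l. of_int (d j) * w s j) \<noteq> 0"
begin

lemma C_zero: "C x 0 = 0"
  using C_scl(1)[of x 0 0] by simp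

lemma C_subspace: "subspace {y. C x y = 0}"
  by (auto simp: subspace_def C_add C_scl C_zero)

lemma C_weights:
  assumes "br (H s) x = scl a x" "br (H s) y = scl b y" "a + b \<noteq> 0" shows "C x y = 0"
proof -
  have "C (br x (H s)) y = C x (br (H s) y)" by (rule C_inv)
  moreover have "br x (H s) = scl (- a) x" using assms(1) by (simp add: br_skew[of x])
  ultimately have "- a * C x y = b * C x y" using assms(2) by (simp only: C_scl)
  then have "(a + b) * C x y = 0" by (simp add: algebra_simps eq_neg_iff_add_eq_0 neg_eq_iff_add_eq_0)
  then show ?thesis using assms(3) by simp
qed

lemma C_f_e: assumes "i \<le> l" shows "C (f i b) (e i b) = 0"
proof -
  have "C (br (H (co i b)) (f i b)) (e i b) = C (H (co i b)) (br (f i b) (e i b))" by (rule C_inv)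
  also have "br (f i b) (e i b) = scl (- 1) (H (co i b))" using ef[OF assms] by (simp add: br_skew[of "f i b"])
  also have "br (H (co i b)) (f i b) = scl (- 2) (f i b)"
    using Hf[OF assms, of "co i b" b] by (simp add: w_co z_co assms)
  finally show ?thesis by (simp only: C_scl C_H) simp
qed

text \<open>An element of degree different from \<open>unit_deg i\<close> has a weight that is not opposite to that of
\<open>f i b\<close>, even modulo \<open>a\<close>. The elements of degree \<open>unit_deg i\<close> are sums of vectors of weight
\<open>\<alpha>\<^sub>i + n a\<close>; of these only multiples of \<open>e i b\<close> have the opposite weight, and on them the form is
computed from its values on the Cartan subalgebra.\<close>

theorem form_vanishes_f:
  assumes i: "i \<le> l" and y: "y \<in> alg" shows "C (f i b) y = 0"
proof -
  have loop: "C (f i b) x = 0" if x: "loop_at e f i 1 n x" for n x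
  proof (cases "n = of_bool b")
    case True
    obtain j where j: "j \<le> l" "cartan_A l j i = -1"
      using cartan_A_neighbour[OF l2 i] cartan_A_sym by metis
    have "x \<in> span {e i b}"
      by (rule thin_span[OF elliptic_edge.thin_loop[OF edge[OF j(1) i j(2)], of n]])
        (use loop_at_gens(1)[of e f i b] x True e_nz[OF i] in auto)
    then show ?thesis using C_f_e[OF i] by (auto simp: span_singleton C_scl)
  next
    case False
    obtain s where "z s \<noteq> 0" using sep_z by blast
    moreover have "(of_int n :: complex) \<noteq> of_int (of_bool b)" using False by (simp only: of_int_eq_iff) simp
    ultimately have "- (w s i + of_bool b * z s) + (of_int 1 * w s i + of_int n * z s) \<noteq> 0"
      by (simp add: left_diff_distrib[symmetric] del: of_bool_eq_iff)
    then show ?thesis by (rule C_weights[OF Hf[OF i] loop_weight[OF x i]])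
  qed
  have "C (f i b) x = 0" if G: "G d x" for d x
  proof (cases "\<exists>j\<le>l. (d - unit_deg i) j \<noteq> 0")
    case True
    then obtain s where s: "z s = 0" "(\<Sum>j\<le>l. of_int ((d - unit_deg i) j) * w s j) \<noteq> 0" using sep_w by blast
    have "(\<Sum>j\<le>l. of_int (unit_deg i j) * w s j) = w s i"
      using i by (simp add: unit_deg_def if_distrib[of of_int] if_distrib[of "\<lambda>c. c * _"] cong: if_cong)
    then have "- (w s i + of_bool b * z s) + (\<Sum>j\<le>l. of_int (d j) * w s j) \<noteq> 0"
      using s by (simp add: fun_ops left_diff_distrib sum_subtractf)
    then show ?thesis by (rule C_weights[OF Hf[OF i] G_weight[OF G s(1)]])
  next
    case False
    show ?thesis
    proof (cases "x = 0")
      case False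
      then have "\<forall>j>l. d j = 0" using G_support[OF G] by blast
      then have "d = unit_deg i"
        using \<open>\<not> (\<exists>j\<le>l. (d - unit_deg i) j \<noteq> 0)\<close> i
        by (auto simp: fun_eq_iff fun_ops) (metis linorder_not_le unit_deg_def)
      then have "x \<in> Vp i" using tri.unit_degree G i by blast
      then show ?thesis unfolding Vp_def
        using span_minimal[OF _ C_subspace, of "{x. \<exists>n. loop_at e f i 1 n x}" "f i b"] loop by blast
    qed (simp add: C_zero)
  qed
  then show ?thesis using alg_graded[OF y] span_minimal[OF _ C_subspace, of "\<Union>d. {x. G d x}" "f i b"] by blast
qed

end

theorem form_vanishes_e:
  fixes C :: "'v \<Rightarrow> 'v \<Rightarrow> complex"
  assumes C_add: "\<And>x y y'. C x (y + y') = C x y + C x y'" "\<And>x x' y. C (x + x') y = C x y + C x' y"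
    and C_scl: "\<And>c x y. C x (scl c y) = c * C x y" "\<And>c x y. C (scl c x) y = c * C x y"
    and C_inv: "\<And>x y u. C (br x y) u = C x (br y u)"
    and C_H: "\<And>s t. C (H s) (H t) = 0"
    and sep_z: "\<exists>s. z s \<noteq> 0"
    and sep_w: "\<And>d :: nat \<Rightarrow> int. \<exists>j\<le>l. d j \<noteq> 0 \<Longrightarrow> \<exists>s. z s = 0 \<and> (\<Sum>j\<le>l. of_int (d j) * w s j) \<noteq> 0"
    and i: "i \<le> l" and y: "y \<in> alg"
  shows "C (e i b) y = 0"
proof -
  interpret fl: elliptic_gens scl br l "\<lambda>s. - H s" w z co f e by (rule flip)
  have CH: "C (- H s) (- H t) = 0" for s t
    using C_scl(1)[of "- H s" "-1" "H t"] C_scl(2)[of "-1" "H s" "H t"] C_H[of s t] by simp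
  show ?thesis
    by (rule fl.form_vanishes_f[OF C_add C_scl C_inv CH sep_z sep_w i]) (use y flip_alg in auto)
qed

end

section \<open>From carrier sets to types\<close>

definition psc :: "complex \<Rightarrow> ('b \<Rightarrow>\<^sub>0 complex) \<Rightarrow> ('b \<Rightarrow>\<^sub>0 complex)" where
  "psc c f = Poly_Mapping.map ((*) c) f"

lemma lookup_psc [simp]: "Poly_Mapping.lookup (psc c f) x = c * Poly_Mapping.lookup f x"
  by (simp add: psc_def map.rep_eq when_def)

interpretation psc: vector_space psc
  by unfold_locales (auto intro!: poly_mapping_eqI simp: lookup_add algebra_simps)

interpretation psc2: vector_space_pair psc psc
  by unfold_locales

context lie_superalgebra
begin

lemma complex_ring_simps [simp]: "carrier complex_ring = UNIV" "c \<oplus>\<^bsub>complex_ring\<^esub> d = c + d"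
  "c \<otimes>\<^bsub>complex_ring\<^esub> d = c * d" "\<zero>\<^bsub>complex_ring\<^esub> = 0" "\<one>\<^bsub>complex_ring\<^esub> = 1"
  by (simp_all add: complex_ring_def)

lemma smult_mem [simp]: "x \<in> carrier L \<Longrightarrow> c \<odot> x \<in> carrier L"
  using smult_closed[of c x] by simp

lemma smult_0_left [simp]: "x \<in> carrier L \<Longrightarrow> 0 \<odot> x = \<zero>"
  using smult_l_null[of x] by simp

lemma smult_1 [simp]: "x \<in> carrier L \<Longrightarrow> 1 \<odot> x = x"
  using smult_one[of x] by simp

lemma smult_smult: "x \<in> carrier L \<Longrightarrow> c \<odot> (d \<odot> x) = (c * d) \<odot> x"
  using smult_assoc1[of c d x] by simp

lemma smult_add_left: "x \<in> carrier L \<Longrightarrow> (c + d) \<odot> x = c \<odot> x \<oplus> d \<odot> x"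
  using smult_l_distr[of c d x] by simp

lemma smult_add_right: "x \<in> carrier L \<Longrightarrow> y \<in> carrier L \<Longrightarrow> c \<odot> (x \<oplus> y) = c \<odot> x \<oplus> c \<odot> y"
  using smult_r_distr[of c x y] by simp

lemma smult_zero [simp]: "c \<odot> \<zero> = \<zero>"
  using smult_r_null[of c] by simp

lemma smult_eq_zero: "x \<in> carrier L \<Longrightarrow> c \<odot> x = \<zero> \<Longrightarrow> c = 0 \<or> x = \<zero>"
proof -
  assume x: "x \<in> carrier L" and c: "c \<odot> x = \<zero>"
  show ?thesis
  proof (cases "c = 0")
    case False
    have "x = (1 / c) \<odot> (c \<odot> x)" using False smult_smult[OF x] x by simp
    then show ?thesis unfolding c by simp
  qed simp
qed

lemma add_smult_minus: "x \<in> carrier L \<Longrightarrow> x \<oplus> (- 1) \<odot> x = \<zero>"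
  using smult_add_left[of x 1 "- 1"] by simp

lemma smult_left_cancel: "x \<in> carrier L \<Longrightarrow> c \<odot> x = d \<odot> x \<Longrightarrow> c = d \<or> x = \<zero>"
proof -
  assume x: "x \<in> carrier L" and c: "c \<odot> x = d \<odot> x"
  have "(c + (- 1) * d) \<odot> x = d \<odot> x \<oplus> (- 1) \<odot> (d \<odot> x)"
    using x c by (simp only: smult_add_left smult_smult)
  then have "(c + (- 1) * d) \<odot> x = \<zero>" using add_smult_minus[of "d \<odot> x"] x by simp
  then show ?thesis using smult_eq_zero[OF x] by fastforce
qed

lemma eq_minus_zero: assumes "x \<in> carrier L" "x = (- 1) \<odot> x" shows "x = \<zero>"
  using smult_left_cancel[OF assms(1) HOL.trans[OF smult_1[OF assms(1)] assms(2)]] by simp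

lemma hpart_carrier: "x \<in> hpart L p \<Longrightarrow> x \<in> carrier L"
  using submoduleE(1)[OF hpart_submodule] by blast

lemma hpart_zero: "\<zero> \<in> hpart L p"
proof -
  obtain x where "x \<in> hpart L p" using submoduleE(2)[OF hpart_submodule] by blast
  then show ?thesis using submoduleE(4)[OF hpart_submodule, of 0 x p] hpart_carrier[of x p] by simp
qed

lemma parity_cases:
  assumes "x \<in> carrier L"
  obtains y z where "y \<in> hpart L False" "z \<in> hpart L True" "x = y \<oplus> z"
  using ex1_implies_ex[OF hpart_decomp[OF assms]] that by auto

lemma parity_unique:
  assumes "y \<in> hpart L False" "z \<in> hpart L True" "y' \<in> hpart L False" "z' \<in> hpart L True" "y \<oplus> z = y' \<oplus> z'"
  shows "y = y' \<and> z = z'"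
proof -
  have "y \<oplus> z \<in> carrier L" using assms hpart_carrier by blast
  from hpart_decomp[OF this] have "(y, z) = (y', z')"
    by (rule ex1E) (use assms in \<open>auto dest: spec[of _ "(y, z)"] spec[of _ "(y', z')"]\<close>)
  then show ?thesis by simp
qed

lemma bracket_mem [simp]: "x \<in> carrier L \<Longrightarrow> y \<in> carrier L \<Longrightarrow> bracket L x y \<in> carrier L"
  by (rule bracket_closed)

lemma bracket_zero [simp]: "x \<in> carrier L \<Longrightarrow> bracket L x \<zero> = \<zero>" "x \<in> carrier L \<Longrightarrow> bracket L \<zero> x = \<zero>"
  using bracket_smult_right[of x \<zero> 0] bracket_smult_left[of \<zero> x 0] by simp_all

lemma bracket_even_skew:
  assumes "u \<in> hpart L False" "x \<in> carrier L" shows "bracket L x u = (- 1) \<odot> bracket L u x"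
proof -
  obtain y z where yz: "y \<in> hpart L False" "z \<in> hpart L True" "x = y \<oplus> z" by (rule parity_cases[OF assms(2)])
  note c = hpart_carrier[OF yz(1)] hpart_carrier[OF yz(2)] hpart_carrier[OF assms(1)]
  have "bracket L x u = bracket L y u \<oplus> bracket L z u" unfolding yz(3) by (rule bracket_add_left) (rule c)+
  also have "bracket L y u = (- 1) \<odot> bracket L u y"
    using bracket_skew[OF yz(1) assms(1)] by (simp only: koszul_sign_def simp_thms if_False)
  also have "bracket L z u = (- 1) \<odot> bracket L u z"
    using bracket_skew[OF yz(2) assms(1)] by (simp only: koszul_sign_def simp_thms if_False)
  also have "(- 1) \<odot> bracket L u y \<oplus> (- 1) \<odot> bracket L u z = (- 1) \<odot> bracket L u x"
    unfolding yz(3) using c by (simp only: bracket_add_right smult_add_right bracket_mem)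
  finally show ?thesis .
qed

lemma bracket_even_derivation:
  assumes "u \<in> hpart L False" "x \<in> carrier L" "v \<in> carrier L"
  shows "bracket L u (bracket L x v) = bracket L (bracket L u x) v \<oplus> bracket L x (bracket L u v)"
proof -
  obtain y z where yz: "y \<in> hpart L False" "z \<in> hpart L True" "x = y \<oplus> z" by (rule parity_cases[OF assms(2)])
  note c = hpart_carrier[OF yz(1)] hpart_carrier[OF yz(2)] hpart_carrier[OF assms(1)] assms(3)
  have 1: "bracket L u (bracket L y v) = bracket L (bracket L u y) v \<oplus> bracket L y (bracket L u v)"
    using bracket_jacobi[OF assms(1) yz(1) assms(3)] c by (simp only: koszul_sign_def simp_thms if_False smult_1 bracket_mem)
  have 2: "bracket L u (bracket L z v) = bracket L (bracket L u z) v \<oplus> bracket L z (bracket L u v)"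
    using bracket_jacobi[OF assms(1) yz(2) assms(3)] c by (simp only: koszul_sign_def simp_thms if_False smult_1 bracket_mem)
  have "bracket L u (bracket L x v) = bracket L u (bracket L y v) \<oplus> bracket L u (bracket L z v)"
    unfolding yz(3) using c by (simp only: bracket_add_left bracket_add_right bracket_mem)
  also have "\<dots> = (bracket L (bracket L u y) v \<oplus> bracket L (bracket L u z) v) \<oplus> (bracket L y (bracket L u v) \<oplus> bracket L z (bracket L u v))"
    unfolding 1 2 using c by (simp add: M.a_ac)
  also have "\<dots> = bracket L (bracket L u x) v \<oplus> bracket L x (bracket L u v)"
    unfolding yz(3) using c by (simp only: bracket_add_left bracket_add_right bracket_mem)
  finally show ?thesis .
qed

lemma bracket_finsum:
  assumes "finite A" "x \<in> carrier L" "f \<in> A \<rightarrow> carrier L"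
  shows "bracket L x (finsum L f A) = finsum L (\<lambda>i. bracket L x (f i)) A"
  using assms(1,3)
proof (induction A rule: finite_induct)
  case empty then show ?case using assms(2) by simp
next
  case (insert i A)
  have f: "f \<in> A \<rightarrow> carrier L" "f i \<in> carrier L" using insert.prems by auto
  have g: "(\<lambda>i. bracket L x (f i)) \<in> A \<rightarrow> carrier L" "bracket L x (f i) \<in> carrier L" using f assms(2) by (auto simp: Pi_def)
  show ?case
    by (simp only: M.finsum_insert[OF insert.hyps f] M.finsum_insert[OF insert.hyps g] insert.IH[OF f(1)]
        bracket_add_right[OF assms(2) f(2) M.finsum_closed[OF f(1)]])
qed

end

locale even_lie = lie_superalgebra L for L :: "('b, 'm) lsalg_scheme" (structure) +
  assumes odd_part: "hpart L True = {\<zero>}"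
begin

lemma even_part: "x \<in> carrier L \<Longrightarrow> x \<in> hpart L False"
proof -
  assume x: "x \<in> carrier L"
  obtain y z where yz: "y \<in> hpart L False" "z \<in> hpart L True" "x = y \<oplus> z"
    using ex1_implies_ex[OF hpart_decomp[OF x]] by auto
  have "y \<in> carrier L" using submoduleE(1)[OF hpart_submodule] yz(1) by blast
  moreover have "z = \<zero>" using yz(2) odd_part by simp
  ultimately have "x = y" using yz(3) M.r_zero by simp
  then show ?thesis using yz(1) by simp
qed

lemma skew: "x \<in> carrier L \<Longrightarrow> y \<in> carrier L \<Longrightarrow> bracket L x y = (- 1) \<odot> bracket L y x"
  using bracket_even_skew[OF even_part] by blast

lemma jacobi_even: "x \<in> carrier L \<Longrightarrow> y \<in> carrier L \<Longrightarrow> z \<in> carrier L \<Longrightarrow>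
    bracket L x (bracket L y z) = bracket L (bracket L x y) z \<oplus> bracket L y (bracket L x z)"
  using bracket_even_derivation[OF even_part] by blast

text \<open>Elements outside the carrier are sent to \<open>\<zero>\<close>, so that \<open>toL\<close> is linear on the free vector space over
the whole type.\<close>

definition proj :: "'b \<Rightarrow> 'b" where "proj x = (if x \<in> carrier L then x else \<zero>)"

definition toL :: "('b \<Rightarrow>\<^sub>0 complex) \<Rightarrow> 'b" where
  "toL u = (\<Oplus>x\<in>Poly_Mapping.keys u. Poly_Mapping.lookup u x \<odot> proj x)"

lemma proj_closed [simp]: "proj x \<in> carrier L" by (simp add: proj_def)

lemma toL_closed [simp]: "toL u \<in> carrier L"
  unfolding toL_def by (rule M.finsum_closed) auto

lemma toL_superset:
  assumes "finite A" "Poly_Mapping.keys u \<subseteq> A"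
  shows "toL u = (\<Oplus>x\<in>A. Poly_Mapping.lookup u x \<odot> proj x)"
  unfolding toL_def
  by (rule M.add.finprod_mono_neutral_cong_left) (use assms in \<open>auto simp: in_keys_iff\<close>)

lemma toL_add: "toL (u + v) = toL u \<oplus> toL v"
proof -
  let ?A = "Poly_Mapping.keys u \<union> Poly_Mapping.keys v"
  have "toL (u + v) = (\<Oplus>x\<in>?A. (Poly_Mapping.lookup u x + Poly_Mapping.lookup v x) \<odot> proj x)"
    using toL_superset[of ?A "u + v"] Poly_Mapping.keys_add[of u v] by (simp add: lookup_add)
  also have "\<dots> = (\<Oplus>x\<in>?A. Poly_Mapping.lookup u x \<odot> proj x \<oplus> Poly_Mapping.lookup v x \<odot> proj x)"
    by (rule M.finsum_cong') (auto simp: smult_l_distr[simplified])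
  also have "\<dots> = toL u \<oplus> toL v"
    by (subst M.finsum_addf) (auto simp: toL_superset[of ?A])
  finally show ?thesis .
qed

lemma toL_psc: "toL (psc c u) = c \<odot> toL u"
proof -
  have "toL (psc c u) = (\<Oplus>x\<in>Poly_Mapping.keys u. (c * Poly_Mapping.lookup u x) \<odot> proj x)"
    by (subst toL_superset[of "Poly_Mapping.keys u"]) (auto simp: in_keys_iff)
  also have "\<dots> = (\<Oplus>x\<in>Poly_Mapping.keys u. c \<odot> (Poly_Mapping.lookup u x \<odot> proj x))"
    by (rule M.finsum_cong') (auto simp: smult_assoc1[simplified])
  also have "\<dots> = c \<odot> toL u"
    unfolding toL_def by (rule finsum_smult_ldistr[symmetric]) auto
  finally show ?thesis .
qed

lemma toL_zero: "toL 0 = \<zero>"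
  by (simp add: toL_def)

lemma toL_single: "x \<in> carrier L \<Longrightarrow> toL (Poly_Mapping.single x 1) = x"
  by (simp add: toL_def proj_def M.finsum_insert[of "{}"] smult_one[simplified])

lemma toL_minus: "toL (u - v) = toL u \<ominus> toL v"
proof -
  have "toL u = toL (u - v) \<oplus> toL v" using toL_add[of "u - v" v] by simp
  then show ?thesis by (simp add: M.minus_eq M.a_assoc M.r_neg)
qed

text \<open>A linear map that is zero on a basis of the kernel of \<open>toL\<close> and the identity on the rest of a basis
changes no value of \<open>toL\<close>, and afterwards elements with equal values coincide. Hence it turns the map
of an element to its basis vector into a linear one.\<close>

lemma toL_section: "\<exists>emb. (\<forall>x\<in>carrier L. toL (emb x) = x) \<and>
  (\<forall>x\<in>carrier L. \<forall>y\<in>carrier L. emb (x \<oplus> y) = emb x + emb y) \<and>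
  (\<forall>c. \<forall>x\<in>carrier L. emb (c \<odot> x) = psc c (emb x))"
proof -
  let ?K = "{u. toL u = \<zero>}"
  obtain B where B: "B \<subseteq> ?K" "psc.independent B" "?K \<subseteq> psc.span B"
    by (rule psc.maximal_independent_subset[of ?K])
  obtain B' where B': "B \<subseteq> B'" "psc.independent B'" "UNIV \<subseteq> psc.span B'"
    by (rule psc.maximal_independent_subset_extend[OF subset_UNIV B(2)])
  obtain g where g: "Vector_Spaces.linear psc psc g" "\<forall>x\<in>B'. g x = (if x \<in> B then 0 else x)"
    using psc2.linear_independent_extend[OF B'(2), of "\<lambda>x. if x \<in> B then 0 else x"] by (elim exE conjE)
  interpret g: Vector_Spaces.linear psc psc g by (rule g(1))
  have tg: "toL (g u) = toL u" for u
  proof -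
    have 1: "psc.subspace {u. toL (g u) = toL u}"
      by (auto simp: psc.subspace_def g.zero g.add g.scale toL_add toL_psc)
    have 2: "B' \<subseteq> {u. toL (g u) = toL u}"
    proof
      fix u assume "u \<in> B'"
      then have "g u = (if u \<in> B then 0 else u)" using g(2) by blast
      moreover have "toL u = \<zero>" if "u \<in> B" using B(1) that by blast
      ultimately show "u \<in> {u. toL (g u) = toL u}" by (simp add: toL_zero)
    qed
    have "u \<in> psc.span B'" using B'(3) by blast
    then have "u \<in> {u. toL (g u) = toL u}" using psc.span_minimal[OF 2 1] by (rule subsetD[rotated])
    then show ?thesis by simp
  qed
  have gK: "g u = 0" if "toL u = \<zero>" for u
  proof -
    have 1: "psc.subspace {u. g u = 0}"
      by (auto simp: psc.subspace_def g.zero g.add g.scale)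
    have 2: "B \<subseteq> {u. g u = 0}"
    proof
      fix u assume "u \<in> B"
      then have "g u = (if u \<in> B then 0 else u)" using g(2) B'(1) by blast
      then show "u \<in> {u. g u = 0}" using \<open>u \<in> B\<close> by simp
    qed
    have "u \<in> psc.span B" using B(3) that by blast
    then have "u \<in> {u. g u = 0}" using psc.span_minimal[OF 2 1] by (rule subsetD[rotated])
    then show ?thesis by simp
  qed
  have geq: "g u = g v" if "toL u = toL v" for u v
    using gK[of "u - v"] that by (simp add: toL_minus g.diff M.minus_eq M.r_neg)
  define emb where "emb x = g (Poly_Mapping.single x 1)" for x
  have "emb (x \<oplus> y) = emb x + emb y" if "x \<in> carrier L" "y \<in> carrier L" for x y
    unfolding emb_def g.add[symmetric] by (rule geq) (use that in \<open>simp add: toL_add toL_single\<close>)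
  moreover have "emb (c \<odot> x) = psc c (emb x)" if "x \<in> carrier L" for c x
    unfolding emb_def g.scale[symmetric] by (rule geq) (use that in \<open>simp add: toL_psc toL_single\<close>)
  moreover have "toL (emb x) = x" if "x \<in> carrier L" for x
    using that by (simp add: emb_def tg toL_single)
  ultimately show ?thesis by (intro exI[of _ emb]) blast
qed

end

text \<open>The bracket is transported along the linear section \<open>emb\<close> of \<open>toL\<close>. The result is a Lie algebra on
the whole type, isomorphic to the direct sum of \<open>L\<close> and an abelian algebra, the kernel of \<open>toL\<close>.\<close>

locale even_lie_model = even_lie L for L :: "('b, 'm) lsalg_scheme" (structure) +
  fixes emb :: "'b \<Rightarrow> 'b \<Rightarrow>\<^sub>0 complex"
  assumes toL_emb [simp]: "x \<in> carrier L \<Longrightarrow> toL (emb x) = x"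
    and emb_add: "x \<in> carrier L \<Longrightarrow> y \<in> carrier L \<Longrightarrow> emb (x \<oplus> y) = emb x + emb y"
    and emb_smult: "x \<in> carrier L \<Longrightarrow> emb (c \<odot> x) = psc c (emb x)"
begin

definition brF :: "('b \<Rightarrow>\<^sub>0 complex) \<Rightarrow> ('b \<Rightarrow>\<^sub>0 complex) \<Rightarrow> ('b \<Rightarrow>\<^sub>0 complex)" where
  "brF u v = emb (bracket L (toL u) (toL v))"

lemma emb_zero: "emb \<zero> = 0"
  using emb_smult[of \<zero> 0] by simp

lemma bracket_self: assumes x: "x \<in> carrier L" shows "bracket L x x = \<zero>"
proof -
  have "emb (bracket L x x) = psc (- 1) (emb (bracket L x x))"
    using arg_cong[OF skew[OF x x], of emb] emb_smult[of "bracket L x x" "- 1"] bracket_closed[OF x x]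
    by (simp only:)
  then have "psc 2 (emb (bracket L x x)) = 0"
    by (simp add: psc.scale_minus_left eq_neg_iff_add_eq_0 psc.scale_left_distrib[of 1 1, simplified])
  then have "emb (bracket L x x) = 0" by simp
  then show ?thesis using toL_emb[of "bracket L x x"] x by (simp add: toL_zero)
qed

lemma toL_brF: "toL (brF u v) = bracket L (toL u) (toL v)"
  by (simp add: brF_def)

sublocale F: lie_alg psc brF
proof
  fix x y u :: "'b \<Rightarrow>\<^sub>0 complex" and c
  show "brF (x + y) u = brF x u + brF y u"
    by (simp add: brF_def toL_add bracket_add_left emb_add)
  show "brF x (y + u) = brF x y + brF x u"
    by (simp add: brF_def toL_add bracket_add_right emb_add)
  show "brF (psc c x) y = psc c (brF x y)"
    by (simp add: brF_def toL_psc bracket_smult_left emb_smult)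
  show "brF x (psc c y) = psc c (brF x y)"
    by (simp add: brF_def toL_psc bracket_smult_right emb_smult)
  show "brF x x = 0"
    by (simp add: brF_def bracket_self emb_zero)
  show "brF x (brF y u) = brF (brF x y) u + brF y (brF x u)"
    by (simp add: brF_def jacobi_even[of "toL x" "toL y" "toL u"] emb_add)
qed

lemma brF_emb: "x \<in> carrier L \<Longrightarrow> y \<in> carrier L \<Longrightarrow> brF (emb x) (emb y) = emb (bracket L x y)"
  by (simp add: brF_def)

lemma emb_inj: "x \<in> carrier L \<Longrightarrow> y \<in> carrier L \<Longrightarrow> emb x = emb y \<longleftrightarrow> x = y"
  by (metis toL_emb)

end

lemma (in even_lie) model_exists: "\<exists>emb. even_lie_model L emb"
proof -
  obtain emb where "(\<forall>x\<in>carrier L. toL (emb x) = x) \<and>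
    (\<forall>x\<in>carrier L. \<forall>y\<in>carrier L. emb (x \<oplus> y) = emb x + emb y) \<and>
    (\<forall>c. \<forall>x\<in>carrier L. emb (c \<odot> x) = psc c (emb x))"
    using toL_section by (elim exE)
  then have "even_lie_model L emb" by unfold_locales auto
  then show ?thesis by (rule exI[of _ emb])
qed

section \<open>Roots of the base system\<close>

lemma cartan_A_column_sum:
  assumes "2 \<le> l" "j \<le> l" shows "(\<Sum>i\<le>l. cartan_A l i j) = 0"
proof -
  define p where "p = (if j = l then 0 else j + 1)"
  define m where "m = (if j = 0 then l else j - 1)"
  have pm: "p \<le> l" "m \<le> l" "p \<noteq> j" "m \<noteq> j" "p \<noteq> m" using assms by (auto simp: p_def m_def)
  have p: "Suc j mod Suc l = p" using assms by (auto simp: p_def)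
  have m: "j = Suc i mod Suc l \<longleftrightarrow> i = m" if "i \<le> l" for i
    using assms that by (cases "i = l") (auto simp: m_def)
  have "cartan_A l i j = (if i = j then 2 else 0) + (if i = p then -1 else 0) + (if i = m then - 1 else 0)"
    if "i \<le> l" for i
    unfolding cartan_A_def Suc_eq_plus1[symmetric] p m[OF that] using pm by auto
  then have "(\<Sum>i\<le>l. cartan_A l i j) = (\<Sum>i\<le>l. (if i = j then 2 else 0) + (if i = p then -1 else 0) + (if i = m then - 1 else 0))"
    by (intro sum.cong) auto
  also have "\<dots> = 0" using assms pm by (simp add: sum.distrib)
  finally show ?thesis .
qed

context A11_base_system
begin

abbreviation l :: nat where "l \<equiv> rank D"
abbreviation r :: "nat \<Rightarrow> 'e" where "r \<equiv> simple_root D"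
abbreviation a :: 'e where "a \<equiv> null_a D"
abbreviation J :: "'e \<Rightarrow> 'e \<Rightarrow> complex" where "J \<equiv> form D"

lemma form_add_right: "J x (y + z) = J x y + J x z"
  using form_add[of y z x] by (simp add: form_sym)

lemma form_scl_right: "J x (scl D c y) = c * J x y"
  using form_scl[of c y x] by (simp add: form_sym)

lemma form_zero [simp]: "J 0 x = 0" "J x 0 = 0"
  using form_scl[of 0 0 x] form_scl_right[of x 0 0] by simp_all

lemma form_minus [simp]: "J (- x) y = - J x y" "J x (- y) = - J x y"
  using form_scl[of "-1" x y] form_scl_right[of x "-1" y] by simp_all

lemma form_diff: "J (x - y) z = J x z - J y z" "J x (y - z) = J x y - J x z"
  using form_add[of x "- y" z] form_add_right[of x y "- z"] by simp_all

lemma form_sum: "J (sum g A) x = (\<Sum>i\<in>A. J (g i) x)" "J x (sum g A) = (\<Sum>i\<in>A. J x (g i))"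
  by (induction A rule: infinite_finite_induct) (simp_all add: form_add form_add_right)

lemma form_separates: "(\<And>s. J s x = J s y) \<Longrightarrow> x = y"
  using form_nondegenerate[of "x - y"] by (simp add: form_diff form_sym[of x] form_sym[of y])

text \<open>The form is normalised only by the Cartan matrix, so the squared length of the simple roots is an
arbitrary nonzero number; it is the same for all of them because neighbours have equal length.\<close>

definition N :: complex where "N = J (r 0) (r 0)"

lemma form_coroot: "J (coroot D x) y = 2 / J x x * J x y"
  by (simp add: coroot_def form_scl)

lemma form_simple_aux:
  assumes "i \<le> l" "j \<le> l" shows "2 * J (r i) (r j) = of_int (cartan_A l i j) * J (r i) (r i)"
  using cartan_matrix[OF assms] simple_root_nonisotropic[OF assms(1)]
  by (simp add: form_coroot field_simps)

lemma form_simple_same: "i \<le> l \<Longrightarrow> J (r i) (r i) = N"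
proof (induction i)
  case 0 then show ?case by (simp add: N_def)
next
  case (Suc i)
  have "cartan_A l i (Suc i) = -1" "cartan_A l (Suc i) i = -1"
    using Suc.prems by (auto simp: cartan_A_def)
  then have "2 * J (r i) (r (Suc i)) = - J (r i) (r i)" "2 * J (r (Suc i)) (r i) = - J (r (Suc i)) (r (Suc i))"
    using form_simple_aux[of i "Suc i"] form_simple_aux[of "Suc i" i] Suc.prems by auto
  then show ?case using Suc form_sym[of "r i" "r (Suc i)"] by simp
qed

lemma N_nz: "N \<noteq> 0"
  using simple_root_nonisotropic[of 0] by (simp add: N_def)

lemma form_simple: "i \<le> l \<Longrightarrow> j \<le> l \<Longrightarrow> J (r i) (r j) = N / 2 * of_int (cartan_A l i j)"
  using form_simple_aux[of i j] form_simple_same[of i] by (simp add: field_simps)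

lemma form_simple_a: "i \<le> l \<Longrightarrow> J (r i) a = 0"
  using form_a_simple[of i] form_sym[of a "r i"] by simp

lemma form_Lambda_delta_a: "J (Lambda_delta D) a = 0"
  using form_a_Lambda_delta form_sym[of a "Lambda_delta D"] by simp

definition root :: "nat \<Rightarrow> bool \<Rightarrow> 'e" where
  "root i b = r i + (if b then a else 0)"

lemma form_root_a [simp]: "i \<le> l \<Longrightarrow> J (root i b) a = 0" "i \<le> l \<Longrightarrow> J a (root i b) = 0"
  by (simp_all add: root_def form_add form_add_right form_a_simple form_a_a form_simple_a)

lemma form_root: "i \<le> l \<Longrightarrow> j \<le> l \<Longrightarrow> J (root i b) (root j b') = N / 2 * of_int (cartan_A l i j)"
  by (simp add: root_def form_add form_add_right form_a_simple form_a_a form_simple_a form_simple)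

lemma form_root_same: "i \<le> l \<Longrightarrow> J (root i b) (root i b') = N"
  by (simp add: form_root)

lemma root_Lambda_a: "i \<le> l \<Longrightarrow> J (Lambda_a D) (root i b) = of_bool b"
  by (simp add: root_def form_add_right form_Lambda_a_simple form_Lambda_a_a)

lemma coroot_root: "i \<le> l \<Longrightarrow> coroot D (root i b) = scl D (2 / N) (root i b)"
  by (simp add: coroot_def form_root_same)

lemma coroot_minus: "coroot D (- x) = - coroot D x"
  by (simp add: coroot_def)

lemma form_coroot_root: "i \<le> l \<Longrightarrow> j \<le> l \<Longrightarrow> J (coroot D (root i b)) (root j b') = of_int (cartan_A l i j)"
  using N_nz by (simp add: form_coroot form_root)

lemma root_inj: assumes "i \<le> l" "j \<le> l" "root i b = root j b'" shows "i = j \<and> b = b'"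
proof -
  have "of_int (cartan_A l i j) = (2 :: complex)"
    using form_root[OF assms(1,2), of b b'] form_root_same[OF assms(1), of b b] assms(3) N_nz by simp
  then have "i = j" using cartan_A_cases[of i j l] by fastforce
  moreover have "b = b'" using root_Lambda_a[OF assms(1), of b] root_Lambda_a[OF assms(2), of b'] assms(3)
    by (cases b; cases b') auto
  ultimately show ?thesis ..
qed

lemma root_neq_minus: assumes "i \<le> l" "j \<le> l" shows "root i b \<noteq> - root j b'"
proof
  assume e: "root i b = - root j b'"
  have "J (root i b) (root i b) = - (N / 2 * of_int (cartan_A l i j))"
    using form_root[OF assms, of b b'] by (subst (2) e) simp
  then have "N * (of_int (cartan_A l i j) + 2) = 0"
    using form_root_same[OF assms(1), of b b] by (simp add: ring_distribs) (simp add: field_simps)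
  then have "of_int (cartan_A l i j) = (- 2 :: complex)" using N_nz by (simp add: eq_neg_iff_add_eq_0)
  then have "cartan_A l i j = -2" by (metis of_int_eq_iff of_int_minus of_int_numeral)
  then show False using cartan_A_cases[of i j l] by (cases "i = j") auto
qed

lemma B_plus_root: "B_plus D = {root i b | i b. i \<le> l}"
proof -
  have "simple_roots D = (\<lambda>i. root i False) ` {..l}" "star D ` simple_roots D = (\<lambda>i. root i True) ` {..l}"
    by (auto simp: simple_roots_def root_def star_def)
  then have "x \<in> B_plus D \<longleftrightarrow> (\<exists>i\<le>l. x = root i False) \<or> (\<exists>i\<le>l. x = root i True)" for x
    by (auto simp: B_plus_def)
  then show ?thesis by (auto; metis (full_types))
qed

lemma B_all_cases:
  assumes "\<mu> \<in> B_all D"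
  obtains i b where "i \<le> l" "\<mu> = root i b" | i b where "i \<le> l" "\<mu> = - root i b"
  using assms unfolding B_all_def B_plus_root by auto

lemma root_B: "i \<le> l \<Longrightarrow> root i b \<in> B_all D" "i \<le> l \<Longrightarrow> - root i b \<in> B_all D" "i \<le> l \<Longrightarrow> root i b \<in> B_plus D"
  unfolding B_all_def B_plus_root by blast+

definition refl :: "nat \<Rightarrow> 'e \<Rightarrow> 'e" where
  "refl i y = y - scl D (J (coroot D (r i)) y) (r i)"

lemma coroot_r: "i \<le> l \<Longrightarrow> J (coroot D (r i)) y = 2 / N * J (r i) y"
  by (simp add: form_coroot form_simple_same)

lemma coroot_r_a [simp]: "i \<le> l \<Longrightarrow> J (coroot D (r i)) a = 0"
  by (simp add: coroot_r form_simple_a)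

lemma reflection_r: "reflection D (r i) = refl i"
  by (simp add: fun_eq_iff refl_def reflection_def)

lemma refl_form: assumes "i \<le> l" shows "J (refl i x) (refl i y) = J x y"
  using N_nz form_sym[of x "r i"]
  by (simp add: refl_def form_diff form_scl form_scl_right coroot_r[OF assms] form_simple_same[OF assms])

lemma refl_add: "refl i (x + y) = refl i x + refl i y"
  by (simp add: refl_def form_add_right scale_left_distrib)

lemma refl_scl: "refl i (scl D c x) = scl D c (refl i x)"
  by (simp add: refl_def form_scl_right scale_right_diff_distrib)

lemma refl_a: "i \<le> l \<Longrightarrow> refl i a = a"
  by (simp add: refl_def)

lemma weyl_induct [consumes 1, case_names id refl]:
  assumes "w \<in> weyl_group D" "P id" "\<And>i w. i \<le> l \<Longrightarrow> w \<in> weyl_group D \<Longrightarrow> P w \<Longrightarrow> P (refl i \<circ> w)"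
  shows "P w"
  using assms(1)
proof induction
  case one show ?case by (rule assms(2))
next
  case (step \<alpha> w)
  then obtain i where i: "i \<le> l" "\<alpha> = r i" by (auto simp: simple_roots_def)
  show ?case unfolding i(2) reflection_r by (rule assms(3)[OF i(1) step(2,3)])
qed

lemma weyl_refl_left: "i \<le> l \<Longrightarrow> w \<in> weyl_group D \<Longrightarrow> refl i \<circ> w \<in> weyl_group D"
  using weyl_group.step[of "r i" D w] by (simp add: simple_roots_def reflection_r)

lemma weyl_refl_right: "w \<in> weyl_group D \<Longrightarrow> i \<le> l \<Longrightarrow> w \<circ> refl i \<in> weyl_group D"
proof (induction rule: weyl_induct)
  case id then show ?case using weyl_refl_left[OF id weyl_group.one] by (simp only: id_comp comp_id)
next
  case (refl j w)
  show ?case unfolding comp_assoc by (rule weyl_refl_left[OF refl.hyps(1) refl.IH[OF refl.prems]])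
qed

lemma weyl_form: "w \<in> weyl_group D \<Longrightarrow> J (w x) (w y) = J x y"
  by (induction rule: weyl_induct) (simp_all add: refl_form)

lemma weyl_linear: assumes "w \<in> weyl_group D"
  shows "w (x + y) = w x + w y" "w (scl D c x) = scl D c (w x)" "w a = a"
  using assms by (induction rule: weyl_induct) (simp_all add: refl_add refl_scl refl_a)

lemma real_rootsE:
  assumes "\<nu> \<in> real_roots D"
  obtains w i n where "w \<in> weyl_group D" "i \<le> l" "\<nu> = w (r i + scl D (of_int n) a)"
  using assms unfolding real_roots_def simple_roots_def by auto

lemma real_rootsI:
  "w \<in> weyl_group D \<Longrightarrow> i \<le> l \<Longrightarrow> w (r i + scl D (of_int n) a) \<in> real_roots D"
  unfolding real_roots_def simple_roots_def by blast

lemma string_root: "i \<le> l \<Longrightarrow> r i + scl D (of_int n) a \<in> real_roots D"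
  using real_rootsI[OF weyl_group.one] by simp

lemma root_real: "i \<le> l \<Longrightarrow> root i b \<in> real_roots D"
  using string_root[of i "of_bool b"] by (cases b) (simp_all add: root_def)

lemma real_root_norm: "\<nu> \<in> real_roots D \<Longrightarrow> J \<nu> \<nu> = N"
  by (elim real_rootsE)
    (simp add: weyl_form form_add form_add_right form_scl form_scl_right form_a_simple form_a_a form_simple_a form_simple_same)

lemma real_root_refl: "\<nu> \<in> real_roots D \<Longrightarrow> i \<le> l \<Longrightarrow> refl i \<nu> \<in> real_roots D"
  by (elim real_rootsE) (metis comp_apply real_rootsI weyl_refl_left)

lemma real_root_shift: "\<nu> \<in> real_roots D \<Longrightarrow> \<nu> + scl D (of_int n) a \<in> real_roots D"
proof (elim real_rootsE)
  fix w i m assume w: "w \<in> weyl_group D" "i \<le> l" "\<nu> = w (r i + scl D (of_int m) a)"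
  then have "\<nu> + scl D (of_int n) a = w (r i + scl D (of_int (m + n)) a)"
    by (simp add: weyl_linear scale_left_distrib add.assoc)
  then show ?thesis using real_rootsI[OF w(1,2), of "m + n"] by simp
qed

lemma real_root_minus: "\<nu> \<in> real_roots D \<Longrightarrow> - \<nu> \<in> real_roots D"
proof (elim real_rootsE)
  fix w i m assume w: "w \<in> weyl_group D" "i \<le> l" "\<nu> = w (r i + scl D (of_int m) a)"
  have "- \<nu> = scl D (- 1) \<nu>" by simp
  also have "\<dots> = w (scl D (- 1) (r i + scl D (of_int m) a))" using w by (simp only: weyl_linear)
  also have "scl D (- 1) (r i + scl D (of_int m) a) = refl i (r i + scl D (of_int (- m)) a)"
    using w(2) cartan_matrix[OF w(2,2)] scale_left_distrib[of 1 1 "r i"]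
    by (simp add: refl_def form_add_right form_diff form_scl_right)
  finally have "- \<nu> = (w \<circ> refl i) (r i + scl D (of_int (- m)) a)" by simp
  then show ?thesis using real_rootsI[OF weyl_refl_right[OF w(1,2)] w(2), of "- m"] by simp
qed

text \<open>Integrality on all simple coroots is preserved by simple reflections, the Cartan matrix being
integral.\<close>

lemma real_root_integral: assumes "\<nu> \<in> real_roots D" "i \<le> l"
  shows "\<exists>k::int. J (coroot D (r i)) \<nu> = of_int k"
  using assms(1)
proof (elim real_rootsE)
  fix w j n assume w: "w \<in> weyl_group D" "j \<le> l" "\<nu> = w (r j + scl D (of_int n) a)"
  have "\<forall>i\<le>l. \<exists>k::int. J (coroot D (r i)) (w (r j + scl D (of_int n) a)) = of_int k"
    using w(1)
  proof (induction rule: weyl_induct)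
    case id
    then show ?case using cartan_matrix[OF _ w(2)] by (auto simp: form_add_right form_scl_right)
  next
    case (refl m w)
    show ?case
    proof (intro allI impI)
      fix i assume i: "i \<le> l"
      obtain k k' where "J (coroot D (r i)) (w (r j + scl D (of_int n) a)) = of_int k"
        "J (coroot D (r m)) (w (r j + scl D (of_int n) a)) = of_int k'" using refl i by metis
      then have "J (coroot D (r i)) ((refl m \<circ> w) (r j + scl D (of_int n) a)) = of_int (k - k' * cartan_A l i m)"
        using cartan_matrix[OF i refl(1)] by (simp add: refl_def form_diff form_scl_right)
      then show "\<exists>k::int. J (coroot D (r i)) ((refl m \<circ> w) (r j + scl D (of_int n) a)) = of_int k" ..
    qed
  qed
  then show ?thesis using w assms(2) by blast
qed

lemma form_a_real_root: "\<nu> \<in> real_roots D \<Longrightarrow> J a \<nu> = 0"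
proof (elim real_rootsE)
  fix w j n assume w: "w \<in> weyl_group D" "j \<le> l" "\<nu> = w (r j + scl D (of_int n) a)"
  have "J a \<nu> = J (w a) \<nu>" using w weyl_linear(3) by metis
  also have "\<dots> = 0" using w by (simp add: weyl_form form_add_right form_scl_right form_a_simple form_a_a)
  finally show ?thesis .
qed

lemma coroot_root_real: "\<nu> \<in> real_roots D \<Longrightarrow> i \<le> l \<Longrightarrow> J (coroot D (root i b)) \<nu> = J (coroot D (r i)) \<nu>"
  by (simp add: coroot_root form_scl coroot_r) (simp add: root_def form_add form_a_real_root)

lemma root_reflection_real:
  assumes "\<nu> \<in> real_roots D" "i \<le> l" "J (coroot D (root i b)) \<nu> = of_int k"
  shows "\<nu> - scl D (of_int k) (root i b) \<in> real_roots D"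
proof -
  have "\<nu> - scl D (of_int k) (root i b) = refl i \<nu> + scl D (of_int (if b then - k else 0)) a"
    using assms coroot_root_real[OF assms(1,2), of b] by (simp add: refl_def root_def scale_right_distrib)
  then show ?thesis using real_root_shift[OF real_root_refl[OF assms(1,2)]] by simp
qed

text \<open>The reflections in \<open>\<alpha>\<^sub>i\<close> and \<open>\<alpha>\<^sub>i + a\<close> together translate \<open>\<alpha>\<^sub>i + n a\<close> by \<open>\<plusminus> 2 a\<close>, so that
the whole string is obtained from \<open>\<alpha>\<^sub>i\<close> and \<open>\<alpha>\<^sub>i + a\<close>; the Weyl group does the rest.\<close>

lemma real_roots_induct:
  assumes T: "\<And>i b. i \<le> l \<Longrightarrow> root i b \<in> T"
    "\<And>\<nu> i b k. \<nu> \<in> T \<Longrightarrow> \<nu> \<in> real_roots D \<Longrightarrow> i \<le> l \<Longrightarrow> J (coroot D (root i b)) \<nu> = of_int k \<Longrightarrow>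
      \<nu> - scl D (of_int k) (root i b) \<in> T"
  shows "real_roots D \<subseteq> T"
proof
  have string: "r i + scl D (of_int n) a \<in> T" if i: "i \<le> l" for i n
  proof (induction n rule: int_shift2_induct)
    case 1 then show ?case using T(1)[OF i, of False] by (simp add: root_def)
  next
    case 2 then show ?case using T(1)[OF i, of True] by (simp add: root_def)
  next
    have c2: "J (coroot D (root i b)) (r i + scl D (of_int n) a) = of_int 2" for n b
      using coroot_root_real[OF string_root[OF i] i, of b n] cartan_matrix[OF i i] i by (simp add: form_add_right form_scl_right)
    have m: "- r i + scl D (of_int n) a \<in> real_roots D" for n
      using real_root_minus[OF string_root[OF i, of "- n"]] by simp
    have cm: "J (coroot D (root i b)) (- r i + scl D (of_int n) a) = of_int (- 2)" for n b
      using coroot_root_real[OF m i, of b n] cartan_matrix[OF i i] i by (simp add: form_add_right form_diff form_scl_right)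
    have two: "scl D 2 x = x + x" for x using scale_left_distrib[of 1 1 x] by simp
    {
      case (3 n)
      have "- r i + scl D (of_int n) a \<in> T"
        using T(2)[OF 3 string_root[OF i] i c2[of False]] by (simp add: root_def two)
      from T(2)[OF this m i cm[of True]] show ?case
        by (simp add: root_def two scale_right_distrib scale_left_distrib algebra_simps)
    next
      case (4 n)
      have "- r i + scl D (of_int (n - 2)) a \<in> T"
        using T(2)[OF 4 string_root[OF i] i c2[of True]]
        by (simp add: root_def two scale_left_diff_distrib algebra_simps)
      from T(2)[OF this m i cm[of False]] show ?case
        by (simp add: root_def two add.commute)
    }
  qed
  fix \<nu> assume "\<nu> \<in> real_roots D"
  then show "\<nu> \<in> T"
  proof (elim real_rootsE)
    fix w j n assume w: "w \<in> weyl_group D" "j \<le> l" "\<nu> = w (r j + scl D (of_int n) a)"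
    have "w (r j + scl D (of_int n) a) \<in> T" using w(1)
    proof (induction rule: weyl_induct)
      case id then show ?case using string[OF w(2)] by simp
    next
      case (refl i w)
      let ?\<nu> = "w (r j + scl D (of_int n) a)"
      have real: "?\<nu> \<in> real_roots D" using real_rootsI refl w(2) by blast
      obtain k where k: "J (coroot D (r i)) ?\<nu> = of_int k" using real_root_integral[OF real refl(1)] by blast
      then show ?case
        using T(2)[OF refl(3) real refl(1), of False k] coroot_root_real[OF real refl(1), of False]
        by (simp add: refl_def root_def)
    qed
    then show ?thesis using w by simp
  qed
qed

lemma two_root_real:
  assumes "i \<le> l" "j \<le> l" "cartan_A l i j = -1" shows "root i b + root j b' \<in> real_roots D"
  using root_reflection_real[OF root_real[OF assms(2)] assms(1), of b b' "-1"] form_coroot_root[OF assms(1,2)] assms(3)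
  by (simp add: add.commute)

lemma imag_norm: "J (imag_weight D p) (imag_weight D p) = 0"
proof -
  have d: "J (delta D) (r j) = 0" if "j \<le> l" for j
  proof -
    have "J (delta D) (r j) = (\<Sum>i\<le>l. N / 2 * of_int (cartan_A l i j))"
      unfolding delta_def form_sum using that by (intro sum.cong) (auto simp: form_simple)
    also have "\<dots> = N / 2 * of_int (\<Sum>i\<le>l. cartan_A l i j)"
      unfolding of_int_sum by (rule sum_distrib_left[symmetric])
    also have "\<dots> = 0" using cartan_A_column_sum[OF rank_ge_2 that] by simp
    finally show ?thesis .
  qed
  have dd: "J (delta D) (delta D) = 0" by (subst (2) delta_def) (simp add: form_sum d)
  have da: "J (delta D) a = 0" unfolding delta_def form_sum by (simp add: form_simple_a)
  have ad: "J a (delta D) = 0" using da form_sym[of a "delta D"] by simp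
  obtain m n where "p = (m, n)" by (cases p)
  then show ?thesis
    by (simp add: imag_weight_def form_add form_add_right form_scl form_scl_right dd da ad form_a_a)
qed

lemma imag_weight_inj: "imag_weight D p = imag_weight D q \<Longrightarrow> p = q"
proof -
  assume e: "imag_weight D p = imag_weight D q"
  obtain m n m' n' where pq: "p = (m, n)" "q = (m', n')" by (cases p; cases q)
  have 1: "J (Lambda_delta D) (imag_weight D (m, n)) = of_int m" for m n
    unfolding imag_weight_def
    by (simp add: delta_def form_add_right form_scl_right form_sum form_Lambda_delta_simple form_Lambda_delta_a cong: sum.cong_simp)
  have 2: "J (Lambda_a D) (imag_weight D (m, n)) = of_int n" for m n
    unfolding imag_weight_def
    by (simp add: delta_def form_add_right form_scl_right form_sum form_Lambda_a_simple form_Lambda_a_a)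
  show ?thesis using 1[of m n] 1[of m' n'] 2[of m n] 2[of m' n'] e pq by simp
qed

lemma imag_weight_0: "imag_weight D (0, 0) = 0"
  by (simp add: imag_weight_def)

lemma simple_roots_independent:
  assumes "(\<Sum>j\<le>l. scl D (c j) (r j)) = 0" "j \<le> l" shows "c j = 0"
proof -
  have inj: "inj_on r {..l}"
  proof (rule inj_onI)
    fix i j assume "i \<in> {..l}" "j \<in> {..l}" "r i = r j"
    then show "i = j" using root_inj[of i j False False] by (simp add: root_def)
  qed
  have ind: "independent (r ` {..l})"
    using basis_independent by (rule independent_mono) (auto simp: simple_roots_def)
  have "(\<Sum>v\<in>r ` {..l}. scl D (c (the_inv_into {..l} r v)) v) = (\<Sum>j\<le>l. scl D (c j) (r j))"
    by (subst sum.reindex[OF inj]) (auto intro!: sum.cong simp: the_inv_into_f_f[OF inj])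
  then have "c (the_inv_into {..l} r (r j)) = 0"
    using independentD[OF ind finite_imageI[OF finite_atMost] subset_refl, of "\<lambda>v. c (the_inv_into {..l} r v)" "r j"] assms by simp
  then show ?thesis using the_inv_into_f_f[OF inj] assms(2) by simp
qed

text \<open>A weight that vanishes on the orthogonal complement of \<open>a\<close> is a multiple of \<open>a\<close>, because \<open>\<Lambda>\<^sub>a\<close>
complements it; being orthogonal to \<open>\<Lambda>\<^sub>a\<close>, a combination of simple roots with this property is zero.\<close>

lemma simple_root_separation:
  fixes d :: "nat \<Rightarrow> int"
  assumes "\<exists>j\<le>l. d j \<noteq> 0"
  shows "\<exists>s. J s a = 0 \<and> (\<Sum>j\<le>l. of_int (d j) * J s (r j)) \<noteq> 0"
proof (rule ccontr)
  assume "\<not> ?thesis"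
  then have z: "(\<Sum>j\<le>l. of_int (d j) * J s (r j)) = 0" if "J s a = 0" for s using that by blast
  define v where "v = (\<Sum>j\<le>l. scl D (of_int (d j)) (r j))"
  have v: "J s v = (\<Sum>j\<le>l. of_int (d j) * J s (r j))" for s
    by (simp add: v_def form_sum form_scl_right)
  have La: "J (Lambda_a D) v = 0" by (simp add: v form_Lambda_a_simple)
  have "J s v = J s 0" for s
  proof -
    have "J (s - scl D (J s a) (Lambda_a D)) a = 0"
      by (simp add: form_diff form_scl form_Lambda_a_a)
    from z[OF this] v[of "s - scl D (J s a) (Lambda_a D)"] La show ?thesis
      by (simp add: form_diff form_scl)
  qed
  then have "v = 0" by (rule form_separates)
  then show False using simple_roots_independent[of "\<lambda>j. of_int (d j)"] assms by (auto simp: v_def)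
qed

end

section \<open>Weight spaces under (UI1)--(UI4)\<close>

locale ui_algebra = A11_base_system D + lie_superalgebra L
  for D :: "'e::ab_group_add base_system" and L :: "'b lsalg" (structure) +
  fixes h :: "'e \<Rightarrow> 'b" and J' :: "'b \<Rightarrow> 'b \<Rightarrow> complex"
  assumes ui1: "UI1 D L h" and ui2: "UI2 D L h" and ui3: "UI3 D L h" and ui4: "UI4 D L h J'"
begin

abbreviation W :: "'e \<Rightarrow> 'b set" where "W \<equiv> weight_space D L h"

lemma h_even: "h \<sigma> \<in> hpart L False"
  using ui1 by (auto simp: UI1_def)

lemma h_closed [simp]: "h \<sigma> \<in> carrier L"
  using h_even hpart_carrier by blast

lemma h_comb: "h (scl D x \<sigma> + scl D y \<tau>) = x \<odot> h \<sigma> \<oplus> y \<odot> h \<tau>"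
  using ui1 unfolding UI1_def by blast

lemma h_commute: "bracket L (h \<sigma>) (h \<tau>) = \<zero>"
  using ui1 unfolding UI1_def by blast

lemma W_closed: "x \<in> W \<mu> \<Longrightarrow> x \<in> carrier L"
  by (simp add: weight_space_def)

lemma W_eigen: "x \<in> W \<mu> \<Longrightarrow> bracket L (h \<sigma>) x = J \<sigma> \<mu> \<odot> x"
  by (simp add: weight_space_def)

lemma W_zero: "\<zero> \<in> W \<mu>"
  by (simp add: weight_space_def)

lemma W_smult: "x \<in> W \<mu> \<Longrightarrow> c \<odot> x \<in> W \<mu>"
  by (simp add: weight_space_def bracket_smult_right smult_smult mult.commute)

lemma W_bracket: assumes "x \<in> W \<mu>" "y \<in> W \<nu>" shows "bracket L x y \<in> W (\<mu> + \<nu>)"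
proof -
  note c = W_closed[OF assms(1)] W_closed[OF assms(2)]
  have "bracket L (h \<sigma>) (bracket L x y) = J \<sigma> (\<mu> + \<nu>) \<odot> bracket L x y" for \<sigma>
    using c by (simp add: bracket_even_derivation[OF h_even c] W_eigen[OF assms(1)] W_eigen[OF assms(2)]
      bracket_smult_left bracket_smult_right form_add_right smult_add_left)
  then show ?thesis using c by (simp add: weight_space_def)
qed

definition wt :: "'e summand \<Rightarrow> 'e" where
  "wt i = (case i of Cartan \<Rightarrow> 0 | RealRoot \<nu> \<Rightarrow> \<nu> | ImagRoot p \<Rightarrow> imag_weight D p)"

abbreviation Ind :: "'e summand set" where "Ind \<equiv> summand_indices D"
abbreviation V :: "'e summand \<Rightarrow> 'b set" where "V \<equiv> summand_space D L h"

lemma Ind_cases [consumes 1, case_names Cartan Real Imag]: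
  assumes "i \<in> Ind"
  obtains "i = Cartan" | \<nu> where "i = RealRoot \<nu>" "\<nu> \<in> real_roots D" | p where "i = ImagRoot p" "p \<noteq> (0, 0)"
  using assms unfolding summand_indices_def by auto

lemma V_W: "i \<in> Ind \<Longrightarrow> x \<in> V i \<Longrightarrow> x \<in> W (wt i)"
  by (cases i) (auto simp: wt_def weight_space_def h_commute)

lemma wt_norm: "i \<in> Ind \<Longrightarrow> J (wt i) (wt i) = 0 \<or> J (wt i) (wt i) = N"
  by (cases rule: Ind_cases) (auto simp: wt_def imag_norm real_root_norm)

lemma wt_zero: assumes "i \<in> Ind" "wt i = 0" shows "i = Cartan"
  using assms(1)
proof (cases rule: Ind_cases)
  case (Real \<nu>)
  then show ?thesis using real_root_norm[of \<nu>] N_nz assms(2) by (simp add: wt_def)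
next
  case (Imag p)
  then show ?thesis using imag_weight_inj[of p "(0, 0)"] assms(2) by (simp add: wt_def imag_weight_0)
qed

lemma V_submodule: "i \<in> Ind \<Longrightarrow> submodule (V i) complex_ring L"
  using ui2 unfolding UI2_def internal_direct_sum_def by blast

lemma V_smult: "i \<in> Ind \<Longrightarrow> x \<in> V i \<Longrightarrow> c \<odot> x \<in> V i"
  using submoduleE(4)[OF V_submodule, of i c x] by simp

lemma V_closed: "i \<in> Ind \<Longrightarrow> x \<in> V i \<Longrightarrow> x \<in> carrier L"
  using V_W W_closed by blast

text \<open>The families that represent elements in the direct sum of (UI2).\<close>

definition family :: "('e summand \<Rightarrow> 'b) \<Rightarrow> bool" where
  "family f \<longleftrightarrow> (\<forall>i\<in>Ind. f i \<in> V i) \<and> (\<forall>i. i \<notin> Ind \<longrightarrow> f i = \<zero>) \<and> finite {i. f i \<noteq> \<zero>}"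

lemma family_closed: "family f \<Longrightarrow> f i \<in> carrier L"
  unfolding family_def using V_closed by (cases "i \<in> Ind") auto

lemma expansion:
  assumes "x \<in> carrier L" obtains f where "family f" "x = finsum L f {i. f i \<noteq> \<zero>}"
proof -
  have "\<exists>!f. (\<forall>i\<in>Ind. f i \<in> V i) \<and> (\<forall>i. i \<notin> Ind \<longrightarrow> f i = \<zero>) \<and> finite {i. f i \<noteq> \<zero>} \<and> x = finsum L f {i. f i \<noteq> \<zero>}"
    using ui2 assms unfolding UI2_def internal_direct_sum_def by blast
  from ex1_implies_ex[OF this] show ?thesis using that unfolding family_def by (elim exE conjE) auto
qed

lemma finsum_superset:
  assumes "family f" "finite A" "{i. f i \<noteq> \<zero>} \<subseteq> A"
  shows "finsum L f {i. f i \<noteq> \<zero>} = finsum L f A"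
  by (rule M.add.finprod_mono_neutral_cong_left) (use assms family_closed in auto)

lemma expansion_unique:
  assumes "family f" "family g" "finite A" "{i. f i \<noteq> \<zero>} \<subseteq> A" "{i. g i \<noteq> \<zero>} \<subseteq> A" "finsum L f A = finsum L g A"
  shows "f = g"
proof -
  define x where "x = finsum L f A"
  have "x \<in> carrier L" unfolding x_def by (rule M.finsum_closed) (use assms(1) family_closed in auto)
  define P where "P y \<longleftrightarrow> (\<forall>i\<in>Ind. y i \<in> V i) \<and> (\<forall>i. i \<notin> Ind \<longrightarrow> y i = \<zero>) \<and>
    finite {i. y i \<noteq> \<zero>} \<and> x = finsum L y {i. y i \<noteq> \<zero>}" for y
  have ex: "\<exists>!y. P y" unfolding P_def
    using ui2 \<open>x \<in> carrier L\<close> unfolding UI2_def internal_direct_sum_def by blast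
  have "x = finsum L f {i. f i \<noteq> \<zero>}" "x = finsum L g {i. g i \<noteq> \<zero>}"
    using finsum_superset[OF assms(1,3,4)] finsum_superset[OF assms(2,3,5)] assms(6) by (simp_all add: x_def)
  then have "P f" "P g" using assms(1,2) unfolding P_def family_def by blast+
  with ex show ?thesis by blast
qed

lemma family_smult: "family f \<Longrightarrow> family (\<lambda>i. c i \<odot> f i)"
proof -
  assume f: "family f"
  have "{i. c i \<odot> f i \<noteq> \<zero>} \<subseteq> {i. f i \<noteq> \<zero>}" by auto
  then have "finite {i. c i \<odot> f i \<noteq> \<zero>}" using f finite_subset unfolding family_def by blast
  then show ?thesis using f V_smult unfolding family_def by auto
qed

text \<open>The bracket with \<open>h \<sigma>\<close> multiplies a component by its own weight, and the whole vector by \<open>\<mu>\<close>;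
uniqueness of expansions compares the two.\<close>

lemma weight_components:
  assumes f: "family f" and x: "finsum L f {i. f i \<noteq> \<zero>} \<in> W \<mu>" and i: "f i \<noteq> \<zero>"
  shows "wt i = \<mu>"
proof (rule form_separates)
  fix \<sigma>
  let ?A = "{i. f i \<noteq> \<zero>}"
  have fin: "finite ?A" and cl: "f \<in> ?A \<rightarrow> carrier L" using f family_closed by (auto simp: family_def)
  have "finsum L (\<lambda>i. J \<sigma> \<mu> \<odot> f i) ?A = J \<sigma> \<mu> \<odot> finsum L f ?A"
    by (rule finsum_smult_ldistr[symmetric]) (use fin cl in auto)
  also have "\<dots> = bracket L (h \<sigma>) (finsum L f ?A)" using W_eigen[OF x] by simp
  also have "\<dots> = finsum L (\<lambda>i. bracket L (h \<sigma>) (f i)) ?A" by (rule bracket_finsum[OF fin h_closed cl])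
  also have "\<dots> = finsum L (\<lambda>i. J \<sigma> (wt i) \<odot> f i) ?A"
  proof (rule M.finsum_cong')
    fix i assume "i \<in> ?A"
    then have "i \<in> Ind" using f by (auto simp: family_def)
    then have "f i \<in> W (wt i)" using f V_W by (auto simp: family_def)
    then show "bracket L (h \<sigma>) (f i) = J \<sigma> (wt i) \<odot> f i" by (rule W_eigen)
  qed (use cl in auto)
  finally have eq: "finsum L (\<lambda>i. J \<sigma> \<mu> \<odot> f i) ?A = finsum L (\<lambda>i. J \<sigma> (wt i) \<odot> f i) ?A" .
  have "(\<lambda>i. J \<sigma> \<mu> \<odot> f i) = (\<lambda>i. J \<sigma> (wt i) \<odot> f i)"
    by (rule expansion_unique[OF family_smult[OF f] family_smult[OF f] fin _ _ eq]) auto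
  from fun_cong[OF this, of i] show "J \<sigma> (wt i) = J \<sigma> \<mu>"
    using smult_left_cancel[OF family_closed[OF f, of i]] i by fastforce
qed

text \<open>All weights that occur have squared length \<open>0\<close> or \<open>N\<close>. The Serre relations and all other vanishing
brackets of root vectors come from this.\<close>

lemma W_trivial:
  assumes "x \<in> W \<mu>" "J \<mu> \<mu> \<noteq> 0" "J \<mu> \<mu> \<noteq> N" shows "x = \<zero>"
proof -
  obtain f where f: "family f" "x = finsum L f {i. f i \<noteq> \<zero>}" by (rule expansion[OF W_closed[OF assms(1)]])
  have "{i. f i \<noteq> \<zero>} = {}"
  proof (rule ccontr)
    assume "{i. f i \<noteq> \<zero>} \<noteq> {}"
    then obtain i where i: "f i \<noteq> \<zero>" by blast
    then have "i \<in> Ind" using f(1) by (auto simp: family_def)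
    moreover have "wt i = \<mu>" using weight_components[OF f(1) _ i] f(2) assms(1) by simp
    ultimately show False using wt_norm[of i] assms(2,3) by simp
  qed
  with f(2) show ?thesis by simp
qed

lemma W_0: assumes "x \<in> W 0" shows "\<exists>\<tau>. x = h \<tau>"
proof -
  obtain f where f: "family f" "x = finsum L f {i. f i \<noteq> \<zero>}" by (rule expansion[OF W_closed[OF assms(1)]])
  have sub: "{i. f i \<noteq> \<zero>} \<subseteq> {Cartan}"
  proof
    fix i assume "i \<in> {i. f i \<noteq> \<zero>}"
    then have i: "f i \<noteq> \<zero>" by simp
    then have "i \<in> Ind" using f(1) by (auto simp: family_def)
    moreover have "wt i = 0" using weight_components[OF f(1) _ i] f(2) assms(1) by simp
    ultimately show "i \<in> {Cartan}" using wt_zero by simp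
  qed
  have "x = finsum L f {Cartan}" using f(2) finsum_superset[OF f(1) _ sub] by simp
  also have "\<dots> = f Cartan" using family_closed[OF f(1)] M.finsum_insert[of "{}" Cartan f] by simp
  also have "f Cartan \<in> range h" using f(1) unfolding family_def summand_indices_def by auto
  finally show ?thesis by blast
qed

lemma J'_inv: "invariant_form L J'" and J'_h: "J' (h \<sigma>) (h \<tau>) = J \<sigma> \<tau>"
  using ui4 unfolding UI4_def by blast+

lemma J'_add: "x \<in> carrier L \<Longrightarrow> y \<in> carrier L \<Longrightarrow> z \<in> carrier L \<Longrightarrow> J' (x \<oplus> y) z = J' x z + J' y z"
  "x \<in> carrier L \<Longrightarrow> y \<in> carrier L \<Longrightarrow> z \<in> carrier L \<Longrightarrow> J' x (y \<oplus> z) = J' x y + J' x z"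
  using J'_inv unfolding invariant_form_def bilinear_form_def by blast+

lemma J'_smult: "x \<in> carrier L \<Longrightarrow> y \<in> carrier L \<Longrightarrow> J' (c \<odot> x) y = c * J' x y"
  "x \<in> carrier L \<Longrightarrow> y \<in> carrier L \<Longrightarrow> J' x (c \<odot> y) = c * J' x y"
  using J'_inv unfolding invariant_form_def bilinear_form_def by blast+

lemma J'_bracket: "x \<in> carrier L \<Longrightarrow> y \<in> carrier L \<Longrightarrow> z \<in> carrier L \<Longrightarrow>
    J' (bracket L x y) z = J' x (bracket L y z)"
  using J'_inv unfolding invariant_form_def by blast

lemma J'_zero: "x \<in> carrier L \<Longrightarrow> J' x \<zero> = 0"
  using J'_smult(2)[of x \<zero> 0] by simp

lemma J'_finsum: "finite A \<Longrightarrow> x \<in> carrier L \<Longrightarrow> f \<in> A \<rightarrow> carrier L \<Longrightarrow> J' x (finsum L f A) = (\<Sum>i\<in>A. J' x (f i))"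
proof (induction A rule: finite_induct)
  case empty then show ?case by (simp add: J'_zero)
next
  case (insert i A)
  have f: "f \<in> A \<rightarrow> carrier L" "f i \<in> carrier L" using insert.prems by auto
  then show ?case using insert by (simp add: M.finsum_insert[OF insert.hyps f] J'_add M.finsum_closed)
qed

lemma W_orthogonal:
  assumes "x \<in> W \<mu>" "y \<in> W \<nu>" "\<mu> + \<nu> \<noteq> 0" shows "J' x y = 0"
proof -
  obtain \<sigma> where s: "J \<sigma> (\<mu> + \<nu>) \<noteq> 0" using form_nondegenerate[of "\<mu> + \<nu>"] assms(3) form_sym by metis
  note c = W_closed[OF assms(1)] W_closed[OF assms(2)]
  have "J' (bracket L x (h \<sigma>)) y = J' x (bracket L (h \<sigma>) y)" by (rule J'_bracket) (use c in auto)
  then have "- J \<sigma> \<mu> * J' x y = J \<sigma> \<nu> * J' x y"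
    using c by (simp only: bracket_even_skew[OF h_even c(1)] W_eigen[OF assms(1)] W_eigen[OF assms(2)]
      J'_smult smult_mem smult_smult) simp
  then have "J \<sigma> (\<mu> + \<nu>) * J' x y = 0" by (simp add: form_add_right ring_distribs eq_neg_iff_add_eq_0 neg_eq_iff_add_eq_0)
  then show ?thesis using s by simp
qed

text \<open>The bracket has weight zero, so it lies in the Cartan subalgebra, and \<open>J'\<close> identifies it by
invariance.\<close>

lemma W_bracket_opposite:
  assumes "x \<in> W \<nu>" "y \<in> W (- \<nu>)" shows "bracket L x y = h (scl D (J' x y) \<nu>)"
proof -
  note c = W_closed[OF assms(1)] W_closed[OF assms(2)]
  obtain \<tau> where t: "bracket L x y = h \<tau>" using W_0[of "bracket L x y"] W_bracket[OF assms] by auto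
  have "J \<sigma> \<tau> = J \<sigma> (scl D (J' x y) \<nu>)" for \<sigma>
  proof -
    have "J \<sigma> \<tau> = J' (bracket L (h \<sigma>) x) y" using c by (simp add: J'_bracket t J'_h)
    then show ?thesis using c by (simp add: W_eigen[OF assms(1)] J'_smult form_scl_right)
  qed
  then have "\<tau> = scl D (J' x y) \<nu>" by (rule form_separates)
  with t show ?thesis by simp
qed

text \<open>Otherwise the vector would be a sum of imaginary components, against the uniqueness of expansions.\<close>

lemma real_root_not_kernel:
  assumes "\<nu> \<in> real_roots D" "x \<in> W \<nu>" "x \<noteq> \<zero>" shows "x \<notin> form_kernel L J'"
proof
  assume "x \<in> form_kernel L J'"
  then have "x \<in> sum_of_subspaces L (UNIV - {(0, 0)}) (\<lambda>p. W (imag_weight D p))"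
    using ui4 unfolding UI4_def by blast
  then obtain f F where F: "x = finsum L f F" "finite F" "F \<subseteq> UNIV - {(0, 0)}" "\<forall>p\<in>F. f p \<in> W (imag_weight D p)"
    unfolding sum_of_subspaces_def by blast
  define g where "g i = (case i of ImagRoot p \<Rightarrow> if p \<in> F then f p else \<zero> | _ \<Rightarrow> \<zero>)" for i :: "'e summand"
  define k where "k i = (if i = RealRoot \<nu> then x else \<zero>)" for i :: "'e summand"
  have xc: "x \<in> carrier L" by (rule W_closed[OF assms(2)])
  have gsup: "{i. g i \<noteq> \<zero>} \<subseteq> ImagRoot ` F"
  proof
    fix i assume "i \<in> {i. g i \<noteq> \<zero>}"
    then show "i \<in> ImagRoot ` F" by (cases i) (auto simp: g_def split: if_splits)
  qed
  have zero: "\<zero> \<in> V i" if "i \<in> Ind" for i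
    using submoduleE(4)[OF V_submodule[OF that], of 0] submoduleE(2)[OF V_submodule[OF that]] V_closed[OF that] by fastforce
  have "g i \<in> V i" if "i \<in> Ind" for i
  proof (cases i)
    case (ImagRoot p) then show ?thesis using F(4) W_zero by (simp add: g_def)
  qed (use zero[OF that] in \<open>auto simp: g_def\<close>)
  moreover have "g i = \<zero>" if "i \<notin> Ind" for i
    using that F(3) by (auto simp: g_def summand_indices_def split: summand.splits)
  ultimately have gf: "family g" using finite_subset[OF gsup] F(2) unfolding family_def by blast
  have ksup: "{i. k i \<noteq> \<zero>} \<subseteq> {RealRoot \<nu>}" by (auto simp: k_def)
  have "RealRoot \<nu> \<in> Ind" using assms(1) by (auto simp: summand_indices_def)
  then have kf: "family k" using finite_subset[OF ksup] zero assms(2) unfolding family_def by (auto simp: k_def)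
  let ?A = "insert (RealRoot \<nu>) (ImagRoot ` F)"
  have "finsum L g ?A = finsum L g (ImagRoot ` F)"
    by (subst M.finsum_insert) (use F(2) family_closed[OF gf] in \<open>auto simp: g_def\<close>)
  also have "\<dots> = finsum L (\<lambda>p. g (ImagRoot p)) F"
    by (rule M.finsum_reindex) (use family_closed[OF gf] in \<open>auto intro: inj_onI\<close>)
  also have "\<dots> = finsum L f F"
    by (rule M.finsum_cong') (use F(4) W_closed in \<open>auto simp: g_def\<close>)
  also have "\<dots> = finsum L k {RealRoot \<nu>}" using F(1) xc M.finsum_insert[of "{}" "RealRoot \<nu>" k] by (simp add: k_def)
  also have "\<dots> = finsum L k ?A"
    by (rule M.add.finprod_mono_neutral_cong_left) (use F(2) xc in \<open>auto simp: k_def\<close>)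
  finally have "finsum L g ?A = finsum L k ?A" .
  from expansion_unique[OF gf kf _ _ _ this] gsup ksup F(2) have "g = k" by blast
  then have "g (RealRoot \<nu>) = k (RealRoot \<nu>)" by simp
  then show False using assms(3) by (simp add: g_def k_def)
qed

lemma real_root_pairing:
  assumes "\<nu> \<in> real_roots D" "x \<in> W \<nu>" "x \<noteq> \<zero>" shows "\<exists>y\<in>W (- \<nu>). J' x y \<noteq> 0"
proof -
  have xc: "x \<in> carrier L" by (rule W_closed[OF assms(2)])
  obtain y where y: "y \<in> carrier L" "J' x y \<noteq> 0"
    using real_root_not_kernel[OF assms] xc unfolding form_kernel_def by blast
  obtain f where f: "family f" "y = finsum L f {i. f i \<noteq> \<zero>}" by (rule expansion[OF y(1)])
  have "J' x y = (\<Sum>i\<in>{i. f i \<noteq> \<zero>}. J' x (f i))"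
    unfolding f(2) by (rule J'_finsum) (use f(1) xc family_closed[OF f(1)] in \<open>auto simp: family_def\<close>)
  then obtain i where i: "f i \<noteq> \<zero>" "J' x (f i) \<noteq> 0" using y(2) by (metis (mono_tags, lifting) mem_Collect_eq sum.neutral)
  then have "i \<in> Ind" using f(1) by (auto simp: family_def)
  then have fi: "f i \<in> W (wt i)" using V_W f(1) by (auto simp: family_def)
  then have "\<nu> + wt i = 0" using W_orthogonal[OF assms(2) fi] i(2) by blast
  then have "wt i = - \<nu>" by (simp add: eq_neg_iff_add_eq_0 add.commute)
  then show ?thesis using fi i(2) by auto
qed

lemma real_root_line:
  assumes "\<nu> \<in> real_roots D"
  shows "\<exists>v\<in>W \<nu>. v \<noteq> \<zero> \<and> (\<forall>x\<in>W \<nu>. \<exists>c. x = c \<odot> v)"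
proof -
  have "one_dimensional L (W \<nu>)" using ui2 assms unfolding UI2_def by blast
  then obtain v where v: "v \<noteq> \<zero>" "v \<in> carrier L" "W \<nu> = {c \<odot> v | c. True}"
    unfolding one_dimensional_def by blast
  have "1 \<odot> v \<in> W \<nu>" unfolding v(3) by blast
  then have "v \<in> W \<nu>" using v(2) by simp
  then show ?thesis using v(1,3) by blast
qed

lemma W_parity:
  assumes "x \<in> W \<mu>" "y \<in> hpart L False" "z \<in> hpart L True" "x = y \<oplus> z"
  shows "y \<in> W \<mu> \<and> z \<in> W \<mu>"
proof -
  note c = hpart_carrier[OF assms(2)] hpart_carrier[OF assms(3)]
  have "bracket L (h \<sigma>) y = J \<sigma> \<mu> \<odot> y \<and> bracket L (h \<sigma>) z = J \<sigma> \<mu> \<odot> z" for \<sigma>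
  proof (rule parity_unique)
    show "bracket L (h \<sigma>) y \<in> hpart L False" "bracket L (h \<sigma>) z \<in> hpart L True"
      using bracket_hpart[OF h_even assms(2)] bracket_hpart[OF h_even assms(3)] by simp_all
    show "J \<sigma> \<mu> \<odot> y \<in> hpart L False" "J \<sigma> \<mu> \<odot> z \<in> hpart L True"
      using submoduleE(4)[OF hpart_submodule] assms(2,3) by simp_all
    show "bracket L (h \<sigma>) y \<oplus> bracket L (h \<sigma>) z = J \<sigma> \<mu> \<odot> y \<oplus> J \<sigma> \<mu> \<odot> z"
      using W_eigen[OF assms(1), of \<sigma>] c unfolding assms(4) by (simp add: bracket_add_right smult_add_right)
  qed
  then show ?thesis using c by (simp add: weight_space_def)
qed

text \<open>For odd \<open>v\<close> of weight \<open>\<nu>\<close> the square \<open>[v, v]\<close> has the weight \<open>2 \<nu>\<close>, which is not a root. The Jacobi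
identity then gives \<open>[v, [v, y]] = 0\<close>, whereas \<open>[v, y]\<close> is a nonzero multiple of \<open>h\<^sub>\<nu>\<close> for suitable
\<open>y\<close>.\<close>

lemma odd_real_vector_zero:
  assumes "\<nu> \<in> real_roots D" "v \<in> W \<nu>" "v \<in> hpart L True" shows "v = \<zero>"
proof (rule ccontr)
  assume nz: "v \<noteq> \<zero>"
  obtain y where y: "y \<in> W (- \<nu>)" "J' v y \<noteq> 0" using real_root_pairing[OF assms(1,2) nz] by blast
  note c = W_closed[OF assms(2)] W_closed[OF y(1)]
  have vv: "bracket L v v = \<zero>"
    by (rule W_trivial[OF W_bracket[OF assms(2,2)]]) (use N_nz real_root_norm[OF assms(1)] in \<open>simp_all add: form_add form_add_right\<close>)
  have "bracket L v (bracket L v y) = \<zero>"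
  proof (rule eq_minus_zero)
    have "bracket L v (bracket L v y) = bracket L (bracket L v v) y \<oplus> koszul_sign True True \<odot> bracket L v (bracket L v y)"
      by (rule bracket_jacobi[OF assms(3,3) c(2)])
    also have "\<dots> = (- 1) \<odot> bracket L v (bracket L v y)"
      unfolding vv using c by (simp add: koszul_sign_def)
    finally show "bracket L v (bracket L v y) = (- 1) \<odot> bracket L v (bracket L v y)" .
  qed (use c in simp)
  moreover have "bracket L v (bracket L v y) = (- 1) \<odot> (J' v y * N \<odot> v)"
    unfolding W_bracket_opposite[OF assms(2) y(1)] bracket_even_skew[OF h_even c(1)] W_eigen[OF assms(2)]
    using real_root_norm[OF assms(1)] by (simp add: form_scl)
  ultimately show False
    using smult_eq_zero[of v "(- 1) * (J' v y * N)"] smult_smult[OF c(1)] nz y(2) N_nz c(1) by simp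
qed

lemma real_root_even: assumes "\<nu> \<in> real_roots D" "x \<in> W \<nu>" shows "x \<in> hpart L False"
proof -
  obtain y z where yz: "y \<in> hpart L False" "z \<in> hpart L True" "x = y \<oplus> z"
    by (rule parity_cases[OF W_closed[OF assms(2)]])
  then have "z = \<zero>" using odd_real_vector_zero[OF assms(1)] W_parity[OF assms(2) yz] by blast
  then show ?thesis using yz hpart_carrier[OF yz(1)] by simp
qed

lemma lie_generate_subset:
  assumes "sub_lie_superalgebra U L" "range h \<subseteq> U" "\<And>\<nu>. \<nu> \<in> real_roots D \<Longrightarrow> W \<nu> \<subseteq> U"
  shows "carrier L \<subseteq> U"
proof -
  have "lie_generate L (range h \<union> (\<Union>\<nu>\<in>real_roots D. W \<nu>)) \<subseteq> U"
    unfolding lie_generate_def using assms by (intro Inter_lower) auto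
  then show ?thesis using ui3 unfolding UI3_def by simp
qed

lemma carrier_even: "carrier L = hpart L False"
proof
  have "sub_lie_superalgebra (hpart L False) L"
    unfolding sub_lie_superalgebra_def
  proof (intro conjI ballI)
    fix x assume x: "x \<in> hpart L False"
    show "\<exists>y\<in>hpart L False \<inter> hpart L False. \<exists>z\<in>hpart L False \<inter> hpart L True. x = y \<oplus> z"
      using x hpart_zero hpart_carrier[OF x] by (intro bexI[of _ x] bexI[of _ \<zero>]) auto
    fix y assume "y \<in> hpart L False"
    then show "bracket L x y \<in> hpart L False" using bracket_hpart[OF x] by simp
  qed (rule hpart_submodule)
  then show "carrier L \<subseteq> hpart L False"
    by (rule lie_generate_subset) (use h_even real_root_even in auto)
qed (use hpart_carrier in auto)

lemma odd_trivial: "hpart L True = {\<zero>}"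
proof
  show "hpart L True \<subseteq> {\<zero>}"
  proof
    fix x assume x: "x \<in> hpart L True"
    then have "x \<in> hpart L False" using hpart_carrier carrier_even by blast
    have "x \<oplus> \<zero> = \<zero> \<oplus> x" using hpart_carrier[OF x] by simp
    from conjunct1[OF parity_unique[OF \<open>x \<in> hpart L False\<close> hpart_zero hpart_zero x this]]
    show "x \<in> {\<zero>}" by (rule ssubst) simp
  qed
qed (use hpart_zero in simp)

sublocale even_lie L
  by unfold_locales (rule odd_trivial)

end

section \<open>Normalised root vectors\<close>

locale ui_model = ui_algebra D L h J' + even_lie_model L emb
  for D :: "'e::ab_group_add base_system" and L :: "'b lsalg" (structure) and h J' emb
begin

lemma J'_sym: "x \<in> carrier L \<Longrightarrow> y \<in> carrier L \<Longrightarrow> J' x y = J' y x"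
proof -
  assume xy: "x \<in> carrier L" "y \<in> carrier L"
  have "J' x y = koszul_sign False False * J' y x"
    using J'_inv xy unfolding invariant_form_def carrier_even by blast
  then show ?thesis by (simp add: koszul_sign_def)
qed

lemma emb_power: "e \<in> carrier L \<Longrightarrow> x \<in> carrier L \<Longrightarrow>
    (bracket L e ^^ m) x \<in> carrier L \<and> emb ((bracket L e ^^ m) x) = (brF (emb e) ^^ m) (emb x)"
proof (induction m)
  case (Suc m)
  then show ?case using brF_emb[of e "(bracket L e ^^ m) x"] by simp
qed simp

lemma W_power: "e \<in> W \<mu> \<Longrightarrow> x \<in> W \<nu> \<Longrightarrow> (bracket L e ^^ m) x \<in> W (\<nu> + scl D (of_nat m) \<mu>)"
proof (induction m)
  case (Suc m)
  have "\<mu> + (\<nu> + scl D (of_nat m) \<mu>) = \<nu> + scl D (of_nat (Suc m)) \<mu>"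
    by (simp add: scale_left_distrib)
  then show ?case using W_bracket[OF Suc.prems(1) Suc.IH[OF Suc.prems]] by (simp only: funpow.simps comp_apply)
qed simp

text \<open>The value \<open>2 / N\<close> makes the bracket of the two vectors equal to the coroot (\<open>pair_bracket\<close>).\<close>

definition pair :: "'e \<Rightarrow> 'b \<Rightarrow> 'b \<Rightarrow> bool" where
  "pair \<mu> e f \<longleftrightarrow> J \<mu> \<mu> = N \<and> e \<in> W \<mu> \<and> f \<in> W (- \<mu>) \<and> J' e f = 2 / N"

lemma pair_sym: "pair \<mu> e f \<Longrightarrow> pair (- \<mu>) f e"
  using J'_sym[of f e] W_closed[of f] W_closed[of e] by (auto simp: pair_def)

lemma pair_nonzero: "pair \<mu> e f \<Longrightarrow> e \<noteq> \<zero>"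
  using N_nz J'_smult(1)[of \<zero> f 0] W_closed[of f] by (auto simp: pair_def)

lemma pair_bracket: "pair \<mu> e f \<Longrightarrow> bracket L e f = h (coroot D \<mu>)"
  using W_bracket_opposite[of e \<mu> f] by (simp add: pair_def coroot_def)

lemma pair_exists: assumes "\<mu> \<in> real_roots D" shows "\<exists>e f. pair \<mu> e f"
proof -
  obtain e where e: "e \<in> W \<mu>" "e \<noteq> \<zero>" using real_root_line[OF assms] by blast
  obtain y where y: "y \<in> W (- \<mu>)" "J' e y \<noteq> 0" using real_root_pairing[OF assms e] by blast
  have "pair \<mu> e ((2 / (N * J' e y)) \<odot> y)"
    using e y W_smult[OF y(1)] N_nz real_root_norm[OF assms] W_closed[OF e(1)] W_closed[OF y(1)]
    by (simp add: pair_def J'_smult)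
  then show ?thesis by blast
qed

text \<open>The weight \<open>\<nu> - \<mu>\<close> is too long to be a root, so \<open>x\<close> is a lowest weight vector for the \<open>sl\<^sub>2\<close> of \<open>\<mu>\<close>.\<close>

lemma pair_raise_nonzero:
  assumes p: "pair \<mu> e f" and x: "x \<in> W \<nu>" "x \<noteq> \<zero>" and n: "J \<nu> \<nu> = N"
    and m: "J (coroot D \<mu>) \<nu> = - of_nat m" "0 < m"
  shows "(bracket L e ^^ m) x \<noteq> \<zero>"
proof
  assume z: "(bracket L e ^^ m) x = \<zero>"
  have e: "e \<in> W \<mu>" "e \<in> carrier L" and f: "f \<in> W (- \<mu>)" "f \<in> carrier L" and \<mu>: "J \<mu> \<mu> = N"
    using p W_closed by (auto simp: pair_def)
  note xc = W_closed[OF x(1)]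
  have co: "coroot D \<mu> = scl D (2 / N) \<mu>" by (simp add: coroot_def \<mu>)
  have J\<mu>\<nu>: "J \<mu> \<nu> = - (N / 2 * of_nat m)" using m(1) N_nz by (simp add: co form_scl field_simps)
  have "J (- \<mu> + \<nu>) (- \<mu> + \<nu>) = N * of_nat (m + 2)"
    using J\<mu>\<nu> \<mu> n form_sym[of \<nu> \<mu>] by (simp add: form_add form_add_right form_diff ring_distribs)
  moreover have "N * of_nat (m + 2) \<noteq> 0"
    using N_nz unfolding mult_eq_0_iff of_nat_eq_0_iff by simp
  moreover have "N * of_nat (m + 2) \<noteq> N * of_nat 1"
    using N_nz unfolding mult_cancel_left of_nat_eq_iff by simp
  ultimately have fx: "bracket L f x = \<zero>"
    by (intro W_trivial[OF W_bracket[OF f(1) x(1)]]) (simp_all only: of_nat_1 mult_1_right not_False_eq_True)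
  let ?h = "emb (h (coroot D \<mu>))"
  have "emb x = 0"
  proof (rule F.sl2_raising_injective)
    show "brF (emb e) (emb f) = ?h" using pair_bracket[OF p] by (simp add: brF_emb e f)
    have 2: "J (coroot D \<mu>) \<mu> = 2" "J (coroot D \<mu>) (- \<mu>) = - 2" using N_nz by (simp_all add: co form_scl \<mu>)
    show "brF ?h (emb e) = psc 2 (emb e)"
      by (simp only: brF_emb[OF h_closed e(2)] W_eigen[OF e(1)] emb_smult[OF e(2)] 2)
    show "brF ?h (emb f) = psc (- 2) (emb f)"
      by (simp only: brF_emb[OF h_closed f(2)] W_eigen[OF f(1)] emb_smult[OF f(2)] 2)
    show "brF ?h (emb x) = psc (- of_nat m) (emb x)"
      by (simp only: brF_emb[OF h_closed xc] W_eigen[OF x(1)] emb_smult[OF xc] m(1))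
    show "F.ad_nil (emb f) (emb x)"
      by (rule F.ad_nilI[of 1]) (simp add: brF_emb f xc fx emb_zero)
    show "(brF (emb e) ^^ m) (emb x) = 0" using emb_power[OF e(2) xc, of m] z emb_zero by simp
  qed
  then show False using emb_inj[OF xc M.zero_closed] emb_zero x(2) by simp
qed

lemma pair_ladder:
  assumes p: "pair \<mu> e f" and x: "x \<in> W \<nu>" and n: "J \<nu> \<nu> = N" and m: "J \<mu> \<nu> = - (N / 2)"
  shows "bracket L f (bracket L e x) = x"
proof -
  have e: "e \<in> W \<mu>" "e \<in> carrier L" and f: "f \<in> W (- \<mu>)" "f \<in> carrier L" and \<mu>: "J \<mu> \<mu> = N"
    using p W_closed by (auto simp: pair_def)
  note xc = W_closed[OF x]
  have "J (- \<mu> + \<nu>) (- \<mu> + \<nu>) = 3 * N"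
    using m \<mu> n form_sym[of \<nu> \<mu>] by (simp add: form_diff)
  then have fx: "bracket L f x = \<zero>"
    using N_nz by (intro W_trivial[OF W_bracket[OF f(1) x]]) auto
  have fe: "bracket L f e = h (coroot D (- \<mu>))" by (rule pair_bracket[OF pair_sym[OF p]])
  have "bracket L f (bracket L e x) = bracket L (bracket L f e) x \<oplus> bracket L e (bracket L f x)"
    by (rule jacobi_even) (use e f xc in auto)
  also have "\<dots> = x" unfolding fx fe W_eigen[OF x]
    using e xc m N_nz \<mu> by (simp add: coroot_def form_scl)
  finally show ?thesis .
qed

definition chevalley :: "(nat \<Rightarrow> bool \<Rightarrow> 'b) \<Rightarrow> (nat \<Rightarrow> bool \<Rightarrow> 'b) \<Rightarrow> bool" where
  "chevalley e f \<longleftrightarrow> (\<forall>i\<le>l. \<forall>b. pair (root i b) (e i b) (f i b))"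

lemma chevalley_exists: "\<exists>e f. chevalley e f"
proof -
  have "\<exists>p. pair (root i b) (fst p) (snd p)" if "i \<le> l" for i b
    using pair_exists[OF root_real[OF that]] by auto
  then obtain p where p: "\<And>i b. i \<le> l \<Longrightarrow> pair (root i b) (fst (p i b)) (snd (p i b))" by metis
  then have "chevalley (\<lambda>i b. fst (p i b)) (\<lambda>i b. snd (p i b))" by (simp add: chevalley_def)
  then show ?thesis by blast
qed

context
  fixes e f i j
  assumes c: "chevalley e f" and i: "i \<le> l" and j: "j \<le> l" and near: "cartan_A l i j = -1"
begin

lemma pair_at: "k \<le> l \<Longrightarrow> pair (root k b) (e k b) (f k b)"
  using c by (simp add: chevalley_def)

lemma near_form: "J (root i b) (root j b') = - (N / 2)" "J (root j b') (root i b) = - (N / 2)"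
proof -
  have "cartan_A l j i = -1" using near by (subst cartan_A_sym)
  then show "J (root i b) (root j b') = - (N / 2)" "J (root j b') (root i b) = - (N / 2)"
    using near by (simp_all add: form_root i j)
qed

lemma near_lower_f: "bracket L (e j b) (bracket L (f j b) (f i b')) = f i b'"
  by (rule pair_ladder[OF pair_sym[OF pair_at[OF j]]]) (use pair_sym[OF pair_at[OF i]] near_form in \<open>auto simp: pair_def\<close>)

lemma ef_closed: "k \<le> l \<Longrightarrow> e k b \<in> carrier L" "k \<le> l \<Longrightarrow> f k b \<in> carrier L"
  using pair_at[of k b] W_closed by (auto simp: pair_def)

lemma near_pairing: "J' (bracket L (e i b) (e j b')) (bracket L (f i b) (f j b')) = - (2 / N)"
proof -
  note cl = ef_closed[OF i] ef_closed[OF j]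
  have "bracket L (f i b) (f j b') = (- 1) \<odot> bracket L (f j b') (f i b)" by (rule skew) (use cl in auto)
  then have "bracket L (e j b') (bracket L (f i b) (f j b')) = (- 1) \<odot> f i b"
    using cl by (simp only: bracket_smult_right[OF cl(3) bracket_mem] near_lower_f)
  then show ?thesis
    using cl pair_at[OF i, of b] by (simp add: J'_bracket J'_smult pair_def)
qed

text \<open>The two brackets on each side lie on a common line and are nonzero; both pairings between the sides
equal \<open>- 2 / N\<close> by \<open>near_pairing\<close>, so the two scalars are inverse to each other.\<close>

lemma star_scalar: "\<exists>c. c \<noteq> 0 \<and>
    bracket L (e i False) (e j True) = c \<odot> bracket L (e i True) (e j False) \<and>
    bracket L (f i False) (f j True) = inverse c \<odot> bracket L (f i True) (f j False)"
proof -
  note cl = ef_closed[OF i] ef_closed[OF j]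
  let ?\<mu> = "root i True + root j False"
  have \<mu>: "root i False + root j True = ?\<mu>" "- root i False + - root j True = - ?\<mu>" "- root i True + - root j False = - ?\<mu>"
    by (simp_all add: root_def algebra_simps)
  have real: "?\<mu> \<in> real_roots D" by (rule two_root_real[OF i j near])
  have eW: "e k b \<in> W (root k b)" "f k b \<in> W (- root k b)" if "k \<le> l" for k b
    using pair_at[OF that, of b] by (simp_all add: pair_def)
  have W: "bracket L (e i True) (e j False) \<in> W ?\<mu>" "bracket L (e i False) (e j True) \<in> W ?\<mu>"
    "bracket L (f i True) (f j False) \<in> W (- ?\<mu>)" "bracket L (f i False) (f j True) \<in> W (- ?\<mu>)"
    using W_bracket[OF eW(1)[OF i] eW(1)[OF j]] W_bracket[OF eW(2)[OF i] eW(2)[OF j]] \<mu> by metis+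
  have nz: "bracket L (e i b) (e j b') \<noteq> \<zero>" "bracket L (f i b) (f j b') \<noteq> \<zero>" for b b'
    using near_pairing[of b b'] N_nz J'_smult(1)[of \<zero> "bracket L (f i b) (f j b')" 0] J'_zero[of "bracket L (e i b) (e j b')"] cl
    by auto
  obtain v where v: "v \<in> W ?\<mu>" "v \<noteq> \<zero>" "\<And>x. x \<in> W ?\<mu> \<Longrightarrow> \<exists>c. x = c \<odot> v"
    using real_root_line[OF real] by blast
  obtain u where u: "u \<in> W (- ?\<mu>)" "u \<noteq> \<zero>" "\<And>x. x \<in> W (- ?\<mu>) \<Longrightarrow> \<exists>c. x = c \<odot> u"
    using real_root_line[OF real_root_minus[OF real]] by blast
  have vc: "v \<in> carrier L" "u \<in> carrier L" using v(1) u(1) W_closed by auto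
  obtain x y x' y' where s: "bracket L (e i True) (e j False) = x \<odot> v" "bracket L (e i False) (e j True) = y \<odot> v"
    "bracket L (f i True) (f j False) = x' \<odot> u" "bracket L (f i False) (f j True) = y' \<odot> u"
    using v(3)[OF W(1)] v(3)[OF W(2)] u(3)[OF W(3)] u(3)[OF W(4)] by blast
  have nzs: "x \<noteq> 0" "y \<noteq> 0" "x' \<noteq> 0" "y' \<noteq> 0"
    using nz(1)[of True False] nz(1)[of False True] nz(2)[of True False] nz(2)[of False True] vc unfolding s by auto
  have "x * (x' * J' v u) = - (2 / N)" "y * (y' * J' v u) = - (2 / N)"
    using near_pairing[of True False] near_pairing[of False True] vc unfolding s by (simp_all add: J'_smult mult.left_commute)
  then have "x * x' * J' v u = y * y' * J' v u" "J' v u \<noteq> 0" using N_nz by (simp_all only: mult.assoc) auto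
  then have xy: "x * x' = y * y'" by simp
  have "y \<odot> v = (y / x) \<odot> (x \<odot> v)" "y' \<odot> u = inverse (y / x) \<odot> (x' \<odot> u)"
    using nzs xy vc by (simp_all add: smult_smult field_simps)
  then show ?thesis unfolding s using nzs by (intro exI[of _ "y / x"]) auto
qed

end

text \<open>The cyclic diagram has the edges \<open>(k, k + 1)\<close> and \<open>(0, l)\<close>. Rescaling the starred vectors removes the
scalars along a spanning path; the product of all scalars around the cycle is invariant under
rescaling and survives as \<open>q\<close>.\<close>

definition normalized :: "(nat \<Rightarrow> bool \<Rightarrow> 'b) \<Rightarrow> (nat \<Rightarrow> bool \<Rightarrow> 'b) \<Rightarrow> complex \<Rightarrow> bool" where
  "normalized e f q \<longleftrightarrow> chevalley e f \<and> q \<noteq> 0 \<and>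
    (\<forall>k<l. bracket L (e k False) (e (Suc k) True) = bracket L (e k True) (e (Suc k) False)) \<and>
    (\<forall>k<l. bracket L (f k False) (f (Suc k) True) = bracket L (f k True) (f (Suc k) False)) \<and>
    bracket L (e 0 False) (e l True) = q \<odot> bracket L (e 0 True) (e l False) \<and>
    bracket L (f 0 False) (f l True) = inverse q \<odot> bracket L (f 0 True) (f l False)"

lemma normalized_generators: "\<exists>e f q. normalized e f q"
proof -
  obtain e f where ef: "chevalley e f" using chevalley_exists by blast
  have near: "cartan_A l k (Suc k) = -1" if "k < l" for k using that by (simp add: cartan_A_def)
  have near_l: "cartan_A l 0 l = -1" using rank_ge_2 by (simp add: cartan_A_def)
  have cl: "e k b \<in> carrier L" "f k b \<in> carrier L" if "k \<le> l" for k b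
    using ef that W_closed by (auto simp: chevalley_def pair_def)
  have "\<exists>c. c \<noteq> 0 \<and>
    bracket L (e k False) (e (Suc k) True) = c \<odot> bracket L (e k True) (e (Suc k) False) \<and>
    bracket L (f k False) (f (Suc k) True) = inverse c \<odot> bracket L (f k True) (f (Suc k) False)" if "k < l" for k
    by (rule star_scalar[OF ef _ _ near]) (use that in auto)
  then obtain c where c: "\<And>k. k < l \<Longrightarrow> c k \<noteq> 0"
    "\<And>k. k < l \<Longrightarrow> bracket L (e k False) (e (Suc k) True) = c k \<odot> bracket L (e k True) (e (Suc k) False)"
    "\<And>k. k < l \<Longrightarrow> bracket L (f k False) (f (Suc k) True) = inverse (c k) \<odot> bracket L (f k True) (f (Suc k) False)"
    by metis
  \<comment> \<open>the solution of \<open>t (k + 1) c k = t k\<close>, which makes every scalar on the path equal to \<open>1\<close>\<close>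
  define t where "t k = (\<Prod>m<k. inverse (c m))" for k
  have t: "t k \<noteq> 0" if "k \<le> l" for k unfolding t_def using c(1) that by (simp add: prod_zero_iff)
  have tc: "t (Suc k) * c k = t k" if "k < l" for k using c(1)[OF that] by (simp add: t_def)
  define e' where "e' k b = (if b then t k else 1) \<odot> e k b" for k b
  define f' where "f' k b = (if b then inverse (t k) else 1) \<odot> f k b" for k b
  have ch: "chevalley e' f'" unfolding chevalley_def
  proof (intro allI impI)
    fix k b assume k: "k \<le> l"
    then show "pair (root k b) (e' k b) (f' k b)" using ef t[OF k] cl[OF k]
      by (auto simp: chevalley_def pair_def e'_def f'_def W_smult J'_smult)
  qed
  have "bracket L (e' k False) (e' (Suc k) True) = bracket L (e' k True) (e' (Suc k) False)" if k: "k < l" for k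
  proof -
    have "bracket L (e' k False) (e' (Suc k) True) = (t (Suc k) * c k) \<odot> bracket L (e k True) (e (Suc k) False)"
      using cl k c(2)[OF k] by (simp add: e'_def bracket_smult_right smult_smult)
    then show ?thesis using cl k tc[OF k] by (simp add: e'_def bracket_smult_left)
  qed
  moreover have "bracket L (f' k False) (f' (Suc k) True) = bracket L (f' k True) (f' (Suc k) False)" if k: "k < l" for k
  proof -
    have "bracket L (f' k False) (f' (Suc k) True) = (inverse (t (Suc k)) * inverse (c k)) \<odot> bracket L (f k True) (f (Suc k) False)"
      using cl k c(3)[OF k] by (simp add: f'_def bracket_smult_right smult_smult)
    also have "inverse (t (Suc k)) * inverse (c k) = inverse (t k)" using tc[OF k] by (simp add: inverse_mult_distrib[symmetric])
    finally show ?thesis using cl k by (simp add: f'_def bracket_smult_left)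
  qed
  moreover obtain q where "q \<noteq> 0"
    "bracket L (e' 0 False) (e' l True) = q \<odot> bracket L (e' 0 True) (e' l False)"
    "bracket L (f' 0 False) (f' l True) = inverse q \<odot> bracket L (f' 0 True) (f' l False)"
    using star_scalar[OF ch _ _ near_l] by auto
  ultimately have "normalized e' f' q" using ch unfolding normalized_def by blast
  then show ?thesis by blast
qed

text \<open>The set of real roots whose root space lies in \<open>U\<close> is stable under the reflections in \<open>\<alpha>\<^sub>i\<close> and
\<open>\<alpha>\<^sub>i + a\<close>, because strings do not vanish.\<close>

lemma root_vectors_generate:
  assumes ch: "chevalley e f" and U: "submodule U complex_ring L"
    and br: "\<And>x y. x \<in> U \<Longrightarrow> y \<in> U \<Longrightarrow> bracket L x y \<in> U" and hU: "range h \<subseteq> U"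
    and ef: "\<And>i b. i \<le> l \<Longrightarrow> e i b \<in> U" "\<And>i b. i \<le> l \<Longrightarrow> f i b \<in> U"
  shows "carrier L \<subseteq> U"
proof -
  have smult: "c \<odot> x \<in> U" if "x \<in> U" for c x using submoduleE(4)[OF U, of c x] that by simp
  have Uc: "x \<in> carrier L" if "x \<in> U" for x using submoduleE(1)[OF U] that by blast
  have line: "W \<nu> \<subseteq> U" if nu: "\<nu> \<in> real_roots D" and x: "x \<in> W \<nu>" "x \<noteq> \<zero>" "x \<in> U" for \<nu> x
  proof
    fix y assume y: "y \<in> W \<nu>"
    obtain v where v: "v \<in> W \<nu>" "\<And>x. x \<in> W \<nu> \<Longrightarrow> \<exists>c. x = c \<odot> v"
      using real_root_line[OF nu] by blast
    obtain c d where cd: "x = c \<odot> v" "y = d \<odot> v" using v(2)[OF x(1)] v(2)[OF y] by blast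
    have "c \<noteq> 0" using cd(1) x(2) W_closed[OF v(1)] by auto
    then have "y = (d / c) \<odot> x" using cd W_closed[OF v(1)] by (simp add: smult_smult)
    then show "y \<in> U" using smult x(3) by simp
  qed
  have power: "(bracket L x ^^ m) y \<in> U" if "x \<in> U" "y \<in> U" for x y m
    using that by (induction m) (auto intro: br)
  have move: "W (\<nu> + scl D (of_nat m) \<mu>) \<subseteq> U"
    if "pair \<mu> x y" "x \<in> U" "\<nu> \<in> real_roots D" "W \<nu> \<subseteq> U" "J (coroot D \<mu>) \<nu> = - of_nat m" "0 < m"
      "\<nu> + scl D (of_nat m) \<mu> \<in> real_roots D" for \<mu> x y \<nu> m
  proof -
    obtain v where v: "v \<in> W \<nu>" "v \<noteq> \<zero>" using real_root_line[OF \<open>\<nu> \<in> real_roots D\<close>] by blast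
    have "x \<in> W \<mu>" using that(1) by (simp add: pair_def)
    then show ?thesis
      using line[OF that(7) W_power[OF _ v(1)] pair_raise_nonzero[OF that(1) v real_root_norm[OF that(3)] that(5,6)] power[OF that(2)]]
        v(1) that(4) by blast
  qed
  have pair_at: "pair (root i b) (e i b) (f i b)" if "i \<le> l" for i b using ch that by (simp add: chevalley_def)
  have "real_roots D \<subseteq> {\<nu>. W \<nu> \<subseteq> U}"
  proof (rule real_roots_induct)
    fix i b assume i: "i \<le> l"
    have "W (root i b) \<subseteq> U"
      by (rule line[OF root_real[OF i] _ pair_nonzero[OF pair_at[OF i, of b]] ef(1)[OF i]]) (use pair_at[OF i, of b] in \<open>simp add: pair_def\<close>)
    then show "root i b \<in> {\<nu>. W \<nu> \<subseteq> U}" by simp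
  next
    fix \<nu> i b k assume a: "\<nu> \<in> {\<nu>. W \<nu> \<subseteq> U}" "\<nu> \<in> real_roots D" "i \<le> l" "J (coroot D (root i b)) \<nu> = of_int k"
    have real: "\<nu> - scl D (of_int k) (root i b) \<in> real_roots D" by (rule root_reflection_real[OF a(2-4)])
    consider "k = 0" | m where "k = - int m" "0 < m" | m where "k = int m" "0 < m"
      by (cases k rule: int_cases3) auto
    then have "W (\<nu> - scl D (of_int k) (root i b)) \<subseteq> U"
    proof cases
      case 1 then show ?thesis using a(1) by simp
    next
      case 2
      have "\<nu> - scl D (of_int k) (root i b) = \<nu> + scl D (of_nat m) (root i b)" using 2 by simp
      then show ?thesis
        using move[OF pair_at[OF a(3), of b] ef(1)[OF a(3)] a(2), of m] a(1,4) 2 real by simp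
    next
      case 3
      have "\<nu> - scl D (of_int k) (root i b) = \<nu> + scl D (of_nat m) (- root i b)" using 3 by simp
      then show ?thesis
        using move[OF pair_sym[OF pair_at[OF a(3), of b]] ef(2)[OF a(3)] a(2), of m] a(1,4) 3 real by (simp add: coroot_minus)
    qed
    then show "\<nu> - scl D (of_int k) (root i b) \<in> {\<nu>. W \<nu> \<subseteq> U}" by simp
  qed
  moreover have "sub_lie_superalgebra U L"
    unfolding sub_lie_superalgebra_def
  proof (intro conjI ballI)
    fix x assume x: "x \<in> U"
    have "\<zero> \<in> U" using smult[OF x, of 0] Uc[OF x] by simp
    then show "\<exists>y\<in>U \<inter> hpart L False. \<exists>z\<in>U \<inter> hpart L True. x = y \<oplus> z"
      using x Uc[OF x] hpart_zero carrier_even by (intro bexI[of _ x] bexI[of _ \<zero>]) auto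
  qed (use U br in auto)
  ultimately show ?thesis using lie_generate_subset[OF _ hU] by blast
qed

end

section \<open>Invariant forms on \<open>g\<^sup>q\<close>\<close>

lemma cartan_A_adjacent:
  assumes "i \<le> l" "j \<le> l" "cartan_A l i j = -1"
  shows "j = Suc i \<or> i = Suc j \<or> i = 0 \<and> j = l \<or> i = l \<and> j = 0"
proof -
  have "j = (i + 1) mod (l + 1) \<or> i = (j + 1) mod (l + 1)"
    using assms(3) by (auto simp: cartan_A_def split: if_splits)
  then show ?thesis using assms(1,2) by (cases "i = l"; cases "j = l") auto
qed

context A11_base_system
begin

lemma r_root: "r i = root i False" "star D (root i False) = root i True"
  by (simp_all add: root_def star_def)

lemma form_root_split: "J s (root i b) = J s (r i) + of_bool b * J s a"
  by (simp add: root_def form_add_right)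

lemma r_inj: "i \<le> l \<Longrightarrow> j \<le> l \<Longrightarrow> r i = r j \<Longrightarrow> i = j"
  using root_inj[of i j False False] by (simp add: root_def)

lemma end_roots: "i \<le> l \<Longrightarrow> j \<le> l \<Longrightarrow> {r i, r j} = {r 0, r l} \<longleftrightarrow> i = 0 \<and> j = l \<or> i = l \<and> j = 0"
  using r_inj[of i 0] r_inj[of j l] r_inj[of i l] r_inj[of j 0] by (auto simp: doubleton_eq_iff)

lemma coroot_condition: "i \<le> l \<Longrightarrow> j \<le> l \<Longrightarrow> J (r i) (coroot D (r j)) = - 1 \<longleftrightarrow> cartan_A l i j = - 1"
proof -
  assume ij: "i \<le> l" "j \<le> l"
  have "J (r i) (coroot D (r j)) = of_int (cartan_A l i j)"
    using form_coroot_root[OF ij(2,1), of False False] form_sym[of "r i"] cartan_A_sym[of l i j]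
    by (simp add: r_root)
  moreover have "of_int (cartan_A l i j) = (- 1 :: complex) \<longleftrightarrow> of_int (cartan_A l i j) = (of_int (- 1) :: complex)" by simp
  ultimately show ?thesis unfolding of_int_eq_iff by simp
qed

lemma serre_exp_eq: "J (coroot D \<mu>) \<nu> = of_int k \<Longrightarrow> serre_exp D \<mu> \<nu> = (if k < 0 then nat (1 - k) else 1)"
  by (simp add: serre_exp_def Let_def)

lemma B_form: assumes "\<mu> \<in> B_all D" "\<nu> \<in> B_all D"
  shows "\<exists>k::int. J (coroot D \<mu>) \<nu> = of_int k" and "J \<mu> \<mu> = N"
proof -
  have n: "J (root i b) (root j b') = N / 2 * of_int (cartan_A l i j)" if "i \<le> l" "j \<le> l" for i j b b'
    using form_root that by blast
  show "J \<mu> \<mu> = N" using assms(1) by (cases rule: B_all_cases) (auto simp: form_root_same)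
  have c: "\<exists>k::int. J (coroot D (root i b)) (root j b') = of_int k" "\<exists>k::int. - J (coroot D (root i b)) (root j b') = of_int k"
    if "i \<le> l" "j \<le> l" for i j b b'
    using form_coroot_root[OF that] of_int_minus[of "cartan_A l i j", where 'a=complex] by metis+
  obtain i b where i: "i \<le> l" "\<mu> = root i b \<or> \<mu> = - root i b" using assms(1) by (rule B_all_cases) auto
  obtain j b' where j: "j \<le> l" "\<nu> = root j b' \<or> \<nu> = - root j b'" using assms(2) by (rule B_all_cases) auto
  show "\<exists>k::int. J (coroot D \<mu>) \<nu> = of_int k"
    using i(2) j(2) c[OF i(1) j(1), of b b'] by (elim disjE) (simp_all add: coroot_minus)
qed

end

locale gq_terms = A11_base_system D for D :: "'e::ab_group_add base_system" +
  fixes q :: complex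
  assumes q_nz: "q \<noteq> 0"
begin

abbreviation X where "X \<equiv> gq_generators D"
abbreviation R where "R \<equiv> gq_relations D q"
abbreviation cl where "cl \<equiv> lie_class X R"

lemma gens_mem [simp]: "HGen \<sigma> \<in> X" "EGen \<mu> \<in> X \<longleftrightarrow> \<mu> \<in> B_all D"
  by (auto simp: gq_generators_def)

lemma gen_terms: "gen_h \<sigma> \<in> lie_terms X" "\<mu> \<in> B_all D \<Longrightarrow> gen_e \<mu> \<in> lie_terms X"
  by simp_all

lemma gq_simps:
  "carrier (gq D q) = cl ` lie_terms X" "\<zero>\<^bsub>gq D q\<^esub> = cl Zero"
  "s \<in> lie_terms X \<Longrightarrow> t \<in> lie_terms X \<Longrightarrow> cl s \<oplus>\<^bsub>gq D q\<^esub> cl t = cl (Add s t)"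
  "t \<in> lie_terms X \<Longrightarrow> c \<odot>\<^bsub>gq D q\<^esub> cl t = cl (Smul c t)"
  "s \<in> lie_terms X \<Longrightarrow> t \<in> lie_terms X \<Longrightarrow> bracket (gq D q) (cl s) (cl t) = cl (Brk s t)"
  by (simp_all add: gq_def presented_lie_algebra_simps)

lemma gq_even: "even_lie (gq D q)"
  unfolding even_lie_def even_lie_axioms_def
  by (simp add: gq_def presented_lie_algebra_lie_superalgebra presented_lie_algebra_simps)

end

text \<open>That the generators \<open>E\<^sub>\<mu>\<close> do not collapse cannot be read off from the presentation; it will follow
from the map to \<open>L\<close>.\<close>

locale gq_model = gq_terms D q + even_lie_model "gq D q" emb
  for D :: "'e::ab_group_add base_system" and q emb +
  assumes gen_e_nz: "\<mu> \<in> B_all D \<Longrightarrow> lie_class (gq_generators D) (gq_relations D q) (gen_e \<mu>) \<noteq>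
    lie_class (gq_generators D) (gq_relations D q) Zero"
begin

definition val where "val t = emb (cl t)"

lemma cl_carrier [simp]: "t \<in> lie_terms X \<Longrightarrow> cl t \<in> carrier (gq D q)"
  by (simp add: gq_simps)

lemma val_hom:
  "s \<in> lie_terms X \<Longrightarrow> t \<in> lie_terms X \<Longrightarrow> val (Add s t) = val s + val t"
  "t \<in> lie_terms X \<Longrightarrow> val (Smul c t) = psc c (val t)"
  "s \<in> lie_terms X \<Longrightarrow> t \<in> lie_terms X \<Longrightarrow> val (Brk s t) = brF (val s) (val t)"
  "val Zero = 0"
  using emb_add[of "cl s" "cl t"] emb_smult[of "cl t" c] brF_emb[of "cl s" "cl t"] emb_zero
  by (simp_all add: val_def gq_simps)

lemma val_rel: "(s, t) \<in> R \<Longrightarrow> val s = val t"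
  unfolding val_def by (rule arg_cong[OF lie_class_eqI[OF lie_cong.rel]])

lemma val_pow: "s \<in> lie_terms X \<Longrightarrow> t \<in> lie_terms X \<Longrightarrow>
    (Brk s ^^ n) t \<in> lie_terms X \<and> val ((Brk s ^^ n) t) = (brF (val s) ^^ n) (val t)"
  by (induction n) (simp_all add: val_hom)

abbreviation hh where "hh \<sigma> \<equiv> val (gen_h \<sigma>)"
abbreviation ee where "ee \<mu> \<equiv> val (gen_e \<mu>)"

lemma hh_comb: "psc x (hh \<sigma>) + psc y (hh \<tau>) = hh (scl D x \<sigma> + scl D y \<tau>)"
  using val_rel[OF gq_relations.h_linear[of x \<sigma> y \<tau>]] by (simp add: val_hom)

lemma hh_ee: "\<mu> \<in> B_all D \<Longrightarrow> brF (hh \<sigma>) (ee \<mu>) = psc (J \<sigma> \<mu>) (ee \<mu>)"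
  using val_rel[OF gq_relations.h_e[of \<mu> D \<sigma>]] by (simp add: val_hom)

lemma serre_rel:
  assumes "\<mu> \<in> B_all D" "\<nu> \<in> B_all D" "\<mu> \<noteq> \<nu>" "\<mu> + \<nu> \<noteq> 0" "J (coroot D \<mu>) \<nu> = of_int k"
  shows "(brF (ee \<mu>) ^^ (if k < 0 then nat (1 - k) else 1)) (ee \<nu>) = 0"
  using val_rel[OF gq_relations.serre[OF assms(1-4)]] val_pow[OF gen_terms(2)[OF assms(1)] gen_terms(2)[OF assms(2)]]
  by (simp only: serre_exp_eq[OF assms(5)] val_hom)

lemma serre_root:
  assumes "i \<le> l" "j \<le> l" "i \<noteq> j \<or> b \<noteq> b'"
  shows "(brF (ee (root i b)) ^^ (if cartan_A l i j < 0 then 2 else 1)) (ee (root j b')) = 0"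
    "(brF (ee (- root i b)) ^^ (if cartan_A l i j < 0 then 2 else 1)) (ee (- root j b')) = 0"
proof -
  have n: "root i b \<noteq> root j b'" "root i b + root j b' \<noteq> 0"
    using root_inj[OF assms(1,2), of b b'] assms(3) root_neq_minus[OF assms(1,2), of b b'] eq_neg_iff_add_eq_0 by blast+
  then have m: "- root i b \<noteq> - root j b'" "- root i b + - root j b' \<noteq> 0"
    using n by (simp_all only: neg_equal_iff_equal minus_add_distrib[symmetric] neg_equal_0_iff_equal)
  have c: "(if cartan_A l i j < 0 then nat (1 - cartan_A l i j) else 1) = (if cartan_A l i j < 0 then 2 else 1)"
    using cartan_A_cases[of i j l] by (cases "i = j") auto
  show "(brF (ee (root i b)) ^^ (if cartan_A l i j < 0 then 2 else 1)) (ee (root j b')) = 0"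
    using serre_rel[OF root_B(1)[OF assms(1)] root_B(1)[OF assms(2)] n form_coroot_root[OF assms(1,2)]] unfolding c .
  show "(brF (ee (- root i b)) ^^ (if cartan_A l i j < 0 then 2 else 1)) (ee (- root j b')) = 0"
  proof -
    have "J (coroot D (- root i b)) (- root j b') = of_int (cartan_A l i j)"
      by (simp add: coroot_minus form_coroot_root assms)
    from serre_rel[OF root_B(2)[OF assms(1)] root_B(2)[OF assms(2)] m this] show ?thesis unfolding c .
  qed
qed

lemma serre_root_mixed:
  assumes "i \<le> l" "j \<le> l" "i \<noteq> j \<or> b \<noteq> b'"
  shows "(brF (ee (root i b)) ^^ (if i = j then 3 else 1)) (ee (- root j b')) = 0"
    "(brF (ee (- root i b)) ^^ (if i = j then 3 else 1)) (ee (root j b')) = 0"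
proof -
  have n: "root i b \<noteq> - root j b'" "root i b + - root j b' \<noteq> 0"
    using root_inj[OF assms(1,2), of b b'] assms(3) root_neq_minus[OF assms(1,2), of b b'] by auto
  have m: "- root i b \<noteq> root j b'" "- root i b + root j b' \<noteq> 0"
  proof -
    show "- root i b \<noteq> root j b'"
    proof
      assume "- root i b = root j b'"
      then have "- (- root i b) = - root j b'" by (rule arg_cong)
      then show False using n(1) by simp
    qed
    show "- root i b + root j b' \<noteq> 0"
    proof
      assume "- root i b + root j b' = 0"
      then have "root i b + (- root i b + root j b') = root i b" by simp
      then have "root j b' = root i b" by (simp only: add.assoc[symmetric] add.right_inverse add_0_left)
      then show False using n(2) by simp
    qed
  qed
  have c: "(if - cartan_A l i j < 0 then nat (1 - - cartan_A l i j) else 1) = (if i = j then 3 else 1)"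
    using cartan_A_cases[of i j l] by (cases "i = j") auto
  show "(brF (ee (root i b)) ^^ (if i = j then 3 else 1)) (ee (- root j b')) = 0"
  proof -
    have "J (coroot D (root i b)) (- root j b') = of_int (- cartan_A l i j)"
      by (simp add: form_coroot_root assms)
    from serre_rel[OF root_B(1)[OF assms(1)] root_B(2)[OF assms(2)] n this] show ?thesis unfolding c .
  qed
  show "(brF (ee (- root i b)) ^^ (if i = j then 3 else 1)) (ee (root j b')) = 0"
  proof -
    have "J (coroot D (- root i b)) (root j b') = of_int (- cartan_A l i j)"
      by (simp add: coroot_minus form_coroot_root assms)
    from serre_rel[OF root_B(2)[OF assms(1)] root_B(1)[OF assms(2)] m this] show ?thesis unfolding c .
  qed
qed

lemma star_ee:
  assumes "i \<le> l" "j \<le> l" "cartan_A l i j = - 1"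
  shows "F.star_related (\<lambda>i b. ee (root i b)) i j"
    "F.star_related (\<lambda>i b. ee (- root i b)) i j"
proof -
  have simple: "r i \<in> simple_roots D" "r j \<in> simple_roots D" using assms by (auto simp: simple_roots_def)
  have J: "J (r i) (coroot D (r j)) = - 1" using coroot_condition assms by simp
  have B: "root k b \<in> B_all D" "- root k b \<in> B_all D" if "k \<le> l" for k b using root_B that by auto
  consider "{r i, r j} \<noteq> {r 0, r l}" | "i = 0" "j = l" | "i = l" "j = 0"
    using end_roots[OF assms(1,2)] by blast
  then have "F.star_related (\<lambda>i b. ee (root i b)) i j \<and>
    F.star_related (\<lambda>i b. ee (- root i b)) i j"
  proof cases
    case 1
    show ?thesis
      using val_rel[OF gq_relations.star_pos[OF simple J 1]] val_rel[OF gq_relations.star_neg[OF simple J 1]] B assms(1,2)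
      unfolding F.star_related_def
      by (intro conjI exI[of _ 1]) (simp_all add: val_hom r_root)
  next
    case 2
    have "psc q (brF (ee (root 0 True)) (ee (root l False))) = brF (ee (root 0 False)) (ee (root l True))"
      "psc (inverse q) (brF (ee (- root 0 True)) (ee (- root l False))) = brF (ee (- root 0 False)) (ee (- root l True))"
      using val_rel[OF gq_relations.twist_pos] val_rel[OF gq_relations.twist_neg] B by (simp_all add: val_hom r_root)
    then show ?thesis unfolding 2 F.star_related_def using q_nz
      by (intro conjI exI[of _ "inverse q"] exI[of _ q]) (simp_all flip: \<open>psc q _ = _\<close> \<open>psc (inverse q) _ = _\<close>)
  next
    case 3
    have t: "psc q (brF (ee (root 0 True)) (ee (root l False))) = brF (ee (root 0 False)) (ee (root l True))"
      "psc (inverse q) (brF (ee (- root 0 True)) (ee (- root l False))) = brF (ee (- root 0 False)) (ee (- root l True))"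
      using val_rel[OF gq_relations.twist_pos] val_rel[OF gq_relations.twist_neg] B by (simp_all add: val_hom r_root)
    have "brF (ee (root l True)) (ee (root 0 False)) = - psc q (brF (ee (root 0 True)) (ee (root l False)))"
      "brF (ee (- root l True)) (ee (- root 0 False)) = - psc (inverse q) (brF (ee (- root 0 True)) (ee (- root l False)))"
      unfolding t by (rule F.br_skew)+
    then have "brF (ee (root l True)) (ee (root 0 False)) = psc q (brF (ee (root l False)) (ee (root 0 True)))"
      "brF (ee (- root l True)) (ee (- root 0 False)) = psc (inverse q) (brF (ee (- root l False)) (ee (- root 0 True)))"
      using F.br_skew[of "ee (root 0 True)" "ee (root l False)"] F.br_skew[of "ee (- root 0 True)" "ee (- root l False)"]
      by (simp_all add: psc.scale_minus_right)
    then show ?thesis unfolding 3 F.star_related_def using q_nz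
      by (intro conjI exI[of _ q] exI[of _ "inverse q"]) simp_all
  qed
  then show "F.star_related (\<lambda>i b. ee (root i b)) i j"
    "F.star_related (\<lambda>i b. ee (- root i b)) i j"
    by blast+
qed

lemma ee_nz: "\<mu> \<in> B_all D \<Longrightarrow> ee \<mu> \<noteq> 0"
  using gen_e_nz[of \<mu>] emb_inj[of "cl (gen_e \<mu>)" "cl Zero"] val_hom(4) by (simp add: val_def)

lemma elliptic: "elliptic_gens psc brF l hh (\<lambda>s i. J s (r i)) (\<lambda>s. J s a) (\<lambda>i b. coroot D (root i b))
    (\<lambda>i b. ee (root i b)) (\<lambda>i b. ee (- root i b))"
proof unfold_locales
  show "2 \<le> l" by (rule rank_ge_2)
  show "brF (hh s) (hh t) = 0" for s t
    using val_rel[OF gq_relations.h_h[of s t]] by (simp add: val_hom)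
  show "brF (ee (root i b)) (ee (- root i b)) = hh (coroot D (root i b))" if "i \<le> l" for i b
    using val_rel[OF gq_relations.e_f[OF root_B(3)[OF that]]] root_B that by (simp add: val_hom)
  fix i b s assume i: "i \<le> l"
  show "brF (hh s) (ee (root i b)) = psc (J s (r i) + of_bool b * J s a) (ee (root i b))"
    unfolding hh_ee[OF root_B(1)[OF i]] form_root_split ..
  show "brF (hh s) (ee (- root i b)) = psc (- (J s (r i) + of_bool b * J s a)) (ee (- root i b))"
    unfolding hh_ee[OF root_B(2)[OF i]] form_minus form_root_split ..
  show "J (coroot D (root i b)) a = 0" using i by (simp add: coroot_root form_scl)
  show "J (coroot D (root i b)) (r j) = of_int (cartan_A l i j)" if "j \<le> l" for j
    using form_coroot_root[OF i that, of b False] by (simp add: r_root)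
  show "ee (root i b) \<noteq> 0" "ee (- root i b) \<noteq> 0" using ee_nz root_B i by auto
  fix b'
  show "brF (ee (root i b)) (ee (root i b')) = 0"
    using serre_root(1)[OF i i, of b b'] by (cases "b = b'") (simp_all add: F.br_self)
  show "brF (ee (- root i b)) (ee (- root i b')) = 0"
    using serre_root(2)[OF i i, of b b'] by (cases "b = b'") (simp_all add: F.br_self)
  show "brF (ee (root i b)) (brF (ee (root i b)) (brF (ee (root i b)) (ee (- root i b')))) = 0" if "b \<noteq> b'"
    using serre_root_mixed(1)[OF i i, of b b'] that by (simp add: numeral_3_eq_3)
  show "brF (ee (- root i b)) (brF (ee (- root i b)) (brF (ee (- root i b)) (ee (root i b')))) = 0" if "b \<noteq> b'"
    using serre_root_mixed(2)[OF i i, of b b'] that by (simp add: numeral_3_eq_3)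
  fix j assume j: "j \<le> l"
  show "brF (ee (root i b)) (ee (- root j b')) = 0" if "i \<noteq> j"
    using serre_root_mixed(1)[OF i j, of b b'] that by simp
  show "brF (ee (root i b)) (ee (root j b')) = 0" if "cartan_A l i j = 0"
    using serre_root(1)[OF i j, of b b'] that by (cases "i = j") simp_all
  show "brF (ee (- root i b)) (ee (- root j b')) = 0" if "cartan_A l i j = 0"
    using serre_root(2)[OF i j, of b b'] that by (cases "i = j") simp_all
  show "brF (ee (root i b)) (brF (ee (root i b)) (ee (root j b'))) = 0" if "cartan_A l i j = -1"
    using serre_root(1)[OF i j, of b b'] that by (cases "i = j") (simp_all add: numeral_2_eq_2)
  show "brF (ee (- root i b)) (brF (ee (- root i b)) (ee (- root j b'))) = 0" if "cartan_A l i j = -1"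
    using serre_root(2)[OF i j, of b b'] that by (cases "i = j") (simp_all add: numeral_2_eq_2)
  show "F.star_related (\<lambda>i b. ee (root i b)) i j"
    "F.star_related (\<lambda>i b. ee (- root i b)) i j"
    if "cartan_A l i j = -1"
    using star_ee[OF i j that] by auto
qed

sublocale ell: elliptic_gens psc brF l hh "\<lambda>s i. J s (r i)" "\<lambda>s. J s a" "\<lambda>i b. coroot D (root i b)"
    "\<lambda>i b. ee (root i b)" "\<lambda>i b. ee (- root i b)"
  by (rule elliptic)

lemma val_alg: "t \<in> lie_terms X \<Longrightarrow> val t \<in> ell.alg"
proof (induction t)
  case (Gen x)
  then have "x \<in> gq_generators D" by simp
  then show ?case unfolding gq_generators_def
    using ell.alg_H ell.alg_e ell.alg_f by (auto elim: B_all_cases)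
qed (simp_all add: val_hom F.subspace_0 F.subspace_add F.subspace_scale ell.alg_subspace ell.alg_br)

text \<open>The difference \<open>C\<close> of the two forms vanishes on the Cartan subalgebra, so all \<open>E\<^sub>\<mu>\<close> belong to its
radical \<open>K\<close>. As \<open>K\<close> is an ideal, the sum of \<open>K\<close> and the Cartan subalgebra is a subalgebra that
contains the generators, hence everything, and \<open>C\<close> vanishes on it.\<close>

theorem model_forms_agree:
  assumes "invariant_form (gq D q) B1" "invariant_form (gq D q) B2"
    and h: "\<And>\<sigma> \<tau>. B1 (cl (gen_h \<sigma>)) (cl (gen_h \<tau>)) = B2 (cl (gen_h \<sigma>)) (cl (gen_h \<tau>))"
    and xy: "x \<in> carrier (gq D q)" "y \<in> carrier (gq D q)"
  shows "B1 x y = B2 x y"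
proof -
  define C where "C u v = B1 (toL u) (toL v) - B2 (toL u) (toL v)" for u v
  have add: "C u (v + v') = C u v + C u v'" "C (u + u') v = C u v + C u' v" for u u' v v'
    using assms(1,2) unfolding invariant_form_def bilinear_form_def by (simp_all add: C_def toL_add)
  have scl: "C u (psc c v) = c * C u v" "C (psc c u) v = c * C u v" for u v c
    using assms(1,2) unfolding invariant_form_def bilinear_form_def by (simp_all add: C_def toL_psc algebra_simps)
  have inv: "C (brF u v) v' = C u (brF v v')" for u v v'
    using assms(1,2) unfolding invariant_form_def by (simp add: C_def toL_brF)
  have sym: "C u v = C v u" for u v
  proof -
    have "B x y = koszul_sign False False * B y x" if "invariant_form (gq D q) B" "x \<in> carrier (gq D q)" "y \<in> carrier (gq D q)" for B x y
      using that even_part unfolding invariant_form_def by blast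
    from this[OF assms(1), of "toL u" "toL v"] this[OF assms(2), of "toL u" "toL v"] show ?thesis
      by (simp add: C_def koszul_sign_def)
  qed
  have H: "C (hh \<sigma>) (hh \<tau>) = 0" for \<sigma> \<tau> using h by (simp add: C_def val_def)
  have sep_z: "\<exists>s. J s a \<noteq> 0" using form_Lambda_a_a by (intro exI[of _ "Lambda_a D"]) simp
  \<comment> \<open>the two triangular decompositions enter here\<close>
  have e: "C (ee (root i b)) y = 0" if "i \<le> l" "y \<in> ell.alg" for i b y
    by (rule ell.form_vanishes_e[OF add scl inv H sep_z simple_root_separation that])
  have f: "C (ee (- root i b)) y = 0" if "i \<le> l" "y \<in> ell.alg" for i b y
    by (rule ell.form_vanishes_f[OF add scl inv H sep_z simple_root_separation that])
  have zero: "C 0 v = 0" for v using scl(2)[of 0 0 v] by simp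
  define K where "K = {u \<in> ell.alg. \<forall>v\<in>ell.alg. C u v = 0}"
  have K_add: "u + v \<in> K" if "u \<in> K" "v \<in> K" for u v
    using that F.subspace_add[OF ell.alg_subspace] by (auto simp: K_def add)
  have K_scl: "psc c u \<in> K" if "u \<in> K" for u c
    using that F.subspace_scale[OF ell.alg_subspace] by (auto simp: K_def scl)
  have K_br: "brF u v \<in> K" "brF v u \<in> K" if "u \<in> K" "v \<in> ell.alg" for u v
  proof -
    show *: "brF u v \<in> K" using that ell.alg_br by (auto simp: K_def inv)
    show "brF v u \<in> K" using K_scl[OF *, of "- 1"] F.br_skew[of v u] by simp
  qed
  define U where "U = {k + hh \<sigma> | k \<sigma>. k \<in> K}"
  have K0: "0 \<in> K" by (simp add: K_def zero F.subspace_0 ell.alg_subspace)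
  have hh_add: "hh \<sigma> + hh \<tau> = hh (\<sigma> + \<tau>)" for \<sigma> \<tau> using hh_comb[of 1 \<sigma> 1 \<tau>] by simp
  have hh_scl: "psc c (hh \<sigma>) = hh (scl D c \<sigma>)" for c \<sigma> using hh_comb[of c \<sigma> 0 \<sigma>] by simp
  have hh_zero: "hh 0 = 0" using hh_scl[of 0 0] by simp
  have KU: "k \<in> U" if "k \<in> K" for k
    unfolding U_def using that hh_zero by (intro CollectI exI[of _ k] exI[of _ 0]) simp
  have HU: "hh \<sigma> \<in> U" for \<sigma>
    unfolding U_def using K0 by (intro CollectI exI[of _ 0] exI[of _ \<sigma>]) simp
  have "ell.alg \<subseteq> U"
  proof
    fix u assume "u \<in> ell.alg"
    then show "u \<in> U"
    proof (rule ell.alg_least)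
      have "ee (root i b) \<in> K" "ee (- root i b) \<in> K" if "i \<le> l" for i b
        using e f ell.alg_e ell.alg_f that by (auto simp: K_def)
      then show "ell.gens \<subseteq> U" using KU HU by (auto simp: ell.gens_def)
      show "F.subspace U" unfolding F.subspace_def
      proof (intro conjI ballI allI)
        show "0 \<in> U" by (rule KU[OF K0])
        fix u assume "u \<in> U"
        then obtain k \<sigma> where u: "u = k + hh \<sigma>" "k \<in> K" by (auto simp: U_def)
        have "psc c u = psc c k + hh (scl D c \<sigma>)" for c by (simp add: u(1) psc.scale_right_distrib hh_scl)
        then show "psc c u \<in> U" for c unfolding U_def using K_scl[OF u(2)] by blast
        fix v assume "v \<in> U"
        then obtain k' \<tau> where v: "v = k' + hh \<tau>" "k' \<in> K" by (auto simp: U_def)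
        have "u + v = (k + k') + hh (\<sigma> + \<tau>)" by (simp add: u(1) v(1) hh_add[symmetric] add_ac)
        then show "u + v \<in> U" unfolding U_def using K_add[OF u(2) v(2)] by blast
      qed
      fix u v assume "u \<in> U" "v \<in> U"
      then obtain k \<sigma> k' \<tau> where u: "u = k + hh \<sigma>" "k \<in> K" and v: "v = k' + hh \<tau>" "k' \<in> K" by (auto simp: U_def)
      have "brF u v = (brF k k' + brF k (hh \<tau>)) + brF (hh \<sigma>) k'"
        by (simp add: u v F.br_add_left F.br_add_right ell.HH add_ac)
      moreover have "k' \<in> ell.alg" using v by (simp add: K_def)
      ultimately have "brF u v \<in> K" using K_add K_br u(2) v(2) ell.alg_H by simp
      then show "brF u v \<in> U" by (rule KU)
    qed
  qed
  moreover have "C u v = 0" if uv: "u \<in> U" "v \<in> U" "v \<in> ell.alg" for u v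
  proof -
    obtain k \<sigma> k' \<tau> where u: "u = k + hh \<sigma>" "k \<in> K" and v: "v = k' + hh \<tau>" "k' \<in> K" using uv(1,2) by (auto simp: U_def)
    have "C u v = C k v + (C (hh \<sigma>) k' + C (hh \<sigma>) (hh \<tau>))" by (simp add: u v(1) add)
    also have "C (hh \<sigma>) k' = C k' (hh \<sigma>)" by (rule sym)
    also have "C k v + (C k' (hh \<sigma>) + C (hh \<sigma>) (hh \<tau>)) = 0"
      using u(2) v(2) uv(3) ell.alg_H by (simp add: K_def H)
    finally show ?thesis .
  qed
  moreover obtain s t where st: "x = cl s" "s \<in> lie_terms X" "y = cl t" "t \<in> lie_terms X"
    using xy by (auto simp: gq_simps)
  ultimately have "C (val s) (val t) = 0" using val_alg[OF st(2)] val_alg[OF st(4)] by blast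
  then show ?thesis using st by (simp add: C_def val_def)
qed

end

theorem (in gq_terms) invariant_forms_agree:
  assumes nz: "\<And>\<mu>. \<mu> \<in> B_all D \<Longrightarrow> cl (gen_e \<mu>) \<noteq> cl Zero"
    and B: "invariant_form (gq D q) B1" "invariant_form (gq D q) B2"
    and h: "\<And>\<sigma> \<tau>. B1 (cl (gen_h \<sigma>)) (cl (gen_h \<tau>)) = B2 (cl (gen_h \<sigma>)) (cl (gen_h \<tau>))"
    and xy: "x \<in> carrier (gq D q)" "y \<in> carrier (gq D q)"
  shows "B1 x y = B2 x y"
proof -
  interpret G: even_lie "gq D q" by (rule gq_even)
  obtain emb where "even_lie_model (gq D q) emb" using G.model_exists by blast
  then interpret gq_model D q emb
    unfolding gq_model_def gq_model_axioms_def using gq_terms_axioms nz by blast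
  show ?thesis by (rule model_forms_agree[OF B h xy])
qed

section \<open>The epimorphism\<close>

text \<open>With \<open>k = J(\<mu>\<^sup>\<or>, \<nu>)\<close> and \<open>n\<close> the exponent of the Serre relation, \<open>\<nu> + n \<mu>\<close> has squared length
\<open>N (1 + n (k + n))\<close>, and \<open>n (k + n)\<close> is positive: \<open>n\<close> is \<open>1 - k\<close> for negative \<open>k\<close>, and \<open>1\<close>
otherwise.\<close>

lemma (in A11_base_system) serre_weight_not_root:
  assumes "\<mu> \<in> B_all D" "\<nu> \<in> B_all D"
  shows "J (\<nu> + scl D (of_nat (serre_exp D \<mu> \<nu>)) \<mu>) (\<nu> + scl D (of_nat (serre_exp D \<mu> \<nu>)) \<mu>) \<notin> {0, N}"
proof -
  define n where "n = serre_exp D \<mu> \<nu>"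
  obtain k where k: "J (coroot D \<mu>) \<nu> = of_int k" using B_form(1)[OF assms(1,2)] by blast
  have N: "J \<mu> \<mu> = N" "J \<nu> \<nu> = N" using B_form(2) assms(1,2) by auto
  have J1: "J \<mu> \<nu> = N / 2 * of_int k"
    using k N N_nz by (simp add: form_coroot field_simps)
  have J2: "J \<nu> \<mu> = N / 2 * of_int k" using J1 form_sym[of \<nu> \<mu>] by simp
  have n: "n = (if k < 0 then nat (1 - k) else 1)" unfolding n_def by (rule serre_exp_eq[OF k])
  define d where "d = 1 + int n * (k + int n)"
  have "J (\<nu> + scl D (of_nat n) \<mu>) (\<nu> + scl D (of_nat n) \<mu>) =
      N + of_nat n * (N * of_int k) + of_nat n * (of_nat n * N)"
    by (simp add: form_add form_add_right form_scl form_scl_right N J1 J2) (simp add: field_simps)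
  also have "\<dots> = N * of_int d" by (simp add: d_def ring_distribs)
  finally have eq: "J (\<nu> + scl D (of_nat n) \<mu>) (\<nu> + scl D (of_nat n) \<mu>) = N * of_int d" .
  have "2 \<le> d"
  proof (cases "k < 0")
    case True
    then have "int n = 1 - k" by (simp add: n)
    then have "k + int n = 1" "2 \<le> int n" using True by simp_all
    then show ?thesis by (simp add: d_def)
  next
    case False then show ?thesis by (simp add: n d_def)
  qed
  then have "(of_int d :: complex) \<noteq> of_int 0" "(of_int d :: complex) \<noteq> of_int 1"
    unfolding of_int_eq_iff by simp_all
  then show ?thesis using eq N_nz unfolding n_def by simp
qed

locale ui_generators = ui_model D L h J' emb
  for D :: "'e::ab_group_add base_system" and L :: "'b lsalg" (structure) and h J' emb +
  fixes e f :: "nat \<Rightarrow> bool \<Rightarrow> 'b" and q :: complex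
  assumes norm: "normalized e f q"
begin

lemma chev: "chevalley e f" and q_nz: "q \<noteq> 0"
  and star_e: "k < l \<Longrightarrow> bracket L (e k False) (e (Suc k) True) = bracket L (e k True) (e (Suc k) False)"
  and star_f: "k < l \<Longrightarrow> bracket L (f k False) (f (Suc k) True) = bracket L (f k True) (f (Suc k) False)"
  and twist_e: "bracket L (e 0 False) (e l True) = q \<odot> bracket L (e 0 True) (e l False)"
  and twist_f: "bracket L (f 0 False) (f l True) = inverse q \<odot> bracket L (f 0 True) (f l False)"
  using norm unfolding normalized_def by blast+

sublocale gq_terms D q
  by unfold_locales (rule q_nz)

lemma root_pair: "i \<le> l \<Longrightarrow> pair (root i b) (e i b) (f i b)"
  using chev by (simp add: chevalley_def)

lemma ef_closed [simp]: "i \<le> l \<Longrightarrow> e i b \<in> carrier L" "i \<le> l \<Longrightarrow> f i b \<in> carrier L"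
  using root_pair[of i b] W_closed by (auto simp: pair_def)

text \<open>The root vectors as a function of the weight; well defined since the weights \<open>\<plusminus>\<alpha>\<^sub>i\<close>, \<open>\<plusminus>(\<alpha>\<^sub>i + a)\<close> are
pairwise different.\<close>

definition E :: "'e \<Rightarrow> 'b" where
  "E \<mu> = (SOME x. \<exists>i b. i \<le> l \<and> (\<mu> = root i b \<and> x = e i b \<or> \<mu> = - root i b \<and> x = f i b))"

lemma E_root: assumes "i \<le> l" shows "E (root i b) = e i b" "E (- root i b) = f i b"
proof -
  have 1: "(\<exists>i' b'. i' \<le> l \<and> (root i b = root i' b' \<and> x = e i' b' \<or> root i b = - root i' b' \<and> x = f i' b')) \<longleftrightarrow> x = e i b" for x
    using root_inj[OF assms] root_neq_minus[OF assms] assms by blast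
  have "- root i b = root i' b' \<longleftrightarrow> False" if "i' \<le> l" for i' b'
    using root_neq_minus[OF that assms, of b' b] by auto
  then have 2: "(\<exists>i' b'. i' \<le> l \<and> (- root i b = root i' b' \<and> x = e i' b' \<or> - root i b = - root i' b' \<and> x = f i' b')) \<longleftrightarrow> x = f i b" for x
    using root_inj[OF assms] assms neg_equal_iff_equal by blast
  show "E (root i b) = e i b" "E (- root i b) = f i b" unfolding E_def 1 2 by simp_all
qed

lemma E_W: "\<mu> \<in> B_all D \<Longrightarrow> E \<mu> \<in> W \<mu>"
proof (elim B_all_cases)
  fix i b assume "i \<le> l" "\<mu> = root i b"
  then show ?thesis using root_pair[of i b] by (simp add: E_root pair_def)
next
  fix i b assume "i \<le> l" "\<mu> = - root i b"
  then show ?thesis using root_pair[of i b] by (simp add: E_root pair_def)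
qed

lemma E_closed: "\<mu> \<in> B_all D \<Longrightarrow> E \<mu> \<in> carrier L"
  using E_W W_closed by blast

lemma E_nonzero: "\<mu> \<in> B_all D \<Longrightarrow> E \<mu> \<noteq> \<zero>"
proof (elim B_all_cases)
  fix i b assume "i \<le> l" "\<mu> = root i b"
  then show ?thesis using pair_nonzero[OF root_pair[of i b]] by (simp add: E_root)
next
  fix i b assume "i \<le> l" "\<mu> = - root i b"
  then show ?thesis using pair_nonzero[OF pair_sym[OF root_pair[of i b]]] by (simp add: E_root)
qed

definition gval :: "'e gen \<Rightarrow> 'b \<Rightarrow>\<^sub>0 complex" where
  "gval x = (case x of HGen \<sigma> \<Rightarrow> emb (h \<sigma>) | EGen \<mu> \<Rightarrow> if \<mu> \<in> B_all D then emb (E \<mu>) else 0)"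

abbreviation ev where "ev \<equiv> F.eval_term gval"

lemma ev_h: "ev (gen_h \<sigma>) = emb (h \<sigma>)"
  by (simp add: gval_def)

lemma ev_e: "\<mu> \<in> B_all D \<Longrightarrow> ev (gen_e \<mu>) = emb (E \<mu>)"
  by (simp add: gval_def)

lemma ev_root: "i \<le> l \<Longrightarrow> ev (gen_e (root i b)) = emb (e i b)" "i \<le> l \<Longrightarrow> ev (gen_e (- root i b)) = emb (f i b)"
  using ev_e root_B by (simp_all add: E_root del: F.eval_term.simps)

lemma ev_pow: "ev ((Brk s ^^ n) t) = (brF (ev s) ^^ n) (ev t)"
  by (induction n) simp_all

lemma star_relation:
  assumes "i \<le> l" "j \<le> l" "cartan_A l i j = - 1" "\<not> (i = 0 \<and> j = l \<or> i = l \<and> j = 0)"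
  shows "bracket L (e i True) (e j False) = bracket L (e i False) (e j True)"
    "bracket L (f i True) (f j False) = bracket L (f i False) (f j True)"
proof -
  consider "j = Suc i" | "i = Suc j" using cartan_A_adjacent[OF assms(1-3)] assms(4) by blast
  then have "bracket L (e i True) (e j False) = bracket L (e i False) (e j True) \<and>
    bracket L (f i True) (f j False) = bracket L (f i False) (f j True)"
  proof cases
    case 1 then show ?thesis using star_e[of i] star_f[of i] assms by simp
  next
    case 2
    have "bracket L (e i True) (e j False) = (- 1) \<odot> bracket L (e j False) (e i True)"
      "bracket L (e i False) (e j True) = (- 1) \<odot> bracket L (e j True) (e i False)"
      "bracket L (f i True) (f j False) = (- 1) \<odot> bracket L (f j False) (f i True)"
      "bracket L (f i False) (f j True) = (- 1) \<odot> bracket L (f j True) (f i False)"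
      by (rule skew; simp add: assms)+
    then show ?thesis using star_e[of j] star_f[of j] 2 assms by simp
  qed
  then show "bracket L (e i True) (e j False) = bracket L (e i False) (e j True)"
    "bracket L (f i True) (f j False) = bracket L (f i False) (f j True)" by blast+
qed

lemma simple_root_cases:
  assumes "\<alpha> \<in> simple_roots D" "\<beta> \<in> simple_roots D" "J \<alpha> (coroot D \<beta>) = - 1"
    "{\<alpha>, \<beta>} \<noteq> {r 0, r l}"
  obtains i j where "i \<le> l" "j \<le> l" "\<alpha> = root i False" "\<beta> = root j False" "cartan_A l i j = - 1"
    "\<not> (i = 0 \<and> j = l \<or> i = l \<and> j = 0)"
proof -
  obtain i j where ij: "i \<le> l" "j \<le> l" "\<alpha> = r i" "\<beta> = r j" using assms(1,2) by (auto simp: simple_roots_def)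
  show thesis
    by (rule that[OF ij(1,2)]) (use ij assms(3,4) coroot_condition[OF ij(1,2)] end_roots[OF ij(1,2)] in \<open>simp_all add: r_root\<close>)
qed

text \<open>The Serre relations hold because their weights are neither real roots nor isotropic, the remaining ones by the normalisation
of the root vectors.\<close>

lemma relations_hold: "(s, t) \<in> R \<Longrightarrow> ev s = ev t"
proof (induction rule: gq_relations.cases)
  case (h_linear x \<sigma> y \<tau>)
  then show ?case
    using h_comb[of x \<sigma> y \<tau>] emb_add[of "x \<odot> h \<sigma>" "y \<odot> h \<tau>"]
    by (simp add: gval_def emb_smult)
next
  case (h_h \<sigma> \<tau>)
  then show ?case by (simp add: gval_def brF_emb h_commute emb_zero)
next
  case (h_e \<mu> \<sigma>)
  then show ?case using W_eigen[OF E_W[OF h_e(3)], of \<sigma>] E_closed[OF h_e(3)]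
    by (simp add: gval_def brF_emb emb_smult)
next
  case (e_f \<mu>)
  then obtain i b where i: "i \<le> l" "\<mu> = root i b" by (auto simp: B_plus_root)
  show ?case unfolding e_f i(2) F.eval_term.simps(5) ev_root[OF i(1)] ev_h
    using pair_bracket[OF root_pair[OF i(1)]] i(1) by (simp add: brF_emb)
next
  case (serre \<mu> \<nu>)
  let ?n = "serre_exp D \<mu> \<nu>"
  have W: "(bracket L (E \<mu>) ^^ ?n) (E \<nu>) \<in> W (\<nu> + scl D (of_nat ?n) \<mu>)"
    by (rule W_power[OF E_W E_W]) (rule serre)+
  have "(bracket L (E \<mu>) ^^ ?n) (E \<nu>) = \<zero>"
    using serre_weight_not_root[OF serre(3,4)] by (intro W_trivial[OF W]) auto
  then have "(brF (emb (E \<mu>)) ^^ ?n) (emb (E \<nu>)) = 0"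
    using emb_power[OF E_closed[OF serre(3)] E_closed[OF serre(4)], of ?n] emb_zero by simp
  then show ?case unfolding serre(1,2) ev_pow ev_e[OF serre(3)] ev_e[OF serre(4)] by simp
next
  case (star_pos \<alpha> \<beta>)
  obtain i j where ij: "i \<le> l" "j \<le> l" "\<alpha> = root i False" "\<beta> = root j False" "cartan_A l i j = - 1"
    "\<not> (i = 0 \<and> j = l \<or> i = l \<and> j = 0)"
    using simple_root_cases[OF star_pos(3-6)] .
  show ?case unfolding star_pos(1,2) ij(3,4) r_root F.eval_term.simps(5) ev_root[OF ij(1)] ev_root[OF ij(2)]
    using star_relation(1)[OF ij(1,2,5,6)] ij(1,2) by (simp add: brF_emb)
next
  case (star_neg \<alpha> \<beta>)
  obtain i j where ij: "i \<le> l" "j \<le> l" "\<alpha> = root i False" "\<beta> = root j False" "cartan_A l i j = - 1"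
    "\<not> (i = 0 \<and> j = l \<or> i = l \<and> j = 0)"
    using simple_root_cases[OF star_neg(3-6)] .
  show ?case unfolding star_neg(1,2) ij(3,4) r_root F.eval_term.simps(5) ev_root[OF ij(1)] ev_root[OF ij(2)]
    using star_relation(2)[OF ij(1,2,5,6)] ij(1,2) by (simp add: brF_emb)
next
  case twist_pos
  show ?case unfolding twist_pos r_root F.eval_term.simps(4,5) ev_root[OF le0] ev_root[OF order_refl]
    using twist_e by (simp add: brF_emb emb_smult)
next
  case twist_neg
  show ?case unfolding twist_neg r_root F.eval_term.simps(4,5) ev_root[OF le0] ev_root[OF order_refl]
    using twist_f by (simp add: brF_emb emb_smult)
qed

definition eta :: "'e gen lie_term set \<Rightarrow> 'b" where
  "eta S = toL (ev (SOME t. t \<in> S))"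

lemma eta_cl: assumes "t \<in> lie_terms X" shows "eta (cl t) = toL (ev t)"
proof -
  have "(SOME s. s \<in> cl t) \<in> cl t" using lie_class_self[OF assms] by (rule someI)
  then have "lie_cong R t (SOME s. s \<in> cl t)" by (simp add: lie_class_def)
  then have "ev t = ev (SOME s. s \<in> cl t)" using F.eval_term_cong relations_hold by blast
  then show ?thesis by (simp add: eta_def)
qed

lemma eta_zero: "eta (cl Zero) = \<zero>"
  by (simp add: eta_cl toL_zero)

lemma eta_h: "eta (cl (gen_h \<sigma>)) = h \<sigma>"
  using eta_cl[OF gen_terms(1)] by (simp add: ev_h del: F.eval_term.simps)

lemma eta_e: "\<mu> \<in> B_all D \<Longrightarrow> eta (cl (gen_e \<mu>)) = E \<mu>"
  using eta_cl[OF gen_terms(2)] E_closed by (simp add: ev_e del: F.eval_term.simps)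

lemma eta_hom: "lie_hom (gq D q) L eta"
  unfolding lie_hom_def
proof (intro conjI ballI allI)
  show "eta \<in> carrier (gq D q) \<rightarrow> carrier L" by (auto simp: eta_def)
  fix x assume "x \<in> carrier (gq D q)"
  then obtain s where s: "x = cl s" "s \<in> lie_terms X" by (auto simp: gq_simps)
  show "eta (c \<odot>\<^bsub>gq D q\<^esub> x) = c \<odot> eta x" for c
    using s by (simp add: gq_simps eta_cl toL_psc)
  fix y assume "y \<in> carrier (gq D q)"
  then obtain t where t: "y = cl t" "t \<in> lie_terms X" by (auto simp: gq_simps)
  show "eta (x \<oplus>\<^bsub>gq D q\<^esub> y) = eta x \<oplus> eta y" using s t by (simp add: gq_simps eta_cl toL_add)
  show "eta (bracket (gq D q) x y) = bracket L (eta x) (eta y)" using s t by (simp add: gq_simps eta_cl toL_brF)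
next
  fix p show "eta ` hpart (gq D q) p \<subseteq> hpart L p"
  proof (cases p)
    case True
    then have "hpart (gq D q) p = {cl Zero}" by (simp add: gq_def presented_lie_algebra_simps)
    then show ?thesis using True eta_zero hpart_zero by simp
  next
    case False
    have "eta S \<in> hpart L False" for S using carrier_even toL_closed by (simp add: eta_def)
    then show ?thesis using False by auto
  qed
qed

lemma eta_epi: "lie_epi (gq D q) L eta"
  unfolding lie_epi_def
proof (intro conjI eta_hom subset_antisym)
  let ?U = "eta ` carrier (gq D q)"
  show "?U \<subseteq> carrier L" by (auto simp: eta_def)
  have U: "?U = (\<lambda>t. toL (ev t)) ` lie_terms X"
    using eta_cl by (auto simp: gq_simps image_iff)
  show "carrier L \<subseteq> ?U"
  proof (rule root_vectors_generate[OF chev])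
    have U_add: "x \<oplus> y \<in> ?U" if xy: "x \<in> ?U" "y \<in> ?U" for x y
    proof -
      obtain s t where st: "s \<in> lie_terms X" "t \<in> lie_terms X" "x = toL (ev s)" "y = toL (ev t)"
        using xy unfolding U by auto
      then have "x \<oplus> y = toL (ev (Add s t))" "Add s t \<in> lie_terms X" by (simp_all add: toL_add)
      then show ?thesis unfolding U by blast
    qed
    have U_smult: "c \<odot> x \<in> ?U" if x: "x \<in> ?U" for x c
    proof -
      obtain s where s: "s \<in> lie_terms X" "x = toL (ev s)" using x unfolding U by auto
      then have "c \<odot> x = toL (ev (Smul c s))" "Smul c s \<in> lie_terms X" by (simp_all add: toL_psc)
      then show ?thesis unfolding U by blast
    qed
    have cl: "x \<in> carrier L" if "x \<in> ?U" for x using that by (auto simp: eta_def)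
    have zero: "\<zero> \<in> ?U" using eta_zero by (auto simp: gq_simps image_iff intro!: bexI[of _ Zero])
    have minus: "\<ominus> x = (- 1) \<odot> x" if "x \<in> carrier L" for x
      by (rule M.minus_equality) (use add_smult_minus[OF that] that M.a_comm in auto)
    show "submodule ?U complex_ring L"
      by (rule submoduleI) (use U_add U_smult cl zero minus in auto)
    show "bracket L x y \<in> ?U" if xy: "x \<in> ?U" "y \<in> ?U" for x y
    proof -
      obtain s t where st: "s \<in> lie_terms X" "t \<in> lie_terms X" "x = toL (ev s)" "y = toL (ev t)"
        using xy unfolding U by auto
      then have "bracket L x y = toL (ev (Brk s t))" "Brk s t \<in> lie_terms X" by (simp_all add: toL_brF)
      then show ?thesis unfolding U by blast
    qed
    show "range h \<subseteq> ?U"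
    proof
      fix x assume "x \<in> range h"
      then obtain \<sigma> where x: "x = h \<sigma>" by blast
      show "x \<in> ?U" using imageI[OF imageI[OF gen_terms(1)[of \<sigma>], of cl], of eta]
        unfolding x eta_h gq_simps(1) .
    qed
    have E: "E \<mu> \<in> ?U" if "\<mu> \<in> B_all D" for \<mu>
      using imageI[OF imageI[OF gen_terms(2)[OF that], of cl], of eta]
      unfolding eta_e[OF that] gq_simps(1) .
    show "e i b \<in> ?U" "f i b \<in> ?U" if "i \<le> l" for i b
      using E[OF root_B(1)[OF that]] E[OF root_B(2)[OF that]] by (simp_all add: E_root that)
  qed
qed

lemma gen_e_nonzero: "\<mu> \<in> B_all D \<Longrightarrow> cl (gen_e \<mu>) \<noteq> cl Zero"
  using eta_e[of \<mu>] E_nonzero[of \<mu>] eta_zero by metis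

text \<open>It is zero outside the carrier, as the description of \<open>gq_form\<close> demands.\<close>

definition pullback where
  "pullback x y = (if x \<in> carrier (gq D q) \<and> y \<in> carrier (gq D q) then J' (eta x) (eta y) else 0)"

lemma pullback_invariant: "invariant_form (gq D q) pullback"
proof -
  interpret G: even_lie "gq D q" by (rule gq_even)
  have hom: "eta (x \<oplus>\<^bsub>gq D q\<^esub> y) = eta x \<oplus> eta y" "eta (c \<odot>\<^bsub>gq D q\<^esub> x) = c \<odot> eta x"
    "eta (bracket (gq D q) x y) = bracket L (eta x) (eta y)" "eta (c \<odot>\<^bsub>gq D q\<^esub> y) = c \<odot> eta y"
    if "x \<in> carrier (gq D q)" "y \<in> carrier (gq D q)" for x y c
    using eta_hom that unfolding lie_hom_def by blast+
  have c: "eta x \<in> carrier L" for x by (simp add: eta_def)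
  show ?thesis
    unfolding invariant_form_def bilinear_form_def
  proof (intro conjI ballI allI)
    fix x y z assume xyz: "x \<in> carrier (gq D q)" "y \<in> carrier (gq D q)" "z \<in> carrier (gq D q)"
    show "pullback (x \<oplus>\<^bsub>gq D q\<^esub> y) z = pullback x z + pullback y z"
      "pullback x (y \<oplus>\<^bsub>gq D q\<^esub> z) = pullback x y + pullback x z"
      using xyz c by (simp_all add: pullback_def hom J'_add)
    show "pullback (bracket (gq D q) x y) z = pullback x (bracket (gq D q) y z)"
      using xyz c G.bracket_closed by (simp add: pullback_def hom J'_bracket)
  next
    fix c x y assume "x \<in> carrier (gq D q)" "y \<in> carrier (gq D q)"
    then show "pullback (c \<odot>\<^bsub>gq D q\<^esub> x) y = c * pullback x y" "pullback x (c \<odot>\<^bsub>gq D q\<^esub> y) = c * pullback x y"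
      using c by (simp_all add: pullback_def hom J'_smult)
  next
    fix p r x y assume xy: "x \<in> hpart (gq D q) p" "y \<in> hpart (gq D q) r"
    then have xyc: "x \<in> carrier (gq D q)" "y \<in> carrier (gq D q)" using G.submoduleE(1)[OF G.hpart_submodule] by blast+
    show "pullback x y = koszul_sign p r * pullback y x"
    proof (cases "p \<and> r")
      case True
      then have "x = cl Zero" using xy by (simp add: gq_def presented_lie_algebra_simps)
      then have "eta x = \<zero>" using eta_zero by simp
      then show ?thesis using c J'_zero J'_sym[of \<zero> "eta y"] by (simp add: pullback_def)
    next
      case False
      then show ?thesis using J'_sym[OF c c] xyc by (auto simp: pullback_def koszul_sign_def)
    qed
  qed
qed

lemma pullback_h: "pullback (cl (gen_h \<sigma>)) (cl (gen_h \<tau>)) = J \<sigma> \<tau>"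
  using gen_terms(1) by (auto simp: pullback_def eta_h J'_h gq_simps)

text \<open>The generators do not vanish in \<open>g\<^sup>q\<close>, since their images in \<open>L\<close> do not; so the uniqueness theorem
applies.\<close>

lemma gq_form_pullback: "gq_form D q = pullback"
  unfolding gq_form_def
proof (rule the_equality)
  show "invariant_form (gq D q) pullback \<and>
    (\<forall>\<sigma> \<tau>. pullback (gq_h D q \<sigma>) (gq_h D q \<tau>) = J \<sigma> \<tau>) \<and>
    (\<forall>x y. x \<notin> carrier (gq D q) \<or> y \<notin> carrier (gq D q) \<longrightarrow> pullback x y = 0)"
    using pullback_invariant pullback_h by (auto simp: gq_h_def pullback_def)
next
  fix B assume B: "invariant_form (gq D q) B \<and>
    (\<forall>\<sigma> \<tau>. B (gq_h D q \<sigma>) (gq_h D q \<tau>) = J \<sigma> \<tau>) \<and>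
    (\<forall>x y. x \<notin> carrier (gq D q) \<or> y \<notin> carrier (gq D q) \<longrightarrow> B x y = 0)"
  have hB: "B (cl (gen_h \<sigma>)) (cl (gen_h \<tau>)) = pullback (cl (gen_h \<sigma>)) (cl (gen_h \<tau>))" for \<sigma> \<tau>
    using conjunct1[OF conjunct2[OF B]] unfolding pullback_h gq_h_def by blast
  show "B = pullback"
  proof (intro ext)
    fix x y
    show "B x y = pullback x y"
    proof (cases "x \<in> carrier (gq D q) \<and> y \<in> carrier (gq D q)")
      case True
      then show ?thesis
        using invariant_forms_agree[OF gen_e_nonzero conjunct1[OF B] pullback_invariant hB] by blast
    next
      case False
      then show ?thesis using B by (auto simp: pullback_def)
    qed
  qed
qed

end

theorem theorem5p2:
  fixes D :: "'e::ab_group_add base_system"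
    and L :: "'b lsalg"
    and h :: "'e \<Rightarrow> 'b"
    and J' :: "'b \<Rightarrow> 'b \<Rightarrow> complex"
  assumes "A11_base_system D"
    and "lie_superalgebra L"
    and "UI1 D L h"
    and "UI2 D L h"
    and "UI3 D L h"
    and "UI4 D L h J'"
  shows "\<exists>q \<eta>. q \<noteq> 0 \<and> lie_epi (gq D q) L \<eta> \<and>
    (\<forall>\<sigma>. \<eta> (gq_h D q \<sigma>) = h \<sigma>) \<and>
    (\<forall>x\<in>carrier (gq D q). \<forall>y\<in>carrier (gq D q). J' (\<eta> x) (\<eta> y) = gq_form D q x y)"
proof -
  interpret ui_algebra D L h J'
    using assms by (simp add: ui_algebra_def ui_algebra_axioms_def)
  obtain emb where "even_lie_model L emb" using model_exists by blast
  then interpret ui_model D L h J' emb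
    using ui_algebra_axioms by (simp add: ui_model_def)
  obtain e f q where "normalized e f q" using normalized_generators by blast
  then interpret ui_generators D L h J' emb e f q by unfold_locales
  show ?thesis
    by (intro exI[of _ q] exI[of _ eta])
      (simp add: q_nz eta_epi eta_h gq_h_def gq_form_pullback pullback_def)
qed

end
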